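(* Let $\lambda\in C^1([0,1]\times[0,\infty))$ with $\lambda>0$. Let $T>0$, and let $\rho_0\in L^\infty(0,1)$ and $u\in L^\infty(0,T)$ be nonnegative almost everywhere. Then the Cauchy problem $$\rho_t(t,x)+\big(\rho(t,x)\lambda(x,W(t))\big)_x=0,\quad W(t)=\int_0^1\rho(t,x)\,dx,\qquad 0\le t\le T,\ 0\le x\le 1,$$ $$\rho(0,x)=\rho_0(x)\ (0\le x\le 1),\qquad \rho(t,0)\lambda(0,W(t))=u(t)\ (0\le t\le T),$$ admits a unique weak solution $\rho\in C^0([0,T];L^1(0,1))\cap L^\infty((0,T)\times(0,1))$, and this solution is nonnegative almost everywhere in $[0,T]\times[0,1]$. Moreover, the weak solution $\rho$ even belongs to $C^0([0,T];L^p(0,1))$ for all $p\in[1,\infty)$.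
   Context: Weak solution: given $T>0$, $\rho_0\in L^\infty(0,1)$ and $u\in L^\infty(0,T)$, a weak solution of the Cauchy problem is a function $\rho\in C^0([0,T];L^1(0,1))\cap L^\infty((0,T)\times(0,1))$ such that, with $W(t):=\int_0^1\rho(t,x)\,dx$ (where $W(t)\ge 0$ for all $t$, so that $\lambda(x,W(t))$ is defined), for every $\tau\in[0,T]$ and every $\varphi\in C^1([0,\tau]\times[0,1])$ with $\varphi(\tau,x)=0$ for all $x\in[0,1]$ and $\varphi(t,1)=0$ for all $t\in[0,\tau]$, one has $$\int_0^\tau\!\int_0^1\rho(t,x)\big(\varphi_t(t,x)+\lambda(x,W(t))\varphi_x(t,x)\big)\,dx\,dt+\int_0^\tau u(t)\varphi(t,0)\,dt+\int_0^1\rho_0(x)\varphi(0,x)\,dx=0.$$ *)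

theory Defs
  imports "HOL-Analysis.Analysis"
begin

text \<open>
  Elements of Lebesgue spaces are represented by functions; equality in these spaces is
  equality almost everywhere and is written out where it is needed.
\<close>

definition Lp :: "real \<Rightarrow> real set \<Rightarrow> (real \<Rightarrow> real) \<Rightarrow> bool" where
  "Lp p S f \<longleftrightarrow> f \<in> borel_measurable (lebesgue_on S) \<and>
     integrable (lebesgue_on S) (\<lambda>x. \<bar>f x\<bar> powr p)"

definition Lp_norm :: "real \<Rightarrow> real set \<Rightarrow> (real \<Rightarrow> real) \<Rightarrow> real" where
  "Lp_norm p S f = (LINT x|lebesgue_on S. \<bar>f x\<bar> powr p) powr (1 / p)"

definition Linf :: "'a::euclidean_space set \<Rightarrow> ('a \<Rightarrow> real) \<Rightarrow> bool" where
  "Linf S f \<longleftrightarrow> f \<in> borel_measurable (lebesgue_on S) \<and>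
     (\<exists>C. AE x in lebesgue_on S. \<bar>f x\<bar> \<le> C)"

text \<open>The space \<open>C\<^sup>0([0,T]; L\<^sup>p(0,1))\<close>; \<open>\<rho> t\<close> is the function \<open>x \<mapsto> \<rho>(t,x)\<close>.\<close>

definition C0_Lp :: "real \<Rightarrow> real \<Rightarrow> (real \<Rightarrow> real \<Rightarrow> real) \<Rightarrow> bool" where
  "C0_Lp p T \<rho> \<longleftrightarrow>
     (\<forall>t\<in>{0..T}. Lp p {0<..<1} (\<rho> t)) \<and>
     (\<forall>t\<in>{0..T}. ((\<lambda>s. Lp_norm p {0<..<1} (\<lambda>x. \<rho> s x - \<rho> t x)) \<longlongrightarrow> 0) (at t within {0..T}))"

text \<open>
  \<open>f\<close> is \<open>C\<^sup>1\<close> on the rectangle \<open>A \<times> B\<close>, boundary included, with partial derivatives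
  \<open>f1\<close> and \<open>f2\<close>. Differentiability at boundary points is relative to \<open>A \<times> B\<close>. The partial
  derivatives are determined on \<open>A \<times> B\<close> when \<open>A\<close> and \<open>B\<close> are nondegenerate intervals.
\<close>

definition C1_rect ::
  "real set \<Rightarrow> real set \<Rightarrow> (real \<Rightarrow> real \<Rightarrow> real) \<Rightarrow> (real \<Rightarrow> real \<Rightarrow> real) \<Rightarrow> (real \<Rightarrow> real \<Rightarrow> real) \<Rightarrow> bool"
  where
  "C1_rect A B f f1 f2 \<longleftrightarrow>
     (\<forall>a\<in>A. \<forall>b\<in>B. ((\<lambda>(x, y). f x y) has_derivative (\<lambda>(h, k). f1 a b * h + f2 a b * k))
        (at (a, b) within A \<times> B)) \<and>
     continuous_on (A \<times> B) (\<lambda>(x, y). f1 x y) \<and>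
     continuous_on (A \<times> B) (\<lambda>(x, y). f2 x y)"

definition mass :: "(real \<Rightarrow> real \<Rightarrow> real) \<Rightarrow> real \<Rightarrow> real" where
  "mass \<rho> t = (LINT x|lebesgue_on {0<..<1}. \<rho> t x)"

text \<open>
  For \<open>\<tau> = 0\<close> the time derivative \<open>\<phi>t\<close> of a test function is not determined, but then it
  only occurs in an integral over the empty interval.
\<close>

definition weak_solution ::
  "(real \<Rightarrow> real \<Rightarrow> real) \<Rightarrow> real \<Rightarrow> (real \<Rightarrow> real) \<Rightarrow> (real \<Rightarrow> real) \<Rightarrow> (real \<Rightarrow> real \<Rightarrow> real) \<Rightarrow> bool"
  where
  "weak_solution lam T \<rho>0 u \<rho> \<longleftrightarrow>
     C0_Lp 1 T \<rho> \<and>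
     Linf ({0<..<T} \<times> {0<..<1}) (\<lambda>(t, x). \<rho> t x) \<and>
     (\<forall>t\<in>{0..T}. mass \<rho> t \<ge> 0) \<and>
     (\<forall>\<tau>\<in>{0..T}. \<forall>\<phi> \<phi>t \<phi>x.
        C1_rect {0..\<tau>} {0..1} \<phi> \<phi>t \<phi>x \<longrightarrow>
        (\<forall>x\<in>{0..1}. \<phi> \<tau> x = 0) \<longrightarrow>
        (\<forall>t\<in>{0..\<tau>}. \<phi> t 1 = 0) \<longrightarrow>
        (LINT t|lebesgue_on {0<..<\<tau>}. LINT x|lebesgue_on {0<..<1}.
            \<rho> t x * (\<phi>t t x + lam x (mass \<rho> t) * \<phi>x t x))
        + (LINT t|lebesgue_on {0<..<\<tau>}. u t * \<phi> t 0)
        + (LINT x|lebesgue_on {0<..<1}. \<rho>0 x * \<phi> 0 x) = 0)"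

end

theory Submission
  imports Defs
begin

text \<open>
  For a given mass \<open>W\<close> the velocity \<open>\<lambda>(x, W(t))\<close> generates characteristics, and particles carry
  the data along them. Their initial position, or minus their time of entry, labels the particles,
  so the data form a density \<open>g\<close> of labels that does not depend on \<open>W\<close>. Hence the mass at time \<open>t\<close>
  is the integral of \<open>g\<close> from \<open>-t\<close> to the label that is just leaving at \<open>1\<close>, and by Gronwall's
  inequality this is a Volterra contraction in \<open>W\<close>, whose fixed point yields the solution.
  Conversely, testing with \<open>\<theta>(t) \<kappa>(Y(t, x))\<close>, where \<open>Y\<close> is the foot of the characteristic through
  \<open>(t, x)\<close>, shows that a weak solution is determined by its own mass, which is therefore a fixed
  point as well.
\<close>

section \<open>Volterra equations\<close>

text \<open>The velocity is given on \<open>[0,1] \<times> [0,\<infinity>)\<close> only, but a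
  particle that enters at a positive time needs a fictitious start to the left of \<open>0\<close>,
  and the mass must stay in a compact range to give uniform constants. Both arguments of
  \<open>lam\<close> are therefore clamped. The price is a velocity that is Lipschitz but may have
  kinks at \<open>x = 0\<close> and \<open>x = 1\<close>, so classical C1 dependence on initial
  values does not apply. Yet test functions built from \<open>Y\<close> must be C1, even where
  characteristics have crossed \<open>0\<close>. The way out is an exact formula: the distance of
  two characteristics is its initial value times the exponential of the time integral of a
  difference quotient of the velocity. Since a kink is met at one instant only, this factor stays
  continuous up to the diagonal, where it becomes the derivative of the flow. The clamp for the mass
  is harmless for existence, because every density of labels bounded by \<open>B\<close> gives a
  mass of at most \<open>B * (T + 1)\<close>. A competing weak solution has no such bound
  beforehand; its mass is only continuous, hence bounded, so uniqueness uses a clamp that depends on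
  the two solutions compared.\<close>

lemma gronwall:
  fixes f :: "real \<Rightarrow> real"
  assumes cont: "continuous_on {0..T} f" and "K \<ge> 0"
    and le: "\<And>t. t \<in> {0..T} \<Longrightarrow> f t \<le> B + K * integral {0..t} f"
    and t: "t \<in> {0..T}"
  shows "f t \<le> B * exp (K * t)"
proof -
  define h where "h s = (B + K * integral {0..s} f) * exp (- K * s)" for s
  have deriv: "(h has_real_derivative (K * f s - K * (B + K * integral {0..s} f)) * exp (- K * s))
      (at s within {0..T})" if "s \<in> {0..T}" for s
    unfolding h_def
    by (auto intro!: derivative_eq_intros integral_has_real_derivative[OF cont that] simp: algebra_simps)
  have "h t \<le> h 0"
  proof (rule DERIV_nonpos_imp_decreasing_open[of 0 t h])
    show "0 \<le> t" using t by simp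
    show "continuous_on {0..t} h"
      by (rule continuous_on_subset[OF DERIV_continuous_on[OF deriv]]) (use t in auto)
    fix s assume s: "0 < s" "s < t"
    then have "s \<in> {0..T}" and at: "at s within {0..T} = at s"
      using t by (auto intro!: at_within_interior)
    then have "(h has_real_derivative (K * f s - K * (B + K * integral {0..s} f)) * exp (- K * s)) (at s)"
      using deriv[of s] unfolding at by blast
    moreover have "(K * f s - K * (B + K * integral {0..s} f)) * exp (- K * s) \<le> 0"
      using le[of s] s t \<open>K \<ge> 0\<close> by (intro mult_nonpos_nonneg) (auto simp: mult_left_mono)
    ultimately show "\<exists>y. (h has_real_derivative y) (at s) \<and> y \<le> 0" by blast
  qed
  then have "(B + K * integral {0..t} f) * exp (- K * t) \<le> B" by (simp add: h_def)
  then have "(B + K * integral {0..t} f) \<le> B * exp (K * t)"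
    by (simp add: exp_minus field_simps)
  with le[OF t] show ?thesis by linarith
qed

lemma continuous_on_clamp:
  fixes f :: "real \<Rightarrow> 'a::topological_space"
  assumes "continuous_on {0..T} f" "0 \<le> T"
  shows "continuous_on UNIV (\<lambda>t. f (max 0 (min T t)))"
  by (rule continuous_on_compose2[OF assms(1)]) (use assms in \<open>auto intro!: continuous_intros\<close>)


text \<open>In the norm \<open>sup exp (- k * t) * \<bar>f t\<bar>\<close> integration from
  \<open>0\<close> gains a factor \<open>1 / k\<close>, so the map contracts on the whole of
  \<open>[0,T]\<close> however large \<open>K\<close> and \<open>T\<close> are. Banach's theorem is
  applied to the weighted function \<open>z\<close>, with
  \<open>f t = exp (k * t) * z t\<close>.\<close>

lemma volterra_fixpoint:
  fixes \<Phi> :: "(real \<Rightarrow> real) \<Rightarrow> real \<Rightarrow> real"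
  assumes "T \<ge> 0" "K \<ge> 0"
    and cont: "\<And>f. continuous_on UNIV f \<Longrightarrow> continuous_on {0..T} (\<Phi> f)"
    and lip: "\<And>f g t. continuous_on UNIV f \<Longrightarrow> continuous_on UNIV g \<Longrightarrow> t \<in> {0..T} \<Longrightarrow>
      \<bar>\<Phi> f t - \<Phi> g t\<bar> \<le> K * integral {0..t} (\<lambda>s. \<bar>f s - g s\<bar>)"
  shows "\<exists>f. continuous_on UNIV f \<and> (\<forall>t\<in>{0..T}. \<Phi> f t = f t)"
proof -
  \<comment> \<open>The contraction factor will be \<open>K / k \<le> 1/2\<close>; the summand
    \<open>1\<close> keeps \<open>k\<close> positive when \<open>K = 0\<close>.\<close>
  define k where "k = 2 * K + 1"
  have k: "k > 0" "k \<ge> 2 * K" using \<open>K \<ge> 0\<close> by (auto simp: k_def)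
  \<comment> \<open>Banach's theorem is used on bounded continuous functions on the whole line,
    while the image under \<open>\<Phi>\<close> is continuous on \<open>[0,T]\<close>; composing
    with \<open>c\<close> extends it by constants.\<close>
  define c where "c t = max 0 (min T t)" for t
  have c: "c t \<in> {0..T}" for t using \<open>T \<ge> 0\<close> by (auto simp: c_def)
  have cid: "c t = t" if "t \<in> {0..T}" for t using that by (auto simp: c_def)
  have contc: "continuous_on A c" for A unfolding c_def by (intro continuous_intros)
  define U :: "(real \<Rightarrow>\<^sub>C real) \<Rightarrow> real \<Rightarrow> real" where "U z t = exp (k * t) * z t" for z t
  have contU: "continuous_on UNIV (U z)" for z
    unfolding U_def by (intro continuous_intros) auto
  define \<Psi> :: "(real \<Rightarrow>\<^sub>C real) \<Rightarrow> (real \<Rightarrow>\<^sub>C real)"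
    where "\<Psi> z = Bcontfun (\<lambda>t. exp (- k * c t) * \<Phi> (U z) (c t))" for z
  have cont\<Psi>: "continuous_on {0..T} (\<lambda>t. exp (- k * t) * \<Phi> (U z) t)" for z
    by (intro continuous_intros cont contU)
  have \<Psi>: "apply_bcontfun (\<Psi> z) t = exp (- k * c t) * \<Phi> (U z) (c t)" for z t
  proof -
    have "compact ((\<lambda>t. exp (- k * t) * \<Phi> (U z) t) ` {0..T})"
      by (intro compact_continuous_image cont\<Psi>) simp
    then obtain b where b: "\<And>s. s \<in> {0..T} \<Longrightarrow> norm (exp (- k * s) * \<Phi> (U z) s) \<le> b"
      by (metis (no_types, lifting) bounded_iff compact_imp_bounded imageI)
    have "(\<lambda>t. exp (- k * c t) * \<Phi> (U z) (c t)) \<in> bcontfun"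
    proof (rule bcontfun_normI)
      show "continuous_on UNIV (\<lambda>t. exp (- k * c t) * \<Phi> (U z) (c t))"
        by (rule continuous_on_compose2[OF cont\<Psi> contc]) (use c in auto)
    qed (rule b[OF c])
    then show ?thesis by (simp add: \<Psi>_def Bcontfun_inverse)
  qed
  have "dist (\<Psi> z) (\<Psi> z') \<le> 1/2 * dist z z'" for z z'
  proof (rule dist_bound)
    fix t
    define s where "s = c t"
    have s: "s \<in> {0..T}" using c by (simp add: s_def)
    have ptw: "\<bar>U z r - U z' r\<bar> \<le> dist z z' * exp (k * r)" for r
    proof -
      have "\<bar>U z r - U z' r\<bar> = exp (k * r) * dist (z r) (z' r)"
        unfolding U_def dist_real_def right_diff_distrib[symmetric] abs_mult by simp
      also have "\<dots> \<le> exp (k * r) * dist z z'"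
        by (intro mult_left_mono dist_bounded) auto
      finally show ?thesis by (simp add: mult.commute)
    qed
    have int: "((\<lambda>r. dist z z' * exp (k * r)) has_integral
        (dist z z' / k * exp (k * s) - dist z z' / k * exp (k * 0))) {0..s}"
      by (rule fundamental_theorem_of_calculus)
         (use s k in \<open>auto intro!: derivative_eq_intros simp flip: has_real_derivative_iff_has_vector_derivative\<close>)
    have "integral {0..s} (\<lambda>r. \<bar>U z r - U z' r\<bar>) \<le> integral {0..s} (\<lambda>r. dist z z' * exp (k * r))"
    proof (rule integral_le)
      show "(\<lambda>r. \<bar>U z r - U z' r\<bar>) integrable_on {0..s}"
        by (intro integrable_continuous_real continuous_intros continuous_on_subset[OF contU]) auto
    qed (use int ptw in auto)
    also have "\<dots> = dist z z' / k * exp (k * s) - dist z z' / k"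
      using integral_unique[OF int] by (simp del: integral_mult_right)
    also have "\<dots> \<le> dist z z' / k * exp (k * s)" using k by simp
    finally have *: "integral {0..s} (\<lambda>r. \<bar>U z r - U z' r\<bar>) \<le> dist z z' / k * exp (k * s)" .
    have "dist (\<Psi> z t) (\<Psi> z' t) = exp (- k * s) * \<bar>\<Phi> (U z) s - \<Phi> (U z') s\<bar>"
      unfolding \<Psi> s_def[symmetric] dist_real_def right_diff_distrib[symmetric] abs_mult by simp
    also have "\<dots> \<le> exp (- k * s) * (K * (dist z z' / k * exp (k * s)))"
      using lip[OF contU contU s, of z z'] mult_left_mono[OF * \<open>K \<ge> 0\<close>]
      by (intro mult_left_mono) auto
    also have "\<dots> = K / k * dist z z'" by (simp add: exp_minus)
    also have "\<dots> \<le> 1/2 * dist z z'"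
      using k by (intro mult_right_mono) (auto simp: field_simps)
    finally show "dist (\<Psi> z t) (\<Psi> z' t) \<le> 1/2 * dist z z'" .
  qed
  then have "\<exists>!z. \<Psi> z = z" by (intro banach_fix_type[of "1/2"]) auto
  then obtain z where z: "\<Psi> z = z" by blast
  have "\<Phi> (U z) t = U z t" if "t \<in> {0..T}" for t
    using \<Psi>[of z t] that unfolding z by (simp add: cid U_def exp_minus)
  with contU show ?thesis by blast
qed

section \<open>Characteristics\<close>

lemma integrable_const_indicator: "integrable lborel (\<lambda>s. k * indicator {a..b} (s :: real) :: real)"
  by (intro integrable_mult_right integrable_real_indicator) (auto simp: emeasure_lborel_Icc_eq)

text \<open>\<open>sl x x' w\<close> is a difference quotient of the velocity, with the derivative as its value at
  \<open>x = x'\<close>. Since \<open>\<Lambda>\<close> is extended by constants beyond \<open>[0,1]\<close>, it may jump at \<open>x = x' \<in> {0, 1}\<close>.\<close>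

locale velocity =
  fixes \<Lambda> :: "real \<Rightarrow> real \<Rightarrow> real" and sl :: "real \<Rightarrow> real \<Rightarrow> real \<Rightarrow> real" and c C L :: real
  assumes c_pos: "0 < c"
    and lower: "c \<le> \<Lambda> x w"
    and upper: "\<Lambda> x w \<le> C"
    and lip_w: "\<bar>\<Lambda> x w - \<Lambda> x w'\<bar> \<le> L * \<bar>w - w'\<bar>"
    and left: "x \<le> 0 \<Longrightarrow> \<Lambda> x w = \<Lambda> 0 w"
    and slope: "\<Lambda> x' w - \<Lambda> x w = sl x x' w * (x' - x)"
    and slope_bound: "\<bar>sl x x' w\<bar> \<le> L"
    and slope_cont: "x \<noteq> x' \<or> x \<notin> {0, 1} \<Longrightarrow> isCont (\<lambda>(p, q). sl p q w) (x, x')"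
    and slope_meas: "(\<lambda>(x, x', w). sl x x' w) \<in> borel_measurable borel"
begin

lemma L_nonneg: "0 \<le> L"
  using slope_bound[of 0 0 0] by linarith

lemma C_pos: "0 < C"
  using c_pos lower[of 0 0] upper[of 0 0] by linarith

lemma lip_x: "\<bar>\<Lambda> x w - \<Lambda> x' w\<bar> \<le> L * \<bar>x - x'\<bar>"
  unfolding slope abs_mult by (intro mult_right_mono slope_bound) simp

lemma lip: "\<bar>\<Lambda> x w - \<Lambda> x' w'\<bar> \<le> L * \<bar>x - x'\<bar> + L * \<bar>w - w'\<bar>"
  using lip_x[of x w x'] lip_w[of x' w w'] by linarith

lemma tendsto_\<Lambda>:
  assumes "(f \<longlongrightarrow> x) F" "(g \<longlongrightarrow> w) F"
  shows "((\<lambda>i. \<Lambda> (f i) (g i)) \<longlongrightarrow> \<Lambda> x w) F"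
proof -
  have "((\<lambda>i. L * \<bar>f i - x\<bar> + L * \<bar>g i - w\<bar>) \<longlongrightarrow> L * \<bar>x - x\<bar> + L * \<bar>w - w\<bar>) F"
    by (intro tendsto_intros assms)
  then have lim: "((\<lambda>i. L * \<bar>f i - x\<bar> + L * \<bar>g i - w\<bar>) \<longlongrightarrow> 0) F" by simp
  have ev: "\<forall>\<^sub>F i in F. norm (\<Lambda> (f i) (g i) - \<Lambda> x w) \<le> L * \<bar>f i - x\<bar> + L * \<bar>g i - w\<bar>"
    unfolding real_norm_def by (intro always_eventually allI lip)
  from Lim_null_comparison[OF ev lim] show ?thesis by (rule LIM_zero_cancel)
qed

lemma continuous_on_\<Lambda> [continuous_intros]:
  assumes "continuous_on S f" "continuous_on S g"
  shows "continuous_on S (\<lambda>x. \<Lambda> (f x) (g x))"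
  using assms unfolding continuous_on_def by (auto intro: tendsto_\<Lambda>)

end

section \<open>Characteristics for a prescribed continuous mass\<close>

locale flow = velocity +
  fixes T :: real and W :: "real \<Rightarrow> real"
  assumes T_pos: "0 < T" and cont_W: "continuous_on UNIV W"
begin

abbreviation cl :: "real \<Rightarrow> real" where "cl t \<equiv> max 0 (min T t)"

lemma cl: "cl t \<in> {0..T}"
  using T_pos by auto

lemma cl_id: "t \<in> {0..T} \<Longrightarrow> cl t = t"
  by auto

lemma cont_W' [continuous_intros]: "continuous_on S f \<Longrightarrow> continuous_on S (\<lambda>x. W (f x))"
  using continuous_on_compose2[OF cont_W] by blast

text \<open>The Picard map is of Volterra type with constant \<open>L\<close>, so the solution
  exists on all of \<open>[0,T]\<close> at once.\<close>

lemma path_exists: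
  "\<exists>f. continuous_on UNIV f \<and> (\<forall>t\<in>{0..T}. f t = y + integral {0..t} (\<lambda>s. \<Lambda> (f s) (W s)))"
proof -
  have int: "(\<lambda>s. \<Lambda> (f s) (W s)) integrable_on {0..t}" if "continuous_on UNIV f" for f :: "real \<Rightarrow> real" and t
    using that by (intro integrable_continuous_real continuous_intros continuous_on_subset[OF that]) auto
  have "\<exists>f. continuous_on UNIV f \<and> (\<forall>t\<in>{0..T}. y + integral {0..t} (\<lambda>s. \<Lambda> (f s) (W s)) = f t)"
  proof (rule volterra_fixpoint[OF _ L_nonneg])
    fix f :: "real \<Rightarrow> real" assume f: "continuous_on UNIV f"
    show "continuous_on {0..T} (\<lambda>t. y + integral {0..t} (\<lambda>s. \<Lambda> (f s) (W s)))"
      by (intro continuous_intros indefinite_integral_continuous_1 int f)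
    fix g :: "real \<Rightarrow> real" and t assume g: "continuous_on UNIV g" and t: "t \<in> {0..T}"
    have "\<bar>(y + integral {0..t} (\<lambda>s. \<Lambda> (f s) (W s))) - (y + integral {0..t} (\<lambda>s. \<Lambda> (g s) (W s)))\<bar>
        = norm (integral {0..t} (\<lambda>s. \<Lambda> (f s) (W s) - \<Lambda> (g s) (W s)))"
      by (simp add: integral_diff int f g)
    also have "\<dots> \<le> integral {0..t} (\<lambda>s. L * \<bar>f s - g s\<bar>)"
    proof (rule integral_norm_bound_integral)
      show "(\<lambda>s. \<Lambda> (f s) (W s) - \<Lambda> (g s) (W s)) integrable_on {0..t}"
        by (intro integrable_diff int f g)
      show "(\<lambda>s. L * \<bar>f s - g s\<bar>) integrable_on {0..t}"
        by (intro integrable_continuous_real continuous_intros)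
           (use f g continuous_on_subset in blast)+
    qed (use lip_x in auto)
    finally show "\<bar>(y + integral {0..t} (\<lambda>s. \<Lambda> (f s) (W s))) - (y + integral {0..t} (\<lambda>s. \<Lambda> (g s) (W s)))\<bar>
        \<le> L * integral {0..t} (\<lambda>s. \<bar>f s - g s\<bar>)" by simp
  qed (use T_pos in auto)
  then show ?thesis by metis
qed

definition path :: "real \<Rightarrow> real \<Rightarrow> real" where
  "path y = (SOME f. continuous_on UNIV f \<and>
      (\<forall>t\<in>{0..T}. f t = y + integral {0..t} (\<lambda>s. \<Lambda> (f s) (W s))))"

text \<open>Clamping the time makes monotonicity, Lipschitz bounds and continuity of the flow hold
  for all real \<open>t\<close>, free of side conditions.\<close>

definition X :: "real \<Rightarrow> real \<Rightarrow> real" where "X t y = path y (cl t)"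

lemma path: "continuous_on UNIV (path y)"
    "t \<in> {0..T} \<Longrightarrow> path y t = y + integral {0..t} (\<lambda>s. \<Lambda> (path y s) (W s))"
  using someI_ex[OF path_exists[of y]] unfolding path_def by auto

lemma X_eq:
  assumes "t \<in> {0..T}"
  shows "X t y = y + integral {0..t} (\<lambda>s. \<Lambda> (X s y) (W s))"
proof -
  have "integral {0..t} (\<lambda>s. \<Lambda> (X s y) (W s)) = integral {0..t} (\<lambda>s. \<Lambda> (path y s) (W s))"
    by (rule integral_cong) (use assms in \<open>auto simp: X_def cl_id\<close>)
  then show ?thesis using path(2)[OF assms] by (simp add: X_def cl_id[OF assms])
qed

lemma X_cl [simp]: "X (cl t) y = X t y"
  using cl_id[OF cl] by (simp only: X_def)

lemma X_0 [simp]: "X 0 y = y"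
  using X_eq[of 0 y] T_pos by simp

lemma cont_X_t: "continuous_on S (\<lambda>t. X t y)"
  unfolding X_def by (rule continuous_on_compose2[OF path(1)]) (auto intro!: continuous_intros)

lemma cont_vel: "continuous_on S (\<lambda>t. \<Lambda> (X t y) (W t))"
  by (intro continuous_intros cont_X_t)

lemma X_deriv:
  assumes "t \<in> {0..T}"
  shows "((\<lambda>t. X t y) has_real_derivative \<Lambda> (X t y) (W t)) (at t within {0..T})"
proof -
  have "((\<lambda>t. y + integral {0..t} (\<lambda>s. \<Lambda> (X s y) (W s))) has_real_derivative \<Lambda> (X t y) (W t))
      (at t within {0..T})"
    using integral_has_real_derivative[OF cont_vel assms]
    by (auto intro!: derivative_eq_intros)
  then show ?thesis
    by (rule has_field_derivative_transform_within[of _ _ _ _ 1]) (use assms X_eq in auto)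
qed

lemma X_increment:
  assumes "0 \<le> s" "s \<le> t" "t \<le> T"
  shows "c * (t - s) \<le> X t y - X s y" "X t y - X s y \<le> C * (t - s)"
proof -
  have int: "(\<lambda>s. \<Lambda> (X s y) (W s)) integrable_on {a..b}" for a b
    by (intro integrable_continuous_real cont_vel)
  have eq: "X t y - X s y = integral {s..t} (\<lambda>s. \<Lambda> (X s y) (W s))"
    using Henstock_Kurzweil_Integration.integral_combine[OF assms(1,2), of "\<lambda>s. \<Lambda> (X s y) (W s)"] int X_eq[of t y] X_eq[of s y] assms by simp
  have "integral {s..t} (\<lambda>s. c) \<le> integral {s..t} (\<lambda>s. \<Lambda> (X s y) (W s))"
    by (intro integral_le int) (auto simp: lower)
  then show "c * (t - s) \<le> X t y - X s y"
    using eq assms by (simp add: mult.commute)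
  have "integral {s..t} (\<lambda>s. \<Lambda> (X s y) (W s)) \<le> integral {s..t} (\<lambda>s. C)"
    by (intro integral_le int) (auto simp: upper)
  then show "X t y - X s y \<le> C * (t - s)"
    using eq assms by (simp add: mult.commute)
qed

lemma X_strict_mono_time: "0 \<le> s \<Longrightarrow> s < t \<Longrightarrow> t \<le> T \<Longrightarrow> X s y < X t y"
  using X_increment(1)[of s t y] c_pos by (smt (verit) mult_pos_pos)

lemma X_lip_time: "\<bar>X t y - X s y\<bar> \<le> C * \<bar>t - s\<bar>"
proof -
  have *: "\<bar>X t y - X s y\<bar> \<le> C * (t - s)" if "s \<le> t" for s t
  proof -
    have "X (cl t) y - X (cl s) y \<le> C * (cl t - cl s)" "c * (cl t - cl s) \<le> X (cl t) y - X (cl s) y"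
      using that T_pos by (intro X_increment; auto)+
    moreover have "C * (cl t - cl s) \<le> C * (t - s)" "0 \<le> c * (cl t - cl s)"
      using C_pos c_pos that by auto
    ultimately show ?thesis unfolding X_cl by linarith
  qed
  show ?thesis using *[of s t] *[of t s] by (cases "s \<le> t") (auto simp: abs_minus_commute)
qed

text \<open>The squared distance cannot decay faster than \<open>exp (- 2 * L * s)\<close>, because
  its derivative is at least \<open>- 2 * L\<close> times itself. Squaring avoids any prior
  knowledge of the sign of \<open>D\<close>. The quotient \<open>q\<close> of \<open>X_diff\<close>
  may then divide by the distance.\<close>

lemma X_separated:
  assumes "y \<noteq> y'" "t \<in> {0..T}"
  shows "X t y \<noteq> X t y'"
proof -
  define D where "D t = X t y' - X t y" for t
  define h where "h s = (D s)\<^sup>2 * exp (2 * L * s)" for s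
  define v where "v s = \<Lambda> (X s y') (W s) - \<Lambda> (X s y) (W s)" for s
  have dD: "(D has_real_derivative v s) (at s within {0..T})" if "s \<in> {0..T}" for s
    unfolding D_def v_def using that by (intro derivative_intros X_deriv)
  have deriv: "(h has_real_derivative (2 * D s * v s + 2 * L * (D s)\<^sup>2) * exp (2 * L * s)) (at s within {0..T})"
    if "s \<in> {0..T}" for s
    unfolding h_def by (auto intro!: derivative_eq_intros dD[OF that] simp: algebra_simps power2_eq_square)
  have "h 0 \<le> h t"
  proof (rule DERIV_nonneg_imp_increasing_open[of 0 t h])
    show "0 \<le> t" using assms by simp
    show "continuous_on {0..t} h"
      by (rule continuous_on_subset[OF DERIV_continuous_on[OF deriv]]) (use assms in auto)
    fix s assume s: "0 < s" "s < t"
    then have "s \<in> {0..T}" and at: "at s within {0..T} = at s"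
      using assms by (auto intro!: at_within_interior)
    then have 1: "(h has_real_derivative (2 * D s * v s + 2 * L * (D s)\<^sup>2) * exp (2 * L * s)) (at s)"
      using deriv[of s] unfolding at by blast
    have "\<bar>D s * v s\<bar> \<le> \<bar>D s\<bar> * (L * \<bar>D s\<bar>)"
      unfolding abs_mult v_def D_def by (intro mult_left_mono lip_x) auto
    then have "\<bar>D s * v s\<bar> \<le> L * (D s)\<^sup>2" by (simp add: power2_eq_square algebra_simps)
    then have "0 \<le> 2 * D s * v s + 2 * L * (D s)\<^sup>2" by linarith
    with 1 show "\<exists>y. (h has_real_derivative y) (at s) \<and> 0 \<le> y" by fastforce
  qed
  moreover have "h 0 > 0" using assms by (simp add: h_def D_def)
  ultimately show ?thesis by (auto simp: h_def D_def)
qed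

definition Q :: "real \<Rightarrow> real \<Rightarrow> real \<Rightarrow> real" where
  "Q y y' s = sl (X s y) (X s y') (W s)"

text \<open>The factor by which the flow stretches the distance of two characteristics; for
  \<open>y = y'\<close> it is the derivative of the flow in the initial position. On the diagonal
  the integrand may jump in time where the characteristic crosses \<open>0\<close> or
  \<open>1\<close>, hence a Lebesgue integral of a bounded Borel function.\<close>

definition Ebar :: "real \<Rightarrow> real \<Rightarrow> real \<Rightarrow> real" where
  "Ebar t y y' = exp (LINT s|lborel. indicator {0..cl t} s * Q y y' s)"

lemma Q_measurable [measurable]: "Q y y' \<in> borel_measurable borel"
proof -
  have "(\<lambda>s. (X s y, X s y', W s)) \<in> borel_measurable borel"
    by (intro borel_measurable_continuous_onI continuous_intros cont_X_t)
  from measurable_compose[OF this slope_meas] show ?thesis by (simp add: Q_def[abs_def])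
qed

lemma Q_bound: "\<bar>Q y y' s\<bar> \<le> L"
  by (simp add: Q_def slope_bound)

lemma Q_integrable: "integrable lborel (\<lambda>s. indicator {0..a} s * Q y y' s)"
proof (rule Bochner_Integration.integrable_bound)
  show "integrable lborel (\<lambda>s. L * indicator {0..a} s :: real)"
    by (rule integrable_const_indicator)
qed (use Q_bound L_nonneg in \<open>auto simp: indicator_def\<close>)

text \<open>The distance \<open>D\<close> solves the linear equation \<open>D' = q * D\<close>, so
  \<open>D\<close> times \<open>exp\<close> of minus the integral of \<open>q\<close> is constant.
  As \<open>D\<close> has no zero, \<open>q\<close> is continuous and agrees with the slope along
  the two paths. Monotonicity, injectivity and both Lipschitz bounds in \<open>y\<close> follow from
  this identity.\<close>

lemma X_diff:
  assumes "t \<in> {0..T}"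
  shows "X t y' - X t y = (y' - y) * Ebar t y y'"
proof (cases "y = y'")
  case False
  define D where "D t = X t y' - X t y" for t
  define q where "q s = (\<Lambda> (X s y') (W s) - \<Lambda> (X s y) (W s)) / D s" for s
  have D: "D s \<noteq> 0" if "s \<in> {0..T}" for s
    using X_separated[OF False that] by (simp add: D_def)
  have qQ: "q s = Q y y' s" if "s \<in> {0..T}" for s
    using D[OF that] by (simp add: q_def Q_def slope D_def)
  have contq: "continuous_on {0..T} q"
    unfolding q_def D_def using D by (intro continuous_intros cont_X_t) (auto simp: D_def)
  have "(LINT s|lborel. indicator {0..t} s * Q y y' s) = (LINT s:{0..t}|lborel. q s)"
    unfolding set_lebesgue_integral_def
    by (rule Bochner_Integration.integral_cong) (use assms qQ in \<open>auto simp: indicator_def\<close>)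
  also have "\<dots> = integral {0..t} q"
    by (intro set_borel_integral_eq_integral borel_integrable_atLeastAtMost' continuous_on_subset[OF contq])
       (use assms in auto)
  finally have E: "Ebar t y y' = exp (integral {0..t} q)" by (simp add: Ebar_def cl_id[OF assms])
  define h where "h s = D s * exp (- integral {0..s} q)" for s
  have dD: "(D has_real_derivative q s * D s) (at s within {0..T})" if "s \<in> {0..T}" for s
    using D[OF that] X_deriv[OF that, of y] X_deriv[OF that, of y']
    unfolding D_def[abs_def] q_def by (auto intro!: derivative_eq_intros)
  have "(h has_real_derivative 0) (at s within {0..T})" if "s \<in> {0..T}" for s
    unfolding h_def
    by (auto intro!: derivative_eq_intros dD[OF that] integral_has_real_derivative[OF contq that])
  then obtain k where k: "\<And>s. s \<in> {0..T} \<Longrightarrow> h s = k"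
    using has_field_derivative_zero_constant[of "{0..T}" h] by auto
  have "h t = h 0" using k[OF assms] k[of 0] T_pos by simp
  then show ?thesis by (simp add: h_def D_def E exp_minus field_simps)
qed simp

lemma Ebar_bounds: "exp (- L * T) \<le> Ebar t y y'" "Ebar t y y' \<le> exp (L * T)"
proof -
  have "\<bar>LINT s|lborel. indicator {0..cl t} s * Q y y' s\<bar> \<le> (LINT s|lborel. L * indicator {0..cl t} s)"
    unfolding real_norm_def[symmetric]
    by (rule Bochner_Integration.integral_norm_bound_integral[OF Q_integrable integrable_const_indicator])
       (use Q_bound L_nonneg in \<open>auto simp: indicator_def\<close>)
  also have "\<dots> = L * cl t" using cl[of t] by simp
  also have "\<dots> \<le> L * T" using cl[of t] L_nonneg by (intro mult_left_mono) auto
  finally show "exp (- L * T) \<le> Ebar t y y'" "Ebar t y y' \<le> exp (L * T)"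
    unfolding Ebar_def by auto
qed

lemma Ebar_pos: "0 < Ebar t y y'"
  by (simp add: Ebar_def)

lemma Ebar_cl [simp]: "Ebar (cl t) y y' = Ebar t y y'"
  using cl_id[OF cl] by (simp only: Ebar_def)

lemma X_diff': "X t y' - X t y = (y' - y) * Ebar t y y'"
  using X_diff[OF cl, of t y' y] by simp

lemma X_less_iff [simp]: "X t y < X t y' \<longleftrightarrow> y < y'"
  using X_diff'[of t y' y] Ebar_pos[of t y y'] by (smt (verit) zero_less_mult_iff)

lemma X_le_iff [simp]: "X t y \<le> X t y' \<longleftrightarrow> y \<le> y'"
  using X_less_iff[of t y' y] by linarith

lemma X_eq_iff [simp]: "X t y = X t y' \<longleftrightarrow> y = y'"
  by (metis X_less_iff less_irrefl linorder_less_linear)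

lemma X_lip_y: "\<bar>X t y - X t y'\<bar> \<le> exp (L * T) * \<bar>y - y'\<bar>"
  unfolding X_diff' abs_mult mult.commute[of "exp (L * T)"] using Ebar_bounds(2)[of t y' y] Ebar_pos[of t y' y]
  by (intro mult_left_mono) auto

lemma X_expand_y: "\<bar>y - y'\<bar> \<le> exp (L * T) * \<bar>X t y - X t y'\<bar>"
proof -
  have "exp (- L * T) * \<bar>y - y'\<bar> \<le> Ebar t y' y * \<bar>y - y'\<bar>"
    by (intro mult_right_mono Ebar_bounds) auto
  also have "\<dots> = \<bar>X t y - X t y'\<bar>"
    unfolding X_diff' abs_mult using Ebar_pos[of t y' y] by simp
  finally show ?thesis by (simp add: exp_minus field_simps)
qed

lemma X_lip: "\<bar>X t y - X t' y'\<bar> \<le> C * \<bar>t - t'\<bar> + exp (L * T) * \<bar>y - y'\<bar>"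
  using X_lip_time[of t y t'] X_lip_y[of t' y y'] by linarith

lemma tendsto_X:
  assumes "(f \<longlongrightarrow> t) F" "(g \<longlongrightarrow> y) F"
  shows "((\<lambda>i. X (f i) (g i)) \<longlongrightarrow> X t y) F"
proof -
  have "((\<lambda>i. C * \<bar>f i - t\<bar> + exp (L * T) * \<bar>g i - y\<bar>) \<longlongrightarrow> C * \<bar>t - t\<bar> + exp (L * T) * \<bar>y - y\<bar>) F"
    by (intro tendsto_intros assms)
  then have lim: "((\<lambda>i. C * \<bar>f i - t\<bar> + exp (L * T) * \<bar>g i - y\<bar>) \<longlongrightarrow> 0) F" by simp
  have ev: "\<forall>\<^sub>F i in F. norm (X (f i) (g i) - X t y) \<le> C * \<bar>f i - t\<bar> + exp (L * T) * \<bar>g i - y\<bar>"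
    unfolding real_norm_def by (intro always_eventually allI X_lip)
  from Lim_null_comparison[OF ev lim] show ?thesis by (rule LIM_zero_cancel)
qed

lemma continuous_on_X [continuous_intros]:
  assumes "continuous_on S f" "continuous_on S g"
  shows "continuous_on S (\<lambda>x. X (f x) (g x))"
  using assms unfolding continuous_on_def by (auto intro: tendsto_X)

lemma X_level_finite: "finite {s \<in> {0..T}. X s y = z}"
proof (cases "\<exists>s0\<in>{0..T}. X s0 y = z")
  case True
  then obtain s0 where "s0 \<in> {0..T}" "X s0 y = z" by blast
  then have "{s \<in> {0..T}. X s y = z} \<subseteq> {s0}"
    using X_strict_mono_time[of s0 _ y] X_strict_mono_time[of _ s0 y]
    by (auto simp: set_eq_iff) (metis linorder_less_linear order_less_irrefl)
  then show ?thesis using finite_subset by blast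
next
  case False
  then have "{s \<in> {0..T}. X s y = z} = {}" by blast
  then show ?thesis by (simp only: finite.emptyI)
qed

text \<open>The slope of the velocity is discontinuous at the boundary points \<open>0\<close> and \<open>1\<close> only, and a
  characteristic crosses each of them at most once, so dominated convergence applies.\<close>

lemma tendsto_Ebar_seq:
  assumes "f \<longlonglongrightarrow> t" "g \<longlonglongrightarrow> y" "h \<longlonglongrightarrow> y'"
  shows "(\<lambda>n. Ebar (f n) (g n) (h n)) \<longlonglongrightarrow> Ebar t y y'"
  unfolding Ebar_def
proof (intro tendsto_exp integral_dominated_convergence)
  show "integrable lborel (\<lambda>s. L * indicator {0..T} s :: real)"
    by (rule integrable_const_indicator)
  show "AE s in lborel. norm (indicator {0..cl (f n)} s * Q (g n) (h n) s) \<le> L * indicator {0..T} s" for n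
    using Q_bound L_nonneg cl[of "f n"] by (intro AE_I2) (auto simp: indicator_def)
  \<comment> \<open>The instant \<open>cl t\<close> is excluded as well, because the indicators of
    the approximating time intervals need not converge there.\<close>
  define N where "N = {cl t} \<union> {s \<in> {0..T}. X s y = 0} \<union> {s \<in> {0..T}. X s y = 1}"
  have "finite N" unfolding N_def using X_level_finite by auto
  then have "AE s in lborel. s \<notin> N"
    by (intro AE_not_in countable_imp_null_set_lborel countable_finite)
  then show "AE s in lborel. (\<lambda>n. indicator {0..cl (f n)} s * Q (g n) (h n) s)
      \<longlonglongrightarrow> indicator {0..cl t} s * Q y y' s"
  proof eventually_elim
    case (elim s)
    have clf: "(\<lambda>n. cl (f n)) \<longlonglongrightarrow> cl t" by (intro tendsto_intros assms)
    consider "s < 0" | "s > cl t" | "0 \<le> s" "s < cl t" using elim by (force simp: N_def)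
    then show ?case
    proof cases
      case 1
      then show ?thesis by (simp add: indicator_def)
    next
      case 2
      then have "\<forall>\<^sub>F n in sequentially. cl (f n) < s" using order_tendstoD(2)[OF clf] by blast
      then have "\<forall>\<^sub>F n in sequentially. indicator {0..cl (f n)} s * Q (g n) (h n) s = indicator {0..cl t} s * Q y y' s"
        by eventually_elim (use 2 in \<open>auto simp: indicator_def\<close>)
      then show ?thesis by (rule tendsto_eventually)
    next
      case 3
      then have sT: "s \<in> {0..T}" using cl[of t] by auto
      have "X s y \<noteq> X s y' \<or> X s y \<notin> {0, 1}" using elim sT by (auto simp: N_def)
      then have *: "isCont (\<lambda>(p, q). sl p q (W s)) (X s y, X s y')" by (rule slope_cont)
      have "(\<lambda>n. (X s (g n), X s (h n))) \<longlonglongrightarrow> (X s y, X s y')"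
        by (intro tendsto_intros tendsto_X assms)
      from isCont_tendsto_compose[OF * this] have lim: "(\<lambda>n. Q (g n) (h n) s) \<longlonglongrightarrow> Q y y' s"
        by (simp add: Q_def)
      have "\<forall>\<^sub>F n in sequentially. s < cl (f n)" using order_tendstoD(1)[OF clf] 3 by blast
      then have "\<forall>\<^sub>F n in sequentially. Q (g n) (h n) s = indicator {0..cl (f n)} s * Q (g n) (h n) s"
        by eventually_elim (use 3 in \<open>auto simp: indicator_def\<close>)
      from Lim_transform_eventually[OF lim this] 3 show ?thesis by (simp add: indicator_def)
    qed
  qed
qed auto

lemma tendsto_Ebar:
  assumes "(f \<longlongrightarrow> t) F" "(g \<longlongrightarrow> y) F" "(h \<longlongrightarrow> y') F"
  shows "((\<lambda>i. Ebar (f i) (g i) (h i)) \<longlongrightarrow> Ebar t y y') F"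
proof -
  have "isCont (\<lambda>(t, y, y'). Ebar t y y') (t, y, y')"
    unfolding continuous_at_sequentially
  proof safe
    fix u :: "nat \<Rightarrow> real \<times> real \<times> real" assume "u \<longlonglongrightarrow> (t, y, y')"
    then have "(\<lambda>n. Ebar (fst (u n)) (fst (snd (u n))) (snd (snd (u n)))) \<longlonglongrightarrow> Ebar t y y'"
      by (intro tendsto_Ebar_seq) (force dest: tendsto_fst tendsto_snd)+
    then show "((\<lambda>(t, y, y'). Ebar t y y') \<circ> u) \<longlonglongrightarrow> Ebar t y y'"
      by (simp add: comp_def split_beta)
  qed
  from isCont_tendsto_compose[OF this, of "\<lambda>i. (f i, g i, h i)" F] assms
  show ?thesis by (simp add: tendsto_Pair)
qed

lemma continuous_on_Ebar [continuous_intros]: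
  assumes "continuous_on S f" "continuous_on S g" "continuous_on S h"
  shows "continuous_on S (\<lambda>x. Ebar (f x) (g x) (h x))"
  using assms unfolding continuous_on_def by (auto intro: tendsto_Ebar)

end

section \<open>The inverse flow and its derivatives\<close>

context flow
begin

lemma X_bounds: "y \<le> X t y" "X t y \<le> y + C * T"
proof -
  have "c * (cl t - 0) \<le> X (cl t) y - X 0 y" "X (cl t) y - X 0 y \<le> C * (cl t - 0)"
    using cl[of t] T_pos by (intro X_increment; auto)+
  moreover have "0 \<le> c * (cl t - 0)" "C * (cl t - 0) \<le> C * T"
    using cl[of t] c_pos C_pos by (auto intro!: mult_left_mono)
  ultimately show "y \<le> X t y" "X t y \<le> y + C * T" unfolding X_cl by simp_all
qed

text \<open>Speeds lie between \<open>0\<close> and \<open>C\<close>, so a particle found at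
  \<open>x\<close> must have started in \<open>{x - C * T..x}\<close>; the intermediate value
  theorem finds it there.\<close>

lemma X_surj: "\<exists>y. X t y = x"
proof -
  have "\<exists>y\<ge>x - C * T. y \<le> x \<and> X t y = x"
  proof (rule IVT'[of "X t"])
    show "X t (x - C * T) \<le> x"
      using X_bounds(2)[of t "x - C * T"] by simp
    show "x \<le> X t x" by (rule X_bounds)
    show "x - C * T \<le> x" using C_pos T_pos by simp
    show "continuous_on {x - C * T..x} (X t)"
      by (rule continuous_on_X[OF continuous_on_const continuous_on_id])
  qed
  then show ?thesis by (elim exE conjE) (rule exI)
qed

definition Y :: "real \<Rightarrow> real \<Rightarrow> real" where "Y t x = (THE y. X t y = x)"

lemma X_Y [simp]: "X t (Y t x) = x"
proof -
  obtain y where y: "X t y = x" using X_surj by blast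
  then have "Y t x = y" unfolding Y_def by (intro the_equality) auto
  with y show ?thesis by simp
qed

lemma Y_X [simp]: "Y t (X t y) = y"
  using X_eq_iff[of t "Y t (X t y)" y] by simp

lemma Y_0 [simp]: "Y 0 x = x"
  using Y_X[of 0 x] by simp

lemma Y_cl [simp]: "Y (cl t) x = Y t x"
  unfolding Y_def X_cl ..

lemma Y_le_iff [simp]: "Y t x \<le> Y t x' \<longleftrightarrow> x \<le> x'"
  using X_le_iff[of t "Y t x" "Y t x'"] by simp

lemma Y_less_iff [simp]: "Y t x < Y t x' \<longleftrightarrow> x < x'"
  using X_less_iff[of t "Y t x" "Y t x'"] by simp

lemma le_Y_iff: "y \<le> Y t x \<longleftrightarrow> X t y \<le> x"
  using X_le_iff[of t y "Y t x"] by simp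

lemma Y_le_iff': "Y t x \<le> y \<longleftrightarrow> x \<le> X t y"
  using X_le_iff[of t "Y t x" y] by simp

lemma Y_antimono:
  assumes "s \<in> {0..T}" "t \<in> {0..T}" "s \<le> t"
  shows "Y t x \<le> Y s x"
  using X_increment(1)[of s t "Y t x"] assms c_pos
  by (simp add: le_Y_iff) (smt (verit) mult_nonneg_nonneg)

lemma Y_lip: "\<bar>Y t x - Y t' x'\<bar> \<le> exp (L * T) * (\<bar>x - x'\<bar> + C * \<bar>t - t'\<bar>)"
proof -
  have "\<bar>Y t x - Y t' x'\<bar> \<le> exp (L * T) * \<bar>X t (Y t x) - X t (Y t' x')\<bar>"
    by (rule X_expand_y)
  also have "\<dots> \<le> exp (L * T) * (\<bar>x - x'\<bar> + C * \<bar>t - t'\<bar>)"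
    using X_lip_time[of t "Y t' x'" t'] by (intro mult_left_mono) auto
  finally show ?thesis .
qed

lemma tendsto_Y:
  assumes "(f \<longlongrightarrow> t) F" "(g \<longlongrightarrow> x) F"
  shows "((\<lambda>i. Y (f i) (g i)) \<longlongrightarrow> Y t x) F"
proof -
  have "((\<lambda>i. exp (L * T) * (\<bar>g i - x\<bar> + C * \<bar>f i - t\<bar>)) \<longlongrightarrow>
      exp (L * T) * (\<bar>x - x\<bar> + C * \<bar>t - t\<bar>)) F"
    by (intro tendsto_intros assms)
  then have lim: "((\<lambda>i. exp (L * T) * (\<bar>g i - x\<bar> + C * \<bar>f i - t\<bar>)) \<longlongrightarrow> 0) F" by simp
  have ev: "\<forall>\<^sub>F i in F. norm (Y (f i) (g i) - Y t x) \<le> exp (L * T) * (\<bar>g i - x\<bar> + C * \<bar>f i - t\<bar>)"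
    unfolding real_norm_def by (intro always_eventually allI Y_lip)
  from Lim_null_comparison[OF ev lim] show ?thesis by (rule LIM_zero_cancel)
qed

lemma continuous_on_Y [continuous_intros]:
  assumes "continuous_on S f" "continuous_on S g"
  shows "continuous_on S (\<lambda>x. Y (f x) (g x))"
  using assms unfolding continuous_on_def by (auto intro: tendsto_Y)

text \<open>The reciprocal of the stretching of the flow at the foot of the characteristic: the
  space derivative of \<open>Y\<close>, and the factor by which a density changes along the
  flow.\<close>

definition J :: "real \<Rightarrow> real \<Rightarrow> real" where "J t x = 1 / Ebar t (Y t x) (Y t x)"

lemma J_pos: "0 < J t x"
  using Ebar_pos by (simp add: J_def)

lemma J_le: "J t x \<le> exp (L * T)"
  using Ebar_bounds(1)[of t "Y t x" "Y t x"] Ebar_pos[of t "Y t x" "Y t x"]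
  by (simp add: J_def exp_minus field_simps)

lemma continuous_on_J [continuous_intros]:
  assumes "continuous_on S f" "continuous_on S g"
  shows "continuous_on S (\<lambda>x. J (f x) (g x))"
  unfolding J_def using Ebar_pos by (intro continuous_intros assms) (metis less_irrefl)

lemma Y_diff: "Y t x' - Y t x = (x' - x) / Ebar t (Y t x) (Y t x')"
  using X_diff'[of t "Y t x'" "Y t x"] Ebar_pos[of t "Y t x" "Y t x'"] by simp

text \<open>The difference quotient of \<open>Y\<close> equals \<open>1 / Ebar\<close> exactly, so
  joint continuity of \<open>Ebar\<close> up to the diagonal is all that the limit requires.\<close>

lemma Y_deriv_x: "((\<lambda>x. Y t x) has_real_derivative J t x) (at x)"
  unfolding has_field_derivative_iff
proof (rule Lim_transform_eventually)
  have "((\<lambda>x'. 1 / Ebar t (Y t x) (Y t x')) \<longlongrightarrow> 1 / Ebar t (Y t x) (Y t x)) (at x)"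
    using Ebar_pos[of t "Y t x" "Y t x"]
    by (intro tendsto_intros tendsto_Ebar tendsto_Y) auto
  then show "((\<lambda>x'. 1 / Ebar t (Y t x) (Y t x')) \<longlongrightarrow> J t x) (at x)" by (simp add: J_def)
  show "\<forall>\<^sub>F x' in at x. 1 / Ebar t (Y t x) (Y t x') = (Y t x' - Y t x) / (x' - x)"
    unfolding eventually_at_filter by (intro always_eventually) (simp add: Y_diff)
qed

text \<open>With \<open>?y\<close> the foot at time \<open>t\<close>, both \<open>X t ?y\<close> and
  \<open>X s (Y s x)\<close> equal \<open>x\<close>. Hence the move of the particle
  \<open>?y\<close> between \<open>t\<close> and \<open>s\<close> is minus the shift of the foot
  times \<open>Ebar\<close>. Together with \<open>Y_deriv_x\<close> this is the transport equation
  for \<open>Y\<close>: its time derivative plus velocity times space derivative vanishes.\<close>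

lemma Y_deriv_t:
  assumes "t \<in> {0..T}"
  shows "((\<lambda>t. Y t x) has_real_derivative - \<Lambda> x (W t) * J t x) (at t within {0..T})"
  unfolding has_field_derivative_iff
proof (rule Lim_transform_eventually)
  let ?y = "Y t x"
  have X: "((\<lambda>s. (X s ?y - X t ?y) / (s - t)) \<longlongrightarrow> \<Lambda> x (W t)) (at t within {0..T})"
    using X_deriv[OF assms, of ?y] unfolding has_field_derivative_iff by simp
  have "((\<lambda>s. - ((X s ?y - X t ?y) / (s - t)) * (1 / Ebar s ?y (Y s x))) \<longlongrightarrow>
      - \<Lambda> x (W t) * (1 / Ebar t ?y ?y)) (at t within {0..T})"
    using Ebar_pos[of t ?y ?y]
    by (intro tendsto_intros X tendsto_Ebar tendsto_Y) auto
  then show "((\<lambda>s. - ((X s ?y - X t ?y) / (s - t)) * (1 / Ebar s ?y (Y s x))) \<longlongrightarrow> - \<Lambda> x (W t) * J t x)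
      (at t within {0..T})" by (simp add: J_def)
  have "- ((X s ?y - X t ?y) / (s - t)) * (1 / Ebar s ?y (Y s x)) = (Y s x - ?y) / (s - t)" for s
    using X_diff'[of s "Y s x" ?y] Ebar_pos[of s ?y "Y s x"] by (simp add: divide_simps)
  then show "\<forall>\<^sub>F s in at t within {0..T}. - ((X s ?y - X t ?y) / (s - t)) * (1 / Ebar s ?y (Y s x))
      = (Y s x - ?y) / (s - t)"
    by simp
qed

text \<open>A time derivative at the point and a jointly continuous space derivative give the total
  derivative. It is taken relative to the closed rectangle, as \<open>C1_rect\<close> demands of
  test functions.\<close>

lemma Y_has_derivative:
  assumes "\<tau> \<in> {0..T}" "t \<in> {0..\<tau>}" "x \<in> {0..1}"
  shows "((\<lambda>(t, x). Y t x) has_derivative (\<lambda>(h, k). (- \<Lambda> x (W t) * J t x) * h + J t x * k))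
    (at (t, x) within {0..\<tau>} \<times> {0..1})"
proof -
  have "((\<lambda>t. Y t x) has_derivative (*) (- \<Lambda> x (W t) * J t x)) (at t within {0..\<tau>})"
    using DERIV_subset[OF Y_deriv_t] assms unfolding has_field_derivative_def by auto
  moreover have "((\<lambda>x. Y t x) has_derivative blinfun_apply (blinfun_mult_right (J t x))) (at x within {0..1})" for t x
    using has_field_derivative_at_within[OF Y_deriv_x] unfolding has_field_derivative_def
    by simp
  moreover have "continuous (at (t, x) within {0..\<tau>} \<times> {0..1}) (\<lambda>(t, x). blinfun_mult_right (J t x))"
  proof -
    have "continuous_on ({0..\<tau>} \<times> {0..1}) (\<lambda>z. blinfun_mult_right (J (fst z) (snd z)))"
      by (intro continuous_intros bounded_linear.continuous_on[OF bounded_linear_blinfun_mult_right])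
    then show ?thesis
      using assms unfolding continuous_on_eq_continuous_within split_beta' by blast
  qed
  ultimately show ?thesis
    using has_derivative_partialsI[of Y x "(*) (- \<Lambda> x (W t) * J t x)" t "{0..\<tau>}" "{0..1}" "\<lambda>t x. blinfun_mult_right (J t x)"] assms
    by simp
qed

end

section \<open>Inflow labels and the density\<close>

text \<open>The passage from the integrals of the problem to Borel integrals on the line; the end
  points are null, so closed intervals can be used from here on.\<close>

lemma lint_lebesgue_on_Ioo:
  fixes f :: "real \<Rightarrow> real"
  assumes [measurable]: "f \<in> borel_measurable borel"
  shows "(LINT x|lebesgue_on {a<..<b}. f x) = (LINT x|lborel. indicator {a..b} x * f x)"
proof -
  have "(LINT x|lebesgue_on {a<..<b}. f x) = (LINT x|lebesgue. indicator {a<..<b} x * f x)"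
    by (subst integral_restrict_space) auto
  also have "\<dots> = (LINT x|lborel. indicator {a<..<b} x * f x)"
    by (rule integral_completion) simp
  also have "\<dots> = (LINT x|lborel. indicator {a..b} x * f x)"
  proof (rule integral_cong_AE)
    have "AE x in lborel. x \<notin> {a, b}"
      by (intro AE_not_in countable_imp_null_set_lborel) auto
    then show "AE x in lborel. indicator {a<..<b} x * f x = indicator {a..b} x * f x"
      by eventually_elim (auto simp: indicator_def)
  qed auto
  finally show ?thesis .
qed

lemma integrable_bounded_Icc:
  fixes f :: "real \<Rightarrow> real"
  assumes "f \<in> borel_measurable borel" "\<And>x. x \<in> {a..b} \<Longrightarrow> \<bar>f x\<bar> \<le> K" "\<And>x. x \<notin> {a..b} \<Longrightarrow> f x = 0"
  shows "integrable lborel f"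
proof (rule Bochner_Integration.integrable_bound[OF integrable_const_indicator])
  show "AE x in lborel. norm (f x) \<le> norm (K * indicator {a..b} x)"
    using assms(2,3) by (intro AE_I2) (force simp: indicator_def)
qed (use assms in simp)

context flow
begin

text \<open>The distance that the boundary velocity covers up to time \<open>s\<close>. It is a
  primitive on the whole line, so its derivative is two-sided at every time, \<open>0\<close> and
  \<open>T\<close> included.\<close>

definition A :: "real \<Rightarrow> real" where
  "A = (SOME F. F 0 = 0 \<and> (\<forall>s. (F has_real_derivative \<Lambda> 0 (W s)) (at s)))"

lemma A: "A 0 = 0" "(A has_real_derivative \<Lambda> 0 (W s)) (at s)"
proof -
  have "isCont (\<lambda>s. \<Lambda> 0 (W s)) s" for s
    using continuous_on_\<Lambda>[OF continuous_on_const cont_W, of 0]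
    by (simp add: continuous_on_eq_continuous_at)
  then obtain F where "\<And>s. (F has_vector_derivative \<Lambda> 0 (W s)) (at s)"
    using einterval_antiderivative[of "-\<infinity>" "\<infinity>" "\<lambda>s. \<Lambda> 0 (W s)"] by auto
  then have "\<And>s. ((\<lambda>s. F s - F 0) has_real_derivative \<Lambda> 0 (W s)) (at s)"
    by (auto intro!: derivative_eq_intros simp: has_real_derivative_iff_has_vector_derivative)
  then have "\<exists>F. F 0 = 0 \<and> (\<forall>s. (F has_real_derivative \<Lambda> 0 (W s)) (at s))"
    by (intro exI[of _ "\<lambda>s. F s - F 0"]) simp
  from someI_ex[OF this] show "A 0 = 0" "(A has_real_derivative \<Lambda> 0 (W s)) (at s)"
    unfolding A_def by auto
qed

lemma A_increment:
  assumes "s \<le> t"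
  shows "c * (t - s) \<le> A t - A s" "A t - A s \<le> C * (t - s)"
proof -
  have "c * (t - s) \<le> A t - A s \<and> A t - A s \<le> C * (t - s)"
  proof (cases "s = t")
    case False
    with assms have "s < t" by simp
    from MVT2[OF this A(2)] obtain z where "A t - A s = (t - s) * \<Lambda> 0 (W z)" by blast
    then show ?thesis
      using mult_right_mono[OF lower[of 0 "W z"], of "t - s"] mult_right_mono[OF upper[of 0 "W z"], of "t - s"] assms
      by (simp add: mult.commute)
  qed simp
  then show "c * (t - s) \<le> A t - A s" "A t - A s \<le> C * (t - s)" by auto
qed

lemma A_integral:
  assumes "0 \<le> s"
  shows "A s = integral {0..s} (\<lambda>r. \<Lambda> 0 (W r))"
proof -
  have "((\<lambda>r. \<Lambda> 0 (W r)) has_integral A s - A 0) {0..s}"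
    using assms has_field_derivative_at_within[OF A(2)] by (intro fundamental_theorem_of_calculus)
      (auto simp flip: has_real_derivative_iff_has_vector_derivative)
  then show ?thesis by (simp add: A(1) integral_unique)
qed

text \<open>To the left of the inflow boundary the velocity does not depend on position, so a particle
  that reaches \<open>0\<close> at time \<open>t\<close> moves along \<open>A s - A t\<close> before that.\<close>

lemma X_inflow:
  assumes "t \<in> {0..T}"
  shows "X t (- A t) = 0"
proof -
  define f where "f s = A s - A t" for s
  define D where "D s = \<bar>X s (- A t) - f s\<bar>" for s
  have contA: "continuous_on S A" for S
    by (rule DERIV_continuous_on) (use A(2) in \<open>auto intro: has_field_derivative_at_within\<close>)
  have contf: "continuous_on S f" for S
    unfolding f_def by (intro continuous_intros contA)
  have contD: "continuous_on S D" for S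
    unfolding D_def by (intro continuous_intros cont_X_t contf)
  have "D t \<le> 0 * exp (L * t)"
  \<comment> \<open>Both curves start at \<open>- A t\<close> and \<open>f\<close> stays in the
    region where the velocity equals its value at \<open>0\<close>, so they solve the same integral
    equation and the Gronwall constant is \<open>0\<close>.\<close>
  proof (rule gronwall[of t D L])
    fix s assume s: "s \<in> {0..t}"
    have f0: "f r \<le> 0" if "r \<in> {0..s}" for r
    proof -
      have "0 \<le> c * (t - r)" using that s c_pos by auto
      then show ?thesis using A_increment(1)[of r t] that s by (auto simp: f_def)
    qed
    have int: "(\<lambda>r. \<Lambda> (X r y) (W r)) integrable_on {0..s}" "(\<lambda>r. \<Lambda> 0 (W r)) integrable_on {0..s}" for y
      by (intro integrable_continuous_real continuous_intros cont_X_t)+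
    have "D s = norm (integral {0..s} (\<lambda>r. \<Lambda> (X r (- A t)) (W r) - \<Lambda> 0 (W r)))"
      using X_eq[of s "- A t"] A_integral[of s] s assms int by (simp add: D_def f_def integral_diff)
    also have "\<dots> \<le> integral {0..s} (\<lambda>r. L * D r)"
    proof (rule integral_norm_bound_integral)
      show "(\<lambda>r. \<Lambda> (X r (- A t)) (W r) - \<Lambda> 0 (W r)) integrable_on {0..s}"
        by (intro integrable_diff int)
      show "(\<lambda>r. L * D r) integrable_on {0..s}"
        by (intro integrable_continuous_real continuous_intros contD)
      show "norm (\<Lambda> (X r (- A t)) (W r) - \<Lambda> 0 (W r)) \<le> L * D r" if "r \<in> {0..s}" for r
        using lip_x[of "X r (- A t)" "W r" "f r"] left[OF f0[OF that]] by (simp add: D_def)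
    qed
    finally show "D s \<le> 0 + L * integral {0..s} D" by simp
  qed (use contD L_nonneg assms in auto)
  then show ?thesis by (simp add: D_def f_def)
qed

text \<open>Particles are labelled by their initial position \<open>b \<ge> 0\<close>, or by \<open>b < 0\<close> if they enter
  at time \<open>-b\<close>; \<open>\<zeta> b\<close> is the position at time \<open>0\<close> on the extended line.\<close>

definition \<zeta> :: "real \<Rightarrow> real" where "\<zeta> b = (if 0 \<le> b then b else - A (- b))"

text \<open>The Jacobian of the relabelling. In general \<zeta> has a corner at
  \<open>b = 0\<close>; the value there is the right derivative.\<close>

definition d\<zeta> :: "real \<Rightarrow> real" where "d\<zeta> b = (if 0 \<le> b then 1 else \<Lambda> 0 (W (- b)))"

text \<open>A lower bound for \<open>d\<zeta>\<close> that is the same for every mass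
  \<open>W\<close>; the Lipschitz constant of the mass map depends on this uniformity.\<close>

definition k\<zeta> :: real where "k\<zeta> = min 1 c"

lemma k\<zeta>_pos: "0 < k\<zeta>"
  using c_pos by (simp add: k\<zeta>_def)

lemma d\<zeta>_ge: "k\<zeta> \<le> d\<zeta> b"
  using lower[of 0 "W (- b)"] by (auto simp: d\<zeta>_def k\<zeta>_def)

lemma \<zeta>_increment:
  assumes "b \<le> b'"
  shows "k\<zeta> * (b' - b) \<le> \<zeta> b' - \<zeta> b" "\<zeta> b' - \<zeta> b \<le> max 1 C * (b' - b)"
proof -
  have k: "k\<zeta> * z \<le> z" "k\<zeta> * z \<le> c * z" "z \<le> max 1 C * z" "C * z \<le> max 1 C * z" if "0 \<le> z" for z
    using mult_right_mono[OF _ that, of k\<zeta> 1] mult_right_mono[OF _ that, of k\<zeta> c]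
      mult_right_mono[OF _ that, of 1 "max 1 C"] mult_right_mono[OF _ that, of C "max 1 C"]
    by (auto simp: k\<zeta>_def)
  consider "0 \<le> b" | "b < 0" "0 \<le> b'" | "b' < 0" using assms by linarith
  then have "k\<zeta> * (b' - b) \<le> \<zeta> b' - \<zeta> b \<and> \<zeta> b' - \<zeta> b \<le> max 1 C * (b' - b)"
  proof cases
    case 1
    then show ?thesis using k[of "b' - b"] assms by (simp add: \<zeta>_def)
  next
    case 2
    have "k\<zeta> * (b' - b) = k\<zeta> * b' + k\<zeta> * (- b)" "max 1 C * (b' - b) = max 1 C * b' + max 1 C * (- b)"
      by (simp_all add: algebra_simps)
    moreover have "\<zeta> b' - \<zeta> b = b' + A (- b)" using 2 by (simp add: \<zeta>_def)
    moreover have "c * (- b) \<le> A (- b)" "A (- b) \<le> C * (- b)"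
      using 2 A_increment[of 0 "- b"] by (simp_all add: A(1))
    moreover have "0 \<le> b'" "0 \<le> - b" using 2 by auto
    ultimately show ?thesis using k[of b'] k[of "- b"] by linarith
  next
    case 3
    then show ?thesis using k[of "b' - b"] assms A_increment[of "- b'" "- b"] by (simp add: \<zeta>_def)
  qed
  then show "k\<zeta> * (b' - b) \<le> \<zeta> b' - \<zeta> b" "\<zeta> b' - \<zeta> b \<le> max 1 C * (b' - b)" by auto
qed

lemma \<zeta>_less_iff [simp]: "\<zeta> b < \<zeta> b' \<longleftrightarrow> b < b'"
proof -
  have "\<zeta> b < \<zeta> b'" if "b < b'" for b b'
    using \<zeta>_increment(1)[of b b'] that k\<zeta>_pos mult_pos_pos[of k\<zeta> "b' - b"] by linarith
  then show ?thesis by (metis linorder_less_linear order_less_asym)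
qed

lemma \<zeta>_le_iff [simp]: "\<zeta> b \<le> \<zeta> b' \<longleftrightarrow> b \<le> b'"
  using \<zeta>_less_iff[of b' b] by linarith

lemma \<zeta>_eq_iff [simp]: "\<zeta> b = \<zeta> b' \<longleftrightarrow> b = b'"
  by (metis \<zeta>_less_iff less_irrefl linorder_less_linear)

lemma \<zeta>_lip: "\<bar>\<zeta> b - \<zeta> b'\<bar> \<le> max 1 C * \<bar>b - b'\<bar>"
  and \<zeta>_expand: "k\<zeta> * \<bar>b - b'\<bar> \<le> \<bar>\<zeta> b - \<zeta> b'\<bar>"
  using \<zeta>_increment[of b b'] \<zeta>_increment[of b' b] \<zeta>_le_iff[of b b'] \<zeta>_le_iff[of b' b]
  by (cases "b \<le> b'"; simp add: abs_if)+

lemma tendsto_\<zeta>: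
  assumes "(f \<longlongrightarrow> b) F"
  shows "((\<lambda>i. \<zeta> (f i)) \<longlongrightarrow> \<zeta> b) F"
proof -
  have "((\<lambda>i. max 1 C * \<bar>f i - b\<bar>) \<longlongrightarrow> max 1 C * \<bar>b - b\<bar>) F"
    by (intro tendsto_intros assms)
  then have lim: "((\<lambda>i. max 1 C * \<bar>f i - b\<bar>) \<longlongrightarrow> 0) F" by simp
  have ev: "\<forall>\<^sub>F i in F. norm (\<zeta> (f i) - \<zeta> b) \<le> max 1 C * \<bar>f i - b\<bar>"
    unfolding real_norm_def by (intro always_eventually allI \<zeta>_lip)
  from Lim_null_comparison[OF ev lim] show ?thesis by (rule LIM_zero_cancel)
qed

lemma continuous_on_\<zeta> [continuous_intros]: "continuous_on S f \<Longrightarrow> continuous_on S (\<lambda>x. \<zeta> (f x))"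
  unfolding continuous_on_def by (auto intro: tendsto_\<zeta>)

lemma \<zeta>_surj: "\<exists>b. \<zeta> b = y"
proof (cases "0 \<le> y")
  case True
  then show ?thesis by (auto simp: \<zeta>_def)
next
  case False
  \<comment> \<open>The lower end comes from \<open>A s \<ge> c * s\<close>: a label of
    \<open>y / c\<close> already starts at or to the left of \<open>y\<close>.\<close>
  have "\<exists>b\<ge>y / c. b \<le> 0 \<and> \<zeta> b = y"
  proof (rule IVT')
    have "c * (- y / c) \<le> A (- y / c)"
      using A_increment(1)[of 0 "- y / c"] False c_pos by (simp add: A(1) divide_nonpos_pos)
    then have "- y \<le> A (- (y / c))" using c_pos by simp
    then show "\<zeta> (y / c) \<le> y"
      using False c_pos by (simp add: \<zeta>_def zero_le_divide_iff)
    show "y \<le> \<zeta> 0" "y / c \<le> 0" using False c_pos by (auto simp: \<zeta>_def divide_nonpos_pos)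
    show "continuous_on {y / c..0} \<zeta>" by (rule continuous_on_\<zeta>[OF continuous_on_id])
  qed
  then show ?thesis by blast
qed

definition \<beta> :: "real \<Rightarrow> real" where "\<beta> y = (THE b. \<zeta> b = y)"

lemma \<beta>_\<zeta> [simp]: "\<beta> (\<zeta> b) = b"
  unfolding \<beta>_def by (rule the_equality) auto

lemma \<zeta>_\<beta> [simp]: "\<zeta> (\<beta> y) = y"
  by (metis \<beta>_\<zeta> \<zeta>_surj)

lemma \<beta>_mono: "y \<le> y' \<Longrightarrow> \<beta> y \<le> \<beta> y'"
  by (metis \<zeta>_\<beta> \<zeta>_le_iff)

lemma \<beta>_measurable [measurable]: "\<beta> \<in> borel_measurable borel"
  by (rule borel_measurable_mono) (auto intro!: monoI \<beta>_mono)

lemma tendsto_\<beta>: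
  assumes "(f \<longlongrightarrow> y) F"
  shows "((\<lambda>i. \<beta> (f i)) \<longlongrightarrow> \<beta> y) F"
proof -
  have "((\<lambda>i. \<bar>f i - y\<bar> / k\<zeta>) \<longlongrightarrow> \<bar>y - y\<bar> / k\<zeta>) F"
    using k\<zeta>_pos by (intro tendsto_intros assms) auto
  then have lim: "((\<lambda>i. \<bar>f i - y\<bar> / k\<zeta>) \<longlongrightarrow> 0) F" by simp
  have ev: "\<forall>\<^sub>F i in F. norm (\<beta> (f i) - \<beta> y) \<le> \<bar>f i - y\<bar> / k\<zeta>"
    using \<zeta>_expand[of "\<beta> (f _)" "\<beta> y"] k\<zeta>_pos by (intro always_eventually) (simp add: field_simps)
  from Lim_null_comparison[OF ev lim] show ?thesis by (rule LIM_zero_cancel)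
qed

text \<open>The position at time \<open>t\<close> of the particle with label \<open>b\<close>. It is
  negative as long as the particle has not entered.\<close>

definition Z :: "real \<Rightarrow> real \<Rightarrow> real" where "Z t b = X t (\<zeta> b)"

lemma Z_enter: "t \<in> {0..T} \<Longrightarrow> Z t (- t) = 0"
  using X_inflow[of t] by (auto simp: Z_def \<zeta>_def A(1))

lemma Z_0: "0 \<le> b \<Longrightarrow> Z 0 b = b"
  by (simp add: Z_def \<zeta>_def)

lemma Z_le_iff [simp]: "Z t b \<le> Z t b' \<longleftrightarrow> b \<le> b'"
  by (simp add: Z_def)

lemma Z_nonneg_iff: "t \<in> {0..T} \<Longrightarrow> 0 \<le> Z t b \<longleftrightarrow> - t \<le> b"
  using Z_le_iff[of t "- t" b] by (simp add: Z_enter)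

lemma continuous_on_Z [continuous_intros]:
  assumes "continuous_on S f" "continuous_on S g"
  shows "continuous_on S (\<lambda>x. Z (f x) (g x))"
  unfolding Z_def by (intro continuous_intros assms)

lemma Z_in_iff: "Z t b \<in> {0..1} \<longleftrightarrow> \<zeta> b \<in> {Y t 0..Y t 1}"
  by (simp add: Z_def le_Y_iff Y_le_iff')

lemma d\<zeta>_measurable [measurable]: "d\<zeta> \<in> borel_measurable borel"
proof -
  have [measurable]: "(\<lambda>b. \<Lambda> 0 (W (- b))) \<in> borel_measurable borel"
    by (intro borel_measurable_continuous_onI continuous_intros)
  show ?thesis unfolding d\<zeta>_def by measurable
qed

lemma \<zeta>_measurable [measurable]: "\<zeta> \<in> borel_measurable borel"
  by (intro borel_measurable_continuous_onI continuous_on_\<zeta> continuous_on_id)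

end

text \<open>The function \<open>g\<close> joins the two data: the initial density at labels
  \<open>b > 0\<close>, and the inflow at time \<open>- b\<close> for \<open>b < 0\<close>. Since
  \<open>u\<close> is a flux, that is, mass per unit of time, it already is a density with respect
  to entry times, which is why \<open>g\<close> does not involve the velocity.\<close>

locale transport = flow +
  fixes g :: "real \<Rightarrow> real" and B :: real
  assumes g_measurable [measurable]: "g \<in> borel_measurable borel"
    and g_nonneg: "0 \<le> g b"
    and g_le: "g b \<le> B"
    and g_support: "b \<notin> {- T..1} \<Longrightarrow> g b = 0"
begin

text \<open>The same mass distribution in terms of the position \<open>y = \<zeta> b\<close> at time
  \<open>0\<close> on the extended line. To the left of \<open>0\<close> it is inflow divided by
  boundary velocity, the density that the boundary condition prescribes at the moment of
  entry.\<close>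

definition r :: "real \<Rightarrow> real" where "r y = g (\<beta> y) / d\<zeta> (\<beta> y)"

text \<open>The push-forward of the density \<open>r\<close> under the map
  \<open>X t\<close>.\<close>

definition \<rho> :: "real \<Rightarrow> real \<Rightarrow> real" where "\<rho> t x = r (Y t x) * J t x"

lemma B_nonneg: "0 \<le> B"
  using g_nonneg[of 0] g_le[of 0] by linarith

lemma r_measurable [measurable]: "r \<in> borel_measurable borel"
  unfolding r_def by measurable

lemma r_nonneg: "0 \<le> r y"
  using g_nonneg d\<zeta>_ge[of "\<beta> y"] k\<zeta>_pos by (auto simp: r_def)

lemma r_le: "r y \<le> B / k\<zeta>"
  unfolding r_def using g_nonneg g_le B_nonneg d\<zeta>_ge[of "\<beta> y"] k\<zeta>_pos by (intro frac_le) auto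

lemma r_support: "y \<notin> {\<zeta> (- T)..1} \<Longrightarrow> r y = 0"
proof -
  assume y: "y \<notin> {\<zeta> (- T)..1}"
  have "\<zeta> 1 = 1" by (simp add: \<zeta>_def)
  then have "\<beta> y \<notin> {- T..1}"
    using y \<zeta>_le_iff[of "- T" "\<beta> y"] \<zeta>_le_iff[of "\<beta> y" 1] by auto
  then show "r y = 0" by (simp add: r_def g_support)
qed

lemma r_integrable:
  assumes [measurable]: "k \<in> borel_measurable borel" and "\<And>y. \<bar>k y\<bar> \<le> K"
  shows "integrable lborel (\<lambda>y. r y * k y)"
proof (rule integrable_bounded_Icc)
  show "\<bar>r y * k y\<bar> \<le> B / k\<zeta> * K" for y
    unfolding abs_mult using assms(2) r_nonneg r_le B_nonneg k\<zeta>_pos by (intro mult_mono) auto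
  show "r y * k y = 0" if "y \<notin> {\<zeta> (- T)..1}" for y
    using r_support[OF that] by simp
qed measurable

lemma g_integrable:
  assumes [measurable]: "k \<in> borel_measurable borel" and "\<And>y. \<bar>k y\<bar> \<le> K"
  shows "integrable lborel (\<lambda>b. g b * k b)"
proof (rule integrable_bounded_Icc)
  show "\<bar>g b * k b\<bar> \<le> B * K" for b
    unfolding abs_mult using assms(2) g_nonneg g_le B_nonneg by (intro mult_mono) auto
  show "g b * k b = 0" if "b \<notin> {- T..1}" for b
    using g_support[OF that] by simp
qed measurable

text \<open>The substitution \<open>y = \<zeta> b\<close> is done on each side of the corner at
  \<open>0\<close> separately: on the right \<zeta> is the identity, on the left it is the smooth
  map \<eta>, whose image of \<open>{- T..0}\<close> contains the negative part of the support of
  \<open>r\<close>. The point \<open>0\<close> itself is null.\<close>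

lemma integral_label:
  assumes [measurable]: "k \<in> borel_measurable borel" and k: "\<And>y. \<bar>k y\<bar> \<le> K"
  shows "(LINT y|lborel. r y * k y) = (LINT b|lborel. g b * k (\<zeta> b))"
proof -
  define \<eta> where "\<eta> b = - A (- b)" for b
  define d where "d b = \<Lambda> 0 (W (- b))" for b
  have [measurable]: "d \<in> borel_measurable borel"
    unfolding d_def by (intro borel_measurable_continuous_onI continuous_intros)
  have [measurable]: "\<eta> \<in> borel_measurable borel"
    unfolding \<eta>_def
    by (intro borel_measurable_continuous_onI continuous_intros
        continuous_on_compose2[OF DERIV_continuous_on[of UNIV A]])
       (use A(2) in \<open>auto intro: has_field_derivative_at_within\<close>)
  have \<zeta>\<eta>: "\<zeta> b = \<eta> b" "d\<zeta> b = d b" if "b < 0" for b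
    using that by (auto simp: \<zeta>_def \<eta>_def d\<zeta>_def d_def)
  have \<eta>_T: "\<eta> (- T) = \<zeta> (- T)" "\<eta> 0 = 0" using T_pos by (auto simp: \<eta>_def \<zeta>_def A)
  have int: "integrable lborel (\<lambda>y. r y * k y)" by (rule r_integrable[OF _ k]) measurable
  have ae0: "AE x in lborel. x \<noteq> (0::real)"
    using AE_lborel_singleton by blast
  have sub: "(LINT y|lborel. (r y * k y) * indicator {\<eta> (- T)..\<eta> 0} y) =
      (LINT b|lborel. (r (\<eta> b) * k (\<eta> b)) * d b * indicator {- T..0} b)"
  proof (rule integral_substitution(2))
    show "set_integrable lborel {\<eta> (- T)..\<eta> 0} (\<lambda>y. r y * k y)"
      unfolding set_integrable_def using integrable_mult_indicator[OF _ int] by simp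
    show "(\<eta> has_real_derivative d b) (at b)" for b
    proof -
      have "((\<lambda>b. A (- b)) has_real_derivative \<Lambda> 0 (W (- b)) * - 1) (at b)"
        by (rule DERIV_chain2[OF A(2)]) (auto intro!: derivative_eq_intros)
      then show ?thesis unfolding \<eta>_def d_def by (auto intro!: derivative_eq_intros)
    qed
    show "continuous_on {- T..0} d" unfolding d_def by (intro continuous_intros)
    show "0 \<le> d b" for b using lower[of 0 "W (- b)"] c_pos by (simp add: d_def)
  qed (use T_pos in simp)
  have "(LINT b|lborel. (r (\<eta> b) * k (\<eta> b)) * d b * indicator {- T..0} b) =
      (LINT b|lborel. indicator {..0} b * (g b * k (\<zeta> b)))"
  proof (rule integral_cong_AE)
    show "AE b in lborel. (r (\<eta> b) * k (\<eta> b)) * d b * indicator {- T..0} b =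
        indicator {..0} b * (g b * k (\<zeta> b))"
      using ae0
    proof eventually_elim
      case (elim b)
      have "d b \<noteq> 0" using lower[of 0 "W (- b)"] c_pos by (simp add: d_def)
      then show ?case using elim g_support[of b] \<zeta>\<eta>[of b]
        by (auto simp: indicator_def r_def simp flip: \<zeta>\<eta>)
    qed
  qed measurable
  moreover have "(LINT y|lborel. r y * k y) =
      (LINT y|lborel. (r y * k y) * indicator {\<eta> (- T)..\<eta> 0} y + indicator {0..} y * (g y * k (\<zeta> y)))"
  proof (rule integral_cong_AE)
    show "AE y in lborel. r y * k y =
        (r y * k y) * indicator {\<eta> (- T)..\<eta> 0} y + indicator {0..} y * (g y * k (\<zeta> y))"
      using ae0
    proof eventually_elim
      case (elim y)
      show ?case
      proof (cases "0 < y")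
        case True
        then have "\<zeta> y = y" by (simp add: \<zeta>_def)
        then have "\<beta> y = y" using \<beta>_\<zeta>[of y] by simp
        then have "r y = g y" using True by (simp add: r_def d\<zeta>_def)
        then show ?thesis using True \<eta>_T \<open>\<zeta> y = y\<close> by (simp add: indicator_def)
      next
        case False
        then show ?thesis using elim r_support[of y] \<eta>_T by (auto simp: indicator_def)
      qed
    qed
  qed measurable
  moreover have "\<dots> = (LINT y|lborel. (r y * k y) * indicator {\<eta> (- T)..\<eta> 0} y)
      + (LINT y|lborel. indicator {0..} y * (g y * k (\<zeta> y)))"
  proof (rule Bochner_Integration.integral_add)
    show "integrable lborel (\<lambda>y. r y * k y * indicator {\<eta> (- T)..\<eta> 0} y)"
      using integrable_mult_indicator[OF _ int, of "{\<eta> (- T)..\<eta> 0}"] by (simp add: mult.commute)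
    show "integrable lborel (\<lambda>y. indicator {0..} y * (g y * k (\<zeta> y)))"
      using integrable_mult_indicator[OF _ g_integrable[of "\<lambda>b. k (\<zeta> b)" K], of "{0..}"] k by simp
  qed
  moreover have "(LINT b|lborel. g b * k (\<zeta> b)) =
      (LINT b|lborel. indicator {..0} b * (g b * k (\<zeta> b)) + indicator {0..} b * (g b * k (\<zeta> b)))"
  proof (rule integral_cong_AE)
    show "AE b in lborel. g b * k (\<zeta> b) =
        indicator {..0} b * (g b * k (\<zeta> b)) + indicator {0..} b * (g b * k (\<zeta> b))"
      using ae0 by eventually_elim (auto simp: indicator_def)
  qed measurable
  moreover have "\<dots> = (LINT b|lborel. indicator {..0} b * (g b * k (\<zeta> b)))
      + (LINT b|lborel. indicator {0..} b * (g b * k (\<zeta> b)))"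
  proof (rule Bochner_Integration.integral_add)
    show "integrable lborel (\<lambda>y. indicator {0..} y * (g y * k (\<zeta> y)))"
         "integrable lborel (\<lambda>y. indicator {..0} y * (g y * k (\<zeta> y)))"
      using integrable_mult_indicator[OF _ g_integrable[of "\<lambda>b. k (\<zeta> b)" K], of "{0..}"]
        integrable_mult_indicator[OF _ g_integrable[of "\<lambda>b. k (\<zeta> b)" K], of "{..0}"] k by simp_all
  qed
  ultimately show ?thesis using sub by simp
qed

end

context flow
begin

lemma integral_space:
  assumes "integrable lborel f"
  shows "integrable lborel (\<lambda>x. indicator {0..1} x * (f (Y t x) * J t x))"
    and "(LINT x|lborel. indicator {0..1} x * (f (Y t x) * J t x)) = (LINT y|lborel. indicator {Y t 0..Y t 1} y * f y)"
proof -
  have f: "set_integrable lborel {Y t 0..Y t 1} f"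
    unfolding set_integrable_def using integrable_mult_indicator[OF _ assms] by simp
  have J: "continuous_on {0..1} (J t)" by (intro continuous_intros)
  note sub = integral_substitution[OF f Y_deriv_x J]
  show "integrable lborel (\<lambda>x. indicator {0..1} x * (f (Y t x) * J t x))"
    using sub(1) J_pos unfolding set_integrable_def by (simp add: less_imp_le)
  show "(LINT x|lborel. indicator {0..1} x * (f (Y t x) * J t x)) = (LINT y|lborel. indicator {Y t 0..Y t 1} y * f y)"
    using sub(2) J_pos by (simp add: less_imp_le mult_ac)
qed

end

context transport
begin

lemma \<rho>_nonneg: "0 \<le> \<rho> t x"
  using r_nonneg[of "Y t x"] J_pos[of t x] by (simp add: \<rho>_def)

lemma \<rho>_le: "\<rho> t x \<le> B / k\<zeta> * exp (L * T)"
  unfolding \<rho>_def using r_le J_le r_nonneg J_pos B_nonneg k\<zeta>_pos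
  by (intro mult_mono) (auto simp: less_imp_le)

lemma \<rho>_measurable_pair: "(\<lambda>(t, x). \<rho> t x) \<in> borel_measurable borel"
proof -
  have [measurable]: "(\<lambda>z. Y (fst z) (snd z)) \<in> borel_measurable borel"
    "(\<lambda>z. J (fst z) (snd z)) \<in> borel_measurable borel"
    by (intro borel_measurable_continuous_onI continuous_intros)+
  show ?thesis unfolding \<rho>_def split_beta by measurable
qed

lemma \<rho>_measurable [measurable]: "\<rho> t \<in> borel_measurable borel"
proof -
  have [measurable]: "Y t \<in> borel_measurable borel" "J t \<in> borel_measurable borel"
    by (intro borel_measurable_continuous_onI continuous_intros)+
  show ?thesis unfolding \<rho>_def[abs_def] by measurable
qed

text \<open>Two changes of variables, from position to foot and from foot to label. On the right the
  mass \<open>W\<close> enters through the trajectories \<open>Z\<close> alone; both the weak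
  identity and the formula for the mass start from here.\<close>

lemma integral_\<rho>:
  assumes [measurable]: "h \<in> borel_measurable borel" and h: "\<And>x. \<bar>h x\<bar> \<le> K"
  shows "(LINT x|lborel. indicator {0..1} x * (\<rho> t x * h x)) =
    (LINT b|lborel. g b * (indicator {0..1} (Z t b) * h (Z t b)))"
proof -
  have [measurable]: "X t \<in> borel_measurable borel"
    by (intro borel_measurable_continuous_onI continuous_intros)
  have K: "0 \<le> K" using h[of 0] by linarith
  have int: "integrable lborel (\<lambda>y. r y * h (X t y))" by (rule r_integrable[OF _ h]) measurable
  have "(LINT x|lborel. indicator {0..1} x * (\<rho> t x * h x)) =
      (LINT x|lborel. indicator {0..1} x * ((\<lambda>y. r y * h (X t y)) (Y t x) * J t x))"
    by (simp add: \<rho>_def mult_ac)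
  also have "\<dots> = (LINT y|lborel. indicator {Y t 0..Y t 1} y * (r y * h (X t y)))"
    by (rule integral_space(2)[OF int])
  also have "\<dots> = (LINT y|lborel. r y * (indicator {Y t 0..Y t 1} y * h (X t y)))"
    by (simp add: mult_ac)
  also have "\<dots> = (LINT b|lborel. g b * (indicator {Y t 0..Y t 1} (\<zeta> b) * h (X t (\<zeta> b))))"
  proof (rule integral_label)
    show "\<bar>indicator {Y t 0..Y t 1} y * h (X t y)\<bar> \<le> K" for y
      using h K by (auto simp: indicator_def)
  qed measurable
  also have "\<dots> = (LINT b|lborel. g b * (indicator {0..1} (Z t b) * h (Z t b)))"
    using Z_in_iff by (intro Bochner_Integration.integral_cong) (auto simp: indicator_def Z_def)
  finally show ?thesis .
qed

end

section \<open>The weak identity\<close>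

text \<open>The weak identity with the velocity as a parameter, detached from the mass of the
  unknown. A weak solution satisfies it with the velocity that its own mass generates, so the
  nonlinear problem splits into a linear one and a condition on the mass.\<close>

definition linear_weak ::
  "(real \<Rightarrow> real \<Rightarrow> real) \<Rightarrow> real \<Rightarrow> (real \<Rightarrow> real) \<Rightarrow> (real \<Rightarrow> real) \<Rightarrow> (real \<Rightarrow> real \<Rightarrow> real) \<Rightarrow> bool"
  where
  "linear_weak a T \<rho>0 u \<rho> \<longleftrightarrow>
     (\<forall>\<tau>\<in>{0..T}. \<forall>\<phi> \<phi>t \<phi>x.
        C1_rect {0..\<tau>} {0..1} \<phi> \<phi>t \<phi>x \<longrightarrow>
        (\<forall>x\<in>{0..1}. \<phi> \<tau> x = 0) \<longrightarrow>
        (\<forall>t\<in>{0..\<tau>}. \<phi> t 1 = 0) \<longrightarrow>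
        (LINT t|lebesgue_on {0<..<\<tau>}. LINT x|lebesgue_on {0<..<1}.
            \<rho> t x * (\<phi>t t x + a t x * \<phi>x t x))
        + (LINT t|lebesgue_on {0<..<\<tau>}. u t * \<phi> t 0)
        + (LINT x|lebesgue_on {0<..<1}. \<rho>0 x * \<phi> 0 x) = 0)"

lemma weak_solution_iff:
  "weak_solution lam T \<rho>0 u \<rho> \<longleftrightarrow>
     C0_Lp 1 T \<rho> \<and> Linf ({0<..<T} \<times> {0<..<1}) (\<lambda>(t, x). \<rho> t x) \<and> (\<forall>t\<in>{0..T}. mass \<rho> t \<ge> 0) \<and>
     linear_weak (\<lambda>t x. lam x (mass \<rho> t)) T \<rho>0 u \<rho>"
  unfolding weak_solution_def linear_weak_def by (rule refl)

lemma integrable_bounded_support: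
  fixes f :: "'a::euclidean_space \<Rightarrow> real"
  assumes "f \<in> borel_measurable borel" "\<And>x. \<bar>f x\<bar> \<le> K" "\<And>x. x \<notin> S \<Longrightarrow> f x = 0"
    and "bounded S" "S \<in> sets borel"
  shows "integrable lborel f"
proof (rule Bochner_Integration.integrable_bound)
  show "integrable lborel (\<lambda>x. K * indicator S x)"
    using assms(4,5) emeasure_bounded_finite by (intro integrable_mult_right integrable_real_indicator) auto
  show "AE x in lborel. norm (f x) \<le> norm (K * indicator S x)"
    using assms(2,3) by (intro AE_I2) (auto simp: indicator_def intro: order_trans[OF _ abs_ge_self])
qed (use assms in simp)

lemma C1_rect_continuous:
  assumes "C1_rect S R \<phi> \<phi>t \<phi>x"
  shows "continuous_on (S \<times> R) (\<lambda>z. \<phi> (fst z) (snd z))"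
    "continuous_on (S \<times> R) (\<lambda>z. \<phi>t (fst z) (snd z))"
    "continuous_on (S \<times> R) (\<lambda>z. \<phi>x (fst z) (snd z))"
proof -
  show "continuous_on (S \<times> R) (\<lambda>z. \<phi> (fst z) (snd z))"
    unfolding continuous_on_eq_continuous_within
    using assms unfolding C1_rect_def split_beta' by (auto intro!: has_derivative_continuous)
qed (use assms in \<open>auto simp: C1_rect_def split_beta'\<close>)

context flow
begin

lemma Z_strict_mono_time: "0 \<le> s \<Longrightarrow> s < t \<Longrightarrow> t \<le> T \<Longrightarrow> Z s b < Z t b"
  unfolding Z_def by (rule X_strict_mono_time)

lemma Z_mono_time: "0 \<le> s \<Longrightarrow> s \<le> t \<Longrightarrow> t \<le> T \<Longrightarrow> Z s b \<le> Z t b"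
  using Z_strict_mono_time[of s t b] by (cases "s = t") auto

lemma Z_start:
  assumes "- T \<le> b"
  shows "Z (max 0 (- b)) b = max 0 b"
  using Z_0[of b] Z_enter[of "- b"] assms by (cases "0 \<le> b") auto

text \<open>Positive velocity makes the visit to \<open>{0..1}\<close> a single time interval. It
  ends either at the final time or at the outflow boundary, and in both cases the test function
  vanishes.\<close>

lemma life_span:
  assumes \<tau>: "\<tau> \<in> {0..T}" and b: "- \<tau> \<le> b" "b \<le> 1"
  obtains t1 where "max 0 (- b) \<le> t1" "t1 \<le> \<tau>" "t1 = \<tau> \<or> Z t1 b = 1"
    "\<And>t. t \<in> {0..\<tau>} \<Longrightarrow> Z t b \<in> {0..1} \<longleftrightarrow> t \<in> {max 0 (- b)..t1}"
proof -
  have ge: "0 \<le> Z t b \<longleftrightarrow> max 0 (- b) \<le> t" if "t \<in> {0..\<tau>}" for t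
    using Z_nonneg_iff[of t b] that \<tau> by auto
  show thesis
  proof (cases "Z \<tau> b \<le> 1")
    case True
    then have "Z t b \<le> 1" if "t \<in> {0..\<tau>}" for t
      using Z_mono_time[of t \<tau> b] that \<tau> by auto
    then show thesis using ge b \<tau> by (intro that[of \<tau>]) auto
  next
    case False
    have "\<exists>t\<ge>max 0 (- b). t \<le> \<tau> \<and> Z t b = 1"
    proof (rule IVT'[of "\<lambda>t. Z t b"])
      show "Z (max 0 (- b)) b \<le> 1" using Z_start[of b] b \<tau> by simp
      show "continuous_on {max 0 (- b)..\<tau>} (\<lambda>t. Z t b)" by (intro continuous_intros)
    qed (use False b \<tau> in auto)
    then obtain t1 where t1: "max 0 (- b) \<le> t1" "t1 \<le> \<tau>" "Z t1 b = 1" by blast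
    have "Z t b \<le> 1 \<longleftrightarrow> t \<le> t1" if "t \<in> {0..\<tau>}" for t
      using Z_mono_time[of t t1 b] Z_strict_mono_time[of t1 t b] that \<tau> t1 by (cases "t \<le> t1") auto
    then show thesis using ge t1 by (intro that[of t1]) auto
  qed
qed

text \<open>The chain rule along a trajectory. As \<phi> is differentiable only relative to the
  closed rectangle, the time derivative is taken within a set of times that the particle spends
  inside.\<close>

lemma test_deriv_along:
  assumes \<tau>: "\<tau> \<in> {0..T}" and C1: "C1_rect {0..\<tau>} {0..1} \<phi> \<phi>t \<phi>x"
    and S: "S \<subseteq> {0..\<tau>}" "\<And>s. s \<in> S \<Longrightarrow> Z s b \<in> {0..1}" and t: "t \<in> S"
  shows "((\<lambda>t. \<phi> t (Z t b)) has_vector_derivative (\<phi>t t (Z t b) + \<Lambda> (Z t b) (W t) * \<phi>x t (Z t b))) (at t within S)"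
proof -
  have "((\<lambda>(x, y). \<phi> x y) has_derivative (\<lambda>(h, k). \<phi>t t (Z t b) * h + \<phi>x t (Z t b) * k))
      (at (t, Z t b) within {0..\<tau>} \<times> {0..1})"
    using C1 S t unfolding C1_rect_def by blast
  then have \<phi>: "((\<lambda>(x, y). \<phi> x y) has_derivative (\<lambda>(h, k). \<phi>t t (Z t b) * h + \<phi>x t (Z t b) * k))
      (at (t, Z t b) within (\<lambda>t. (t, Z t b)) ` S)"
    by (rule has_derivative_subset) (use S in auto)
  have "((\<lambda>t. Z t b) has_real_derivative \<Lambda> (Z t b) (W t)) (at t within S)"
    unfolding Z_def by (rule DERIV_subset[OF X_deriv]) (use S t \<tau> in auto)
  then have curve: "((\<lambda>t. (t, Z t b)) has_derivative (\<lambda>h. (h, \<Lambda> (Z t b) (W t) * h))) (at t within S)"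
    unfolding has_field_derivative_def by (intro has_derivative_Pair has_derivative_ident)
  show ?thesis
    using has_derivative_in_compose[OF curve \<phi>]
    by (simp add: has_vector_derivative_def algebra_simps)
qed

text \<open>By the fundamental theorem of calculus only the two ends of the visit contribute. The
  value at the end is zero by the conditions on \<phi>; the beginning is \<open>(0, b)\<close> for
  an initial particle and \<open>(- b, 0)\<close> for an entering one.\<close>

lemma integral_along:
  assumes \<tau>: "\<tau> \<in> {0..T}" and C1: "C1_rect {0..\<tau>} {0..1} \<phi> \<phi>t \<phi>x"
    and z: "\<And>x. x \<in> {0..1} \<Longrightarrow> \<phi> \<tau> x = 0" "\<And>t. t \<in> {0..\<tau>} \<Longrightarrow> \<phi> t 1 = 0"
    and b: "- \<tau> \<le> b" "b \<le> 1"
  shows "(LINT t|lborel. indicator ({0..\<tau>} \<times> {0..1}) (t, Z t b) *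
      (\<phi>t t (Z t b) + \<Lambda> (Z t b) (W t) * \<phi>x t (Z t b))) = - \<phi> (max 0 (- b)) (max 0 b)"
proof -
  obtain t1 where t1: "max 0 (- b) \<le> t1" "t1 \<le> \<tau>" "t1 = \<tau> \<or> Z t1 b = 1"
    and iff: "\<And>t. t \<in> {0..\<tau>} \<Longrightarrow> Z t b \<in> {0..1} \<longleftrightarrow> t \<in> {max 0 (- b)..t1}"
    using life_span[OF \<tau> b] by blast
  let ?S = "{max 0 (- b)..t1}"
  let ?f = "\<lambda>t. \<phi>t t (Z t b) + \<Lambda> (Z t b) (W t) * \<phi>x t (Z t b)"
  have S: "?S \<subseteq> {0..\<tau>}" using t1 by auto
  have Z: "Z s b \<in> {0..1}" if "s \<in> ?S" for s using iff[of s] that S by blast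
  have eq: "indicator ({0..\<tau>} \<times> {0..1}) (t, Z t b) = (indicator ?S t :: real)" for t
  proof (cases "t \<in> {0..\<tau>}")
    case True
    then show ?thesis using iff[OF True] by (simp add: indicator_def)
  next
    case False
    then show ?thesis using S by (auto simp: indicator_def)
  qed
  have comp: "continuous_on ?S (\<lambda>t. h (fst (t, Z t b)) (snd (t, Z t b)))"
    if "continuous_on ({0..\<tau>} \<times> {0..1}) (\<lambda>z. h (fst z) (snd z))" for h :: "real \<Rightarrow> real \<Rightarrow> real"
    by (rule continuous_on_compose2[OF that]) (use S Z in \<open>auto intro!: continuous_intros\<close>)
  have "continuous_on ?S ?f"
    using comp[OF C1_rect_continuous(2)[OF C1]] comp[OF C1_rect_continuous(3)[OF C1]]
    by (auto intro!: continuous_intros)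
  then have "(LINT t|lborel. indicator ?S t *\<^sub>R ?f t) = \<phi> t1 (Z t1 b) - \<phi> (max 0 (- b)) (Z (max 0 (- b)) b)"
    using test_deriv_along[OF \<tau> C1 S Z]
    by (intro integral_FTC_atLeastAtMost[where F="\<lambda>t. \<phi> t (Z t b)"] t1) auto
  moreover have "\<phi> t1 (Z t1 b) = 0"
    using t1(3) z Z[of t1] t1(1,2) S by auto
  moreover have "Z (max 0 (- b)) b = max 0 b" using Z_start[of b] b \<tau> by auto
  ultimately show ?thesis by (simp add: eq)
qed

end

context transport
begin

text \<open>In label variables the order of integration in time and label can be exchanged, after
  which \<open>integral_along\<close> evaluates the time integral for each particle. Positive labels
  yield the initial term, negative ones the inflow term.\<close>

lemma weak_\<rho>: "linear_weak (\<lambda>t x. \<Lambda> x (W t)) T g (\<lambda>t. g (- t)) \<rho>"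
  unfolding linear_weak_def
proof (intro ballI allI impI)
  fix \<tau> \<phi> \<phi>t \<phi>x
  assume \<tau>: "\<tau> \<in> {0..T}" and C1: "C1_rect {0..\<tau>} {0..1} \<phi> \<phi>t \<phi>x"
    and z\<tau>: "\<forall>x\<in>{0..1}. \<phi> \<tau> x = 0" and z1: "\<forall>t\<in>{0..\<tau>}. \<phi> t 1 = 0"
  define R where "R = {0..\<tau>} \<times> {0..1::real}"
  have R: "compact R" "R \<in> sets borel" unfolding R_def by (auto intro: compact_Times simp: borel_prod[symmetric])
  define \<psi> where "\<psi> t x = \<phi>t t x + \<Lambda> x (W t) * \<phi>x t x" for t x
  \<comment> \<open>Nothing is known about the test function off the rectangle. The cut-offs are
    bounded Borel functions on the whole plane, as Fubini's theorem and the label formula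
    require.\<close>
  define \<psi>' where "\<psi>' z = indicator R z * \<psi> (fst z) (snd z)" for z
  define \<phi>' where "\<phi>' z = indicator R z * \<phi> (fst z) (snd z)" for z
  note cont = C1_rect_continuous[OF C1, folded R_def]
  have cont\<psi>: "continuous_on R (\<lambda>z. \<psi> (fst z) (snd z))"
    unfolding \<psi>_def by (intro continuous_intros cont)
  have [measurable]: "\<psi>' \<in> borel_measurable borel" "\<phi>' \<in> borel_measurable borel"
    unfolding \<psi>'_def \<phi>'_def
    using borel_measurable_continuous_on_indicator[OF R(2) cont\<psi>]
      borel_measurable_continuous_on_indicator[OF R(2) cont(1)] by simp_all
  have sec [measurable]: "(\<lambda>x. h (f x, f' x)) \<in> borel_measurable borel"
    if "h \<in> borel_measurable borel" "f \<in> borel_measurable borel" "f' \<in> borel_measurable borel"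
    for h :: "real \<times> real \<Rightarrow> real" and f f' :: "real \<Rightarrow> real"
    using that by measurable
  have bnd: "\<exists>K. \<forall>z. \<bar>indicator R z * h z\<bar> \<le> K" if ch: "continuous_on R h" for h :: "real \<times> real \<Rightarrow> real"
  proof -
    obtain K where "\<forall>z\<in>R. norm (h z) \<le> K"
      using compact_imp_bounded[OF compact_continuous_image[OF ch R(1)]]
      unfolding bounded_iff by blast
    then have "\<bar>indicator R z * h z\<bar> \<le> max K 0" for z
      by (auto simp: indicator_def intro: order_trans)
    then show ?thesis by blast
  qed
  from bnd[OF cont\<psi>] obtain K where K: "\<And>z. \<bar>\<psi>' z\<bar> \<le> K" unfolding \<psi>'_def by blast
  from bnd[OF cont(1)] obtain K' where K': "\<And>z. \<bar>\<phi>' z\<bar> \<le> K'" unfolding \<phi>'_def by blast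

  have inner: "(LINT x|lebesgue_on {0<..<1}. \<rho> t x * \<psi> t x) = (LINT b|lborel. g b * \<psi>' (t, Z t b))"
    if t: "t \<in> {0<..<\<tau>}" for t
  proof -
    have "(LINT x|lebesgue_on {0<..<1}. \<rho> t x * \<psi> t x) = (LINT x|lebesgue_on {0<..<1}. \<rho> t x * \<psi>' (t, x))"
      using t by (intro Bochner_Integration.integral_cong) (auto simp: \<psi>'_def R_def)
    also have "\<dots> = (LINT x|lborel. indicator {0..1} x * (\<rho> t x * \<psi>' (t, x)))"
      by (rule lint_lebesgue_on_Ioo) measurable
    also have "\<dots> = (LINT b|lborel. g b * (indicator {0..1} (Z t b) * \<psi>' (t, Z t b)))"
      by (rule integral_\<rho>[OF _ K]) measurable
    also have "\<dots> = (LINT b|lborel. g b * \<psi>' (t, Z t b))"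
      by (intro Bochner_Integration.integral_cong) (auto simp: \<psi>'_def R_def indicator_def)
    finally show ?thesis .
  qed
  have Zm [measurable]: "(\<lambda>z. Z (fst z) (snd z)) \<in> borel_measurable borel" "Z t \<in> borel_measurable borel" for t
    by (intro borel_measurable_continuous_onI continuous_intros)+
  have pair [measurable]: "(\<lambda>z. g (snd z) * \<psi>' (fst z, Z (fst z) (snd z))) \<in> borel_measurable borel"
  proof (rule borel_measurable_times)
    have fst_snd: "(fst :: real \<times> real \<Rightarrow> real) \<in> borel_measurable borel"
        "(snd :: real \<times> real \<Rightarrow> real) \<in> borel_measurable borel"
      by (intro borel_measurable_continuous_onI continuous_intros)+
    show "(\<lambda>z :: real \<times> real. g (snd z)) \<in> borel_measurable borel"
      by (rule measurable_compose[OF fst_snd(2) g_measurable])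
    show "(\<lambda>z. \<psi>' (fst z, Z (fst z) (snd z))) \<in> borel_measurable borel"
      by (rule measurable_compose[OF borel_measurable_Pair[OF fst_snd(1) Zm(1)]]) measurable
  qed
  have int: "integrable lborel (\<lambda>z. g (snd z) * \<psi>' (fst z, Z (fst z) (snd z)))"
  proof (rule integrable_bounded_support[OF pair])
    show "\<bar>g (snd z) * \<psi>' (fst z, Z (fst z) (snd z))\<bar> \<le> B * K" for z
      unfolding abs_mult using K g_nonneg g_le B_nonneg by (intro mult_mono) auto
    show "g (snd z) * \<psi>' (fst z, Z (fst z) (snd z)) = 0" if "z \<notin> {0..\<tau>} \<times> {- T..1}" for z
      using that g_support[of "snd z"] by (cases z) (auto simp: \<psi>'_def R_def)
    show "{0..\<tau>} \<times> {- T..1} \<in> sets borel" by (simp add: borel_prod[symmetric])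
  qed (auto intro: bounded_Times)
  have int2: "integrable (lborel \<Otimes>\<^sub>M lborel) (\<lambda>(t, b). g b * \<psi>' (t, Z t b))"
    using int unfolding lborel_prod split_beta' .
  have outer_meas [measurable]: "(\<lambda>t. LINT b|lborel. g b * \<psi>' (t, Z t b)) \<in> borel_measurable borel"
    using borel_measurable_integrable[OF lborel_pair.integrable_fst'[OF int2]] by simp
  have "(LINT t|lebesgue_on {0<..<\<tau>}. LINT x|lebesgue_on {0<..<1}. \<rho> t x * \<psi> t x) =
      (LINT t|lebesgue_on {0<..<\<tau>}. LINT b|lborel. g b * \<psi>' (t, Z t b))"
    by (rule Bochner_Integration.integral_cong[OF refl inner]) simp
  also have "\<dots> = (LINT t|lborel. indicator {0..\<tau>} t * (LINT b|lborel. g b * \<psi>' (t, Z t b)))"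
    by (rule lint_lebesgue_on_Ioo[OF outer_meas])
  also have "\<dots> = (LINT t|lborel. LINT b|lborel. g b * \<psi>' (t, Z t b))"
  proof (rule Bochner_Integration.integral_cong[OF refl])
    fix t
    have "\<psi>' (t, Z t b) = 0" if "t \<notin> {0..\<tau>}" for b
      using that by (auto simp: \<psi>'_def R_def)
    then show "indicator {0..\<tau>} t * (LINT b|lborel. g b * \<psi>' (t, Z t b)) = (LINT b|lborel. g b * \<psi>' (t, Z t b))"
      by (cases "t \<in> {0..\<tau>}") auto
  qed
  also have "\<dots> = (LINT b|lborel. LINT t|lborel. g b * \<psi>' (t, Z t b))"
    by (rule lborel_pair.Fubini_integral[OF int2, symmetric])
  also have "\<dots> = (LINT b|lborel. - (indicator {-\<tau>..0} b * (g b * \<phi>' (- b, 0)))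
      - indicator {0..1} b * (g b * \<phi>' (0, b)))"
  proof (rule integral_cong_AE)
    \<comment> \<open>The label \<open>0\<close> belongs to both intervals on the right-hand side
      and would be counted twice.\<close>
    have "AE b in lborel. b \<noteq> (0::real)" using AE_lborel_singleton by blast
    then show "AE b in lborel. (LINT t|lborel. g b * \<psi>' (t, Z t b)) =
        - (indicator {-\<tau>..0} b * (g b * \<phi>' (- b, 0))) - indicator {0..1} b * (g b * \<phi>' (0, b))"
    proof eventually_elim
      case (elim b)
      consider "b < - \<tau>" | "- \<tau> \<le> b" "b \<le> 1" | "b > 1" by linarith
      then show ?case
      proof cases
        case 1
        have "\<psi>' (t, Z t b) = 0" for t
        proof (cases "t \<in> {0..\<tau>}")
          case True
          then have "\<not> 0 \<le> Z t b" using Z_nonneg_iff[of t b] \<tau> 1 by auto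
          then show ?thesis by (simp add: \<psi>'_def R_def)
        qed (auto simp: \<psi>'_def R_def)
        then show ?thesis using 1 \<tau> by (simp add: indicator_def)
      next
        case 2
        have "(LINT t|lborel. \<psi>' (t, Z t b)) = - \<phi> (max 0 (- b)) (max 0 b)"
          using integral_along[OF \<tau> C1 _ _ 2] z\<tau> z1 by (simp add: \<psi>'_def \<psi>_def R_def)
        then show ?thesis using 2 elim \<tau> by (auto simp: \<phi>'_def R_def indicator_def)
      next
        case 3
        then show ?thesis using g_support[of b] \<tau> by (simp add: indicator_def)
      qed
    qed
    show "(\<lambda>b. LINT t|lborel. g b * \<psi>' (t, Z t b)) \<in> borel_measurable lborel"
      using borel_measurable_integrable[OF lborel_pair.integrable_snd[OF int2]] by simp
  qed measurable
  also have "\<dots> = - (LINT b|lborel. indicator {-\<tau>..0} b * (g b * \<phi>' (- b, 0)))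
      - (LINT b|lborel. indicator {0..1} b * (g b * \<phi>' (0, b)))"
  proof -
    have 1: "integrable lborel (\<lambda>b. indicator {-\<tau>..0} b * (g b * \<phi>' (- b, 0)))"
      using integrable_mult_indicator[OF _ g_integrable[of "\<lambda>b. \<phi>' (- b, 0)" K'], of "{-\<tau>..0}"] K' by simp
    have 2: "integrable lborel (\<lambda>b. indicator {0..1} b * (g b * \<phi>' (0, b)))"
      using integrable_mult_indicator[OF _ g_integrable[of "\<lambda>b. \<phi>' (0, b)" K'], of "{0..1}"] K' by simp
    show ?thesis using 1 2 by simp
  qed
  finally have main: "(LINT t|lebesgue_on {0<..<\<tau>}. LINT x|lebesgue_on {0<..<1}. \<rho> t x * \<psi> t x) =
      - (LINT b|lborel. indicator {-\<tau>..0} b * (g b * \<phi>' (- b, 0)))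
      - (LINT b|lborel. indicator {0..1} b * (g b * \<phi>' (0, b)))" .
  have init: "(LINT x|lebesgue_on {0<..<1}. g x * \<phi> 0 x) = (LINT b|lborel. indicator {0..1} b * (g b * \<phi>' (0, b)))"
  proof -
    have "(LINT x|lebesgue_on {0<..<1}. g x * \<phi> 0 x) = (LINT x|lebesgue_on {0<..<1}. g x * \<phi>' (0, x))"
      using \<tau> by (intro Bochner_Integration.integral_cong) (auto simp: \<phi>'_def R_def)
    also have "\<dots> = (LINT b|lborel. indicator {0..1} b * (g b * \<phi>' (0, b)))"
      by (rule lint_lebesgue_on_Ioo) measurable
    finally show ?thesis .
  qed
  have bdry: "(LINT t|lebesgue_on {0<..<\<tau>}. g (- t) * \<phi> t 0) = (LINT b|lborel. indicator {-\<tau>..0} b * (g b * \<phi>' (- b, 0)))"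
  proof -
    have "(LINT t|lebesgue_on {0<..<\<tau>}. g (- t) * \<phi> t 0) = (LINT t|lebesgue_on {0<..<\<tau>}. g (- t) * \<phi>' (t, 0))"
      using \<tau> by (intro Bochner_Integration.integral_cong) (auto simp: \<phi>'_def R_def)
    also have "\<dots> = (LINT t|lborel. indicator {0..\<tau>} t * (g (- t) * \<phi>' (t, 0)))"
      by (rule lint_lebesgue_on_Ioo) measurable
    also have "\<dots> = (LINT b|lborel. indicator {0..\<tau>} (- b) * (g b * \<phi>' (- b, 0)))"
      using lborel_integral_real_affine[of "-1" "\<lambda>t. indicator {0..\<tau>} t * (g (- t) * \<phi>' (t, 0))" 0] by simp
    also have "\<dots> = (LINT b|lborel. indicator {-\<tau>..0} b * (g b * \<phi>' (- b, 0)))"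
      by (intro Bochner_Integration.integral_cong) (auto simp: indicator_def)
    finally show ?thesis .
  qed
  show "(LINT t|lebesgue_on {0<..<\<tau>}. LINT x|lebesgue_on {0<..<1}. \<rho> t x * (\<phi>t t x + \<Lambda> x (W t) * \<phi>x t x))
      + (LINT t|lebesgue_on {0<..<\<tau>}. g (- t) * \<phi> t 0)
      + (LINT x|lebesgue_on {0<..<1}. g x * \<phi> 0 x) = 0"
    using main init bdry by (simp add: \<psi>_def)
qed

end

section \<open>Continuity in time\<close>

lemma borel_measurable_lebesgue_on:
  fixes f :: "'a::euclidean_space \<Rightarrow> real"
  shows "f \<in> borel_measurable borel \<Longrightarrow> f \<in> borel_measurable (lebesgue_on S)"
  by (intro measurable_restrict_space1 measurable_completion) simp

lemma integrable_lebesgue_on_Ioo: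
  fixes f :: "real \<Rightarrow> real"
  assumes f: "f \<in> borel_measurable borel" and K: "\<And>x. \<bar>f x\<bar> \<le> K"
  shows "integrable (lebesgue_on {a<..<b}) f"
proof -
  have [measurable]: "f \<in> borel_measurable borel" by (rule f)
  have "integrable lborel (\<lambda>x. indicator {a<..<b} x * f x)"
    by (rule integrable_bounded_Icc[of _ a b K]) (use K in \<open>auto simp: indicator_def intro: order_trans[OF abs_ge_zero]\<close>)
  moreover have "(\<lambda>x. indicator {a<..<b} x * f x) \<in> borel_measurable lborel" by measurable
  ultimately show ?thesis
    by (subst integrable_restrict_space) (auto simp: integrable_completion)
qed

text \<open>A measurable function is almost everywhere a limit of continuous ones. Truncating these
  to \<open>[0, M]\<close> keeps the limit, since \<open>f\<close> has values there, and supplies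
  the bound for dominated convergence.\<close>

lemma L1_approx_continuous:
  fixes f :: "real \<Rightarrow> real"
  assumes [measurable]: "f \<in> borel_measurable borel" and f: "\<And>x. 0 \<le> f x" "\<And>x. f x \<le> M" and "0 < e"
  obtains h where "continuous_on UNIV h" "\<And>x. 0 \<le> h x" "\<And>x. h x \<le> M"
    "(LINT x|lborel. indicator {a..b} x * \<bar>f x - h x\<bar>) < e"
proof -
  have "f \<in> borel_measurable lebesgue" by (simp add: measurable_completion)
  then have "f measurable_on UNIV"
    using f(1) by (rule lebesgue_measurable_imp_measurable_on_nnreal_UNIV)
  then obtain N p where N: "negligible N" and p: "\<And>n. continuous_on UNIV (p n)"
    and lim: "\<And>x. x \<notin> N \<Longrightarrow> (\<lambda>n. p n x) \<longlonglongrightarrow> f x"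
    unfolding measurable_on_def by auto
  define h where "h n x = max 0 (min M (p n x))" for n x
  have M: "0 \<le> M" using f[of 0] by linarith
  have conth: "continuous_on UNIV (h n)" for n
    unfolding h_def by (intro continuous_intros p)
  then have [measurable]: "h n \<in> borel_measurable borel" for n
    by (rule borel_measurable_continuous_onI)
  have "(\<lambda>n. LINT x|lborel. indicator {a..b} x * \<bar>f x - h n x\<bar>) \<longlonglongrightarrow> (LINT x|(lborel::real measure). 0)"
  proof (rule integral_dominated_convergence)
    show "integrable lborel (\<lambda>x. M * indicator {a..b} x :: real)" by (rule integrable_const_indicator)
    show "AE x in lborel. norm (indicator {a..b} x * \<bar>f x - h n x\<bar>) \<le> M * indicator {a..b} x" for n
    proof (rule AE_I2)
      fix x
      have "0 \<le> h n x" "h n x \<le> M" using M by (auto simp: h_def)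
      then show "norm (indicator {a..b} x * \<bar>f x - h n x\<bar>) \<le> M * indicator {a..b} x"
        using f[of x] by (auto simp: indicator_def)
    qed
    have "AE x in lebesgue. x \<notin> N"
      using N by (intro AE_not_in) (simp add: negligible_iff_null_sets)
    then have "AE x in lborel. x \<notin> N" by (simp only: AE_completion_iff)
    then show "AE x in lborel. (\<lambda>n. indicator {a..b} x * \<bar>f x - h n x\<bar>) \<longlonglongrightarrow> 0"
    proof eventually_elim
      case (elim x)
      have "(\<lambda>n. h n x) \<longlonglongrightarrow> max 0 (min M (f x))"
        unfolding h_def by (intro tendsto_intros lim elim)
      then have "(\<lambda>n. h n x) \<longlonglongrightarrow> f x" using f[of x] by simp
      then have "(\<lambda>n. indicator {a..b} x * \<bar>f x - h n x\<bar>) \<longlonglongrightarrow> indicator {a..b} x * \<bar>f x - f x\<bar>"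
        by (intro tendsto_intros)
      then show ?case by simp
    qed
  qed measurable
  then have "(\<lambda>n. LINT x|lborel. indicator {a..b} x * \<bar>f x - h n x\<bar>) \<longlonglongrightarrow> 0" by simp
  from order_tendstoD(2)[OF this \<open>0 < e\<close>]
  obtain n where "(LINT x|lborel. indicator {a..b} x * \<bar>f x - h n x\<bar>) < e"
    using eventually_happens' sequentially_bot by blast
  then show thesis by (intro that[of "h n"] conth) (use M in \<open>auto simp: h_def\<close>)
qed

context transport
begin

lemma \<rho>_bound: "\<bar>\<rho> t x\<bar> \<le> B / k\<zeta> * exp (L * T)"
  using \<rho>_nonneg \<rho>_le by simp

text \<open>The substitution by \<open>Y t\<close> preserves L1 distances, and all feet of points of
  \<open>[0,1]\<close> lie in \<open>{- (C * T)..1}\<close>. The resulting bound does not depend on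
  \<open>t\<close>.\<close>

lemma L1_distance_label:
  assumes [measurable]: "h \<in> borel_measurable borel" and h: "\<And>y. 0 \<le> h y" "\<And>y. h y \<le> B / k\<zeta>"
  shows "integrable lborel (\<lambda>x. indicator {0..1} x * \<bar>\<rho> t x - h (Y t x) * J t x\<bar>)"
    "(LINT x|lborel. indicator {0..1} x * \<bar>\<rho> t x - h (Y t x) * J t x\<bar>)
      \<le> (LINT y|lborel. indicator {- (C * T)..1} y * \<bar>r y - h y\<bar>)"
proof -
  define f where "f y = indicator {- (C * T)..1} y * \<bar>r y - h y\<bar>" for y
  have int: "integrable lborel f"
  proof (rule integrable_bounded_Icc[of _ "- (C * T)" 1])
    show "\<bar>f y\<bar> \<le> B / k\<zeta>" for y
      using h[of y] r_nonneg[of y] r_le[of y] by (auto simp: f_def indicator_def abs_le_iff)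
  qed (auto simp: f_def[abs_def])
  have eq: "indicator {0..1} x * \<bar>\<rho> t x - h (Y t x) * J t x\<bar> = indicator {0..1} x * (f (Y t x) * J t x)" for x
  proof (cases "x \<in> {0..1}")
    case True
    then have "Y t x \<in> {- (C * T)..1}"
      using X_bounds(1)[of "Y t x" t] X_bounds(2)[of t "Y t x"] by auto
    moreover have "\<bar>\<rho> t x - h (Y t x) * J t x\<bar> = \<bar>r (Y t x) - h (Y t x)\<bar> * J t x"
      using J_pos[of t x] by (simp add: \<rho>_def abs_mult flip: left_diff_distrib)
    ultimately show ?thesis by (simp add: f_def)
  qed simp
  show "integrable lborel (\<lambda>x. indicator {0..1} x * \<bar>\<rho> t x - h (Y t x) * J t x\<bar>)"
    unfolding eq by (rule integral_space(1)[OF int])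
  have "(LINT x|lborel. indicator {0..1} x * \<bar>\<rho> t x - h (Y t x) * J t x\<bar>)
      = (LINT y|lborel. indicator {Y t 0..Y t 1} y * f y)"
    unfolding eq by (rule integral_space(2)[OF int])
  also have "\<dots> \<le> (LINT y|lborel. f y)"
  proof (rule integral_mono)
    show "integrable lborel (\<lambda>y. indicator {Y t 0..Y t 1} y * f y)"
      using integrable_mult_indicator[OF _ int] by simp
    show "integrable lborel f" by (rule int)
  qed (auto simp: f_def indicator_def)
  finally show "(LINT x|lborel. indicator {0..1} x * \<bar>\<rho> t x - h (Y t x) * J t x\<bar>)
      \<le> (LINT y|lborel. indicator {- (C * T)..1} y * \<bar>r y - h y\<bar>)"
    by (simp add: f_def)
qed

text \<open>As \<open>r\<close> is merely measurable, it is replaced by a continuous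
  \<open>h\<close>: then \<open>h (Y t x) * J t x\<close> is continuous in \<open>t\<close> for each
  \<open>x\<close>, and dominated convergence applies. The error of the replacement is uniform in
  time, so three thirds of \<open>e\<close> suffice.\<close>

lemma \<rho>_continuous_L1:
  assumes s: "s \<longlonglongrightarrow> t"
  shows "(\<lambda>n. LINT x|lborel. indicator {0..1} x * \<bar>\<rho> (s n) x - \<rho> t x\<bar>) \<longlonglongrightarrow> 0"
proof (rule LIMSEQ_I)
  fix e :: real assume "0 < e"
  then have "0 < e / 3" by simp
  then obtain h where conth: "continuous_on UNIV h" and h: "\<And>x. 0 \<le> h x" "\<And>x. h x \<le> B / k\<zeta>"
    and small: "(LINT y|lborel. indicator {- (C * T)..1} y * \<bar>r y - h y\<bar>) < e / 3"
    by (rule L1_approx_continuous[OF r_measurable r_nonneg r_le, where a="- (C * T)" and b=1])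
       (intro that; assumption)
  have [measurable]: "h \<in> borel_measurable borel"
    by (rule borel_measurable_continuous_onI[OF conth])
  define q where "q t x = h (Y t x) * J t x" for t x
  define D where "D f = (LINT x|lborel. indicator {0..1} x * \<bar>f x\<bar>)" for f :: "real \<Rightarrow> real"
  define M where "M = B / k\<zeta> * exp (L * T)"
  have q: "\<bar>q t x\<bar> \<le> M" "\<bar>\<rho> t x\<bar> \<le> M" for t x
  proof -
    show "\<bar>\<rho> t x\<bar> \<le> M" unfolding M_def by (rule \<rho>_bound)
    have "h (Y t x) * J t x \<le> M"
      unfolding M_def using h J_le J_pos B_nonneg k\<zeta>_pos by (intro mult_mono) (auto simp: less_imp_le)
    then show "\<bar>q t x\<bar> \<le> M" using h[of "Y t x"] J_pos[of t x] by (simp add: q_def)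
  qed
  have contq: "continuous_on S (\<lambda>z. q (f z) (f' z))" if "continuous_on S f" "continuous_on S f'" for S :: "real set" and f f'
    unfolding q_def by (intro continuous_intros that continuous_on_compose2[OF conth]) auto
  have [measurable]: "q t \<in> borel_measurable borel" for t
    by (intro borel_measurable_continuous_onI contq continuous_intros)
  have intD: "integrable lborel (\<lambda>x. indicator {0..1} x * \<bar>f x\<bar>)"
    if [measurable]: "f \<in> borel_measurable borel" and "\<And>x. \<bar>f x\<bar> \<le> K" for f :: "real \<Rightarrow> real" and K
    by (rule integrable_bounded_Icc[of _ 0 1 K]) (use that(2) in \<open>auto simp: indicator_def\<close>)
  have "(\<lambda>n. D (\<lambda>x. q (s n) x - q t x)) \<longlonglongrightarrow> (LINT x|(lborel :: real measure). 0)"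
    unfolding D_def
  proof (rule integral_dominated_convergence)
    show "integrable lborel (\<lambda>x :: real. (2 * M) * indicator {0..1} x :: real)" by (rule integrable_const_indicator)
    show "AE x in lborel. norm (indicator {0..1} x * \<bar>q (s n) x - q t x\<bar>) \<le> 2 * M * indicator {0..1} x" for n
    proof (rule AE_I2)
      fix x
      show "norm (indicator {0..1} x * \<bar>q (s n) x - q t x\<bar>) \<le> 2 * M * indicator {0..1} x"
        using q(1)[of "s n" x] q(1)[of t x] by (auto simp: indicator_def)
    qed
    show "AE x in lborel. (\<lambda>n. indicator {0..1} x * \<bar>q (s n) x - q t x\<bar>) \<longlonglongrightarrow> 0"
    proof (rule AE_I2)
      fix x
      have "isCont (\<lambda>t. q t x) t"
        using contq[of UNIV "\<lambda>t. t" "\<lambda>_. x"] by (simp add: continuous_on_eq_continuous_at)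
      from isCont_tendsto_compose[OF this s]
      have "(\<lambda>n. indicator {0..1} x * \<bar>q (s n) x - q t x\<bar>) \<longlonglongrightarrow> indicator {0..1} x * \<bar>q t x - q t x\<bar>"
        by (intro tendsto_intros)
      then show "(\<lambda>n. indicator {0..1} x * \<bar>q (s n) x - q t x\<bar>) \<longlonglongrightarrow> 0" by simp
    qed
  qed measurable
  then have "(\<lambda>n. D (\<lambda>x. q (s n) x - q t x)) \<longlonglongrightarrow> 0" by simp
  from order_tendstoD(2)[OF this \<open>0 < e / 3\<close>]
  obtain n0 where n0: "\<And>n. n \<ge> n0 \<Longrightarrow> D (\<lambda>x. q (s n) x - q t x) < e / 3"
    unfolding eventually_sequentially by blast
  have close: "D (\<lambda>x. \<rho> t x - q t x) < e / 3" for t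
    using L1_distance_label(2)[of h t] h small unfolding D_def q_def by force
  have "norm (D (\<lambda>x. \<rho> (s n) x - \<rho> t x) - 0) < e" if "n \<ge> n0" for n
  proof -
    have int: "integrable lborel (\<lambda>x. indicator {0..1} x * \<bar>\<rho> t x - q t x\<bar>)"
      "integrable lborel (\<lambda>x. indicator {0..1} x * \<bar>q t x - q t' x\<bar>)"
      "integrable lborel (\<lambda>x. indicator {0..1} x * \<bar>\<rho> t x - \<rho> t' x\<bar>)" for t t'
    proof -
      have M: "\<bar>a - b\<bar> \<le> 2 * M" if "\<bar>a\<bar> \<le> M" "\<bar>b\<bar> \<le> M" for a b using that by linarith
      show "integrable lborel (\<lambda>x. indicator {0..1} x * \<bar>\<rho> t x - q t x\<bar>)"
      "integrable lborel (\<lambda>x. indicator {0..1} x * \<bar>q t x - q t' x\<bar>)"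
      "integrable lborel (\<lambda>x. indicator {0..1} x * \<bar>\<rho> t x - \<rho> t' x\<bar>)"
        by (rule intD[OF _ M[OF q(2) q(1)]] intD[OF _ M[OF q(1) q(1)]] intD[OF _ M[OF q(2) q(2)]]; measurable)+
    qed
    have "D (\<lambda>x. \<rho> (s n) x - \<rho> t x) \<le> (LINT x|lborel. indicator {0..1} x * \<bar>\<rho> (s n) x - q (s n) x\<bar>
        + indicator {0..1} x * \<bar>q (s n) x - q t x\<bar> + indicator {0..1} x * \<bar>\<rho> t x - q t x\<bar>)"
      unfolding D_def
      by (intro integral_mono Bochner_Integration.integrable_add int) (auto simp: indicator_def)
    also have "\<dots> = D (\<lambda>x. \<rho> (s n) x - q (s n) x) + D (\<lambda>x. q (s n) x - q t x) + D (\<lambda>x. \<rho> t x - q t x)"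
      using int by (simp add: D_def)
    also have "\<dots> < e" using close[of "s n"] close[of t] n0[OF that] by linarith
    finally have "D (\<lambda>x. \<rho> (s n) x - \<rho> t x) < e" .
    moreover have "0 \<le> D (\<lambda>x. \<rho> (s n) x - \<rho> t x)"
      unfolding D_def by (intro Bochner_Integration.integral_nonneg) auto
    ultimately show ?thesis by simp
  qed
  then show "\<exists>no. \<forall>n\<ge>no. norm ((LINT x|lborel. indicator {0..1} x * \<bar>\<rho> (s n) x - \<rho> t x\<bar>) - 0) < e"
    unfolding D_def by blast
qed

text \<open>A difference bounded by \<open>M\<close> satisfies
  \<open>\<bar>d\<bar> powr p \<le> M powr (p - 1) * \<bar>d\<bar>\<close>, so convergence in L1
  together with the uniform bound gives convergence in every Lp.\<close>

lemma \<rho>_C0_Lp: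
  assumes p: "1 \<le> p"
  shows "C0_Lp p T \<rho>"
  unfolding C0_Lp_def
proof (intro conjI ballI)
  define M where "M = 2 * (B / k\<zeta> * exp (L * T))"
  have M: "\<bar>\<rho> s x - \<rho> t x\<bar> \<le> M" "\<bar>\<rho> t x\<bar> \<le> M" "0 \<le> M" for s t x
    using \<rho>_bound[of s x] \<rho>_bound[of t x] by (auto simp: M_def)
  fix t assume t: "t \<in> {0..T}"
  show "Lp p {0<..<1} (\<rho> t)"
    unfolding Lp_def
  proof
    show "\<rho> t \<in> borel_measurable (lebesgue_on {0<..<1})"
      by (rule borel_measurable_lebesgue_on) measurable
    show "integrable (lebesgue_on {0<..<1}) (\<lambda>x. \<bar>\<rho> t x\<bar> powr p)"
      by (rule integrable_lebesgue_on_Ioo[where K="M powr p"]) (use M p in \<open>auto intro!: powr_mono2\<close>)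
  qed
  show "((\<lambda>s. Lp_norm p {0<..<1} (\<lambda>x. \<rho> s x - \<rho> t x)) \<longlongrightarrow> 0) (at t within {0..T})"
    unfolding tendsto_at_iff_sequentially comp_def
  proof (intro allI impI)
    fix s :: "nat \<Rightarrow> real" assume s: "s \<longlonglongrightarrow> t"
    define I where "I n = (LINT x|lborel. indicator {0..1} x * (\<bar>\<rho> (s n) x - \<rho> t x\<bar> powr p))" for n
    define D where "D n = (LINT x|lborel. indicator {0..1} x * \<bar>\<rho> (s n) x - \<rho> t x\<bar>)" for n
    have le: "I n \<le> M powr (p - 1) * D n" for n
    proof -
      have pw: "\<bar>d\<bar> powr p \<le> M powr (p - 1) * \<bar>d\<bar>" if "\<bar>d\<bar> \<le> M" for d
      proof (cases "d = 0")
        case False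
        then have "\<bar>d\<bar> powr p = \<bar>d\<bar> powr (p - 1) * \<bar>d\<bar>"
          by (simp flip: powr_mult_base' add: powr_diff)
        also have "\<dots> \<le> M powr (p - 1) * \<bar>d\<bar>"
          using that p by (intro mult_right_mono powr_mono2) auto
        finally show ?thesis .
      qed simp
      have "I n \<le> (LINT x|lborel. M powr (p - 1) * (indicator {0..1} x * \<bar>\<rho> (s n) x - \<rho> t x\<bar>))"
        unfolding I_def
      proof (rule integral_mono)
        show "integrable lborel (\<lambda>x. indicator {0..1} x * (\<bar>\<rho> (s n) x - \<rho> t x\<bar> powr p))"
          by (rule integrable_bounded_Icc[of _ 0 1 "M powr p"])
            (use M p in \<open>auto simp: indicator_def intro!: powr_mono2\<close>)
        show "integrable lborel (\<lambda>x. M powr (p - 1) * (indicator {0..1} x * \<bar>\<rho> (s n) x - \<rho> t x\<bar>))"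
          by (intro integrable_mult_right integrable_bounded_Icc[of _ 0 1 M])
            (use M in \<open>auto simp: indicator_def\<close>)
      qed (use pw M in \<open>auto simp: indicator_def\<close>)
      then show ?thesis by (simp add: D_def)
    qed
    have "D \<longlonglongrightarrow> 0" unfolding D_def by (rule \<rho>_continuous_L1[OF s])
    then have lim: "(\<lambda>n. M powr (p - 1) * D n) \<longlonglongrightarrow> 0" by (rule tendsto_mult_right_zero)
    have I0: "0 \<le> I n" for n unfolding I_def by (intro Bochner_Integration.integral_nonneg) auto
    have "I \<longlonglongrightarrow> 0"
      by (rule tendsto_sandwich[OF _ _ tendsto_const lim]) (use I0 le in auto)
    then have "(\<lambda>n. I n powr (1 / p)) \<longlonglongrightarrow> 0"
      using I0 p by (intro tendsto_zero_powrI[where b="1 / p"]) auto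
    moreover have "Lp_norm p {0<..<1} (\<lambda>x. \<rho> (s n) x - \<rho> t x) = I n powr (1 / p)" for n
      unfolding Lp_norm_def I_def by (subst lint_lebesgue_on_Ioo) auto
    ultimately show "(\<lambda>n. Lp_norm p {0<..<1} (\<lambda>x. \<rho> (s n) x - \<rho> t x)) \<longlonglongrightarrow> 0" by simp
  qed
qed

lemma \<rho>_Linf: "Linf S (\<lambda>(t, x). \<rho> t x)"
  unfolding Linf_def
  using borel_measurable_lebesgue_on[OF \<rho>_measurable_pair] \<rho>_bound
  by (auto intro!: exI[of _ "B / k\<zeta> * exp (L * T)"] AE_I2)

end

section \<open>Uniqueness for a given velocity\<close>

text \<open>The positive and the negative part of \<open>f\<close> are densities of two finite
  measures that agree on all half-lines, hence everywhere; densities are unique up to null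
  sets.\<close>

lemma AE_zero_if_tail_integrals_zero:
  fixes f :: "real \<Rightarrow> real"
  assumes int: "integrable lborel f" and zero: "\<And>a. (LINT x|lborel. indicator {a<..} x * f x) = 0"
  shows "AE x in lborel. f x = 0"
proof -
  have [measurable]: "f \<in> borel_measurable lborel" using int by auto
  define p where "p x = max 0 (f x)" for x
  define n where "n x = max 0 (- f x)" for x
  have [measurable]: "p \<in> borel_measurable lborel" "n \<in> borel_measurable lborel"
    unfolding p_def n_def by measurable
  have intp: "integrable lborel p" "integrable lborel n"
    using int unfolding p_def[abs_def] n_def[abs_def] by auto
  have emeas: "emeasure (density lborel (\<lambda>x. ennreal (h x))) {a<..} = ennreal (LINT x|lborel. indicator {a<..} x * h x)"
    if "integrable lborel h" "\<And>x. 0 \<le> h x" for h :: "real \<Rightarrow> real" and a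
  proof -
    have [measurable]: "h \<in> borel_measurable lborel" using that by auto
    have "emeasure (density lborel (\<lambda>x. ennreal (h x))) {a<..} = (\<integral>\<^sup>+x. ennreal (h x) * indicator {a<..} x \<partial>lborel)"
      by (subst emeasure_density) auto
    also have "\<dots> = (\<integral>\<^sup>+x. ennreal (indicator {a<..} x * h x) \<partial>lborel)"
      by (intro nn_integral_cong) (auto simp: indicator_def)
    also have "\<dots> = ennreal (LINT x|lborel. indicator {a<..} x * h x)"
      using integrable_mult_indicator[OF _ that(1), of "{a<..}"] that(2)
      by (intro nn_integral_eq_integral) auto
    finally show ?thesis .
  qed
  have "density lborel (\<lambda>x. ennreal (p x)) = density lborel (\<lambda>x. ennreal (n x))"
  proof (rule measure_eqI_lessThan)
    fix a
    have "(LINT x|lborel. indicator {a<..} x * p x) - (LINT x|lborel. indicator {a<..} x * n x)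
        = (LINT x|lborel. indicator {a<..} x * p x - indicator {a<..} x * n x)"
      using integrable_mult_indicator[OF _ intp(1), of "{a<..}"] integrable_mult_indicator[OF _ intp(2), of "{a<..}"]
      by (intro Bochner_Integration.integral_diff[symmetric]) auto
    also have "\<dots> = (LINT x|lborel. indicator {a<..} x * f x)"
      by (intro Bochner_Integration.integral_cong) (auto simp: p_def n_def indicator_def)
    finally have "(LINT x|lborel. indicator {a<..} x * p x) = (LINT x|lborel. indicator {a<..} x * n x)"
      using zero by simp
    then show "emeasure (density lborel (\<lambda>x. ennreal (p x))) {a<..} = emeasure (density lborel (\<lambda>x. ennreal (n x))) {a<..}"
      using emeas[OF intp(1)] emeas[OF intp(2)] by (simp add: p_def n_def)
    show "emeasure (density lborel (\<lambda>x. ennreal (p x))) {a<..} < \<infinity>"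
      using emeas[OF intp(1)] by (simp add: p_def)
  qed auto
  then have "AE x in lborel. ennreal (p x) = ennreal (n x)"
    by (subst (asm) sigma_finite_measure.density_unique_iff[OF sigma_finite_lborel]) auto
  then show ?thesis
    by eventually_elim (auto simp: p_def n_def max_def split: if_splits)
qed

lemma integral_lebesgue_on_AE_borel:
  fixes f f' :: "real \<Rightarrow> real"
  assumes "f' \<in> borel_measurable borel" and "S \<in> sets lebesgue"
    and "f \<in> borel_measurable (lebesgue_on S)"
    and "AE x in lborel. indicator S x * f x = f' x"
  shows "(LINT x|lebesgue_on S. f x) = (LINT x|lborel. f' x)"
    "integrable (lebesgue_on S) f \<Longrightarrow> integrable lborel f'"
proof -
  have ae: "AE x in lebesgue. indicator S x * f x = f' x"
    using assms(4) by (rule AE_completion)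
  have meas: "(\<lambda>x. indicator S x * f x) \<in> borel_measurable lebesgue"
    using assms(2,3) by (simp add: borel_measurable_restrict_space_iff)
  have meas': "f' \<in> borel_measurable lebesgue" using assms(1) by (simp add: measurable_completion)
  have "(LINT x|lebesgue_on S. f x) = (LINT x|lebesgue. indicator S x * f x)"
    using assms(2) by (subst integral_restrict_space) auto
  also have "\<dots> = (LINT x|lebesgue. f' x)" by (rule integral_cong_AE[OF meas meas' ae])
  also have "\<dots> = (LINT x|lborel. f' x)" using assms(1) by (intro integral_completion) simp
  finally show "(LINT x|lebesgue_on S. f x) = (LINT x|lborel. f' x)" .
  assume "integrable (lebesgue_on S) f"
  then have "integrable lebesgue (\<lambda>x. indicator S x * f x)"
    using assms(2) by (simp add: integrable_restrict_space)
  then have "integrable lebesgue f'" using integrable_cong_AE[OF meas meas' ae] by simp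
  then show "integrable lborel f'" using assms(1) by (simp add: integrable_completion)
qed

text \<open>Test functions vanish at \<open>x = 1\<close>, so only segments that end before
  \<open>1\<close> can be tested. Letting their ends tend to \<open>1\<close> gives the total
  integral, and by subtraction all tail integrals.\<close>

lemma AE_zero_on_unit_interval:
  fixes f :: "real \<Rightarrow> real"
  assumes int: "integrable (lebesgue_on {0<..<1}) f"
    and zero: "\<And>a. a \<in> {0<..<1} \<Longrightarrow> (LINT x|lebesgue_on {0<..<1}. f x * indicator {..<a} x) = 0"
  shows "AE x in lebesgue_on {0<..<1}. f x = 0"
proof -
  let ?S = "{0<..<1::real}"
  let ?M = "lebesgue_on ?S"
  have f [measurable]: "f \<in> borel_measurable ?M" using int by auto
  have [measurable]: "(\<lambda>x. indicator A x :: real) \<in> borel_measurable ?M" if "A \<in> sets borel" for A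
    using that by (intro borel_measurable_lebesgue_on borel_measurable_indicator)
  \<comment> \<open>The shift by \<open>2\<close> puts \<open>a 0 = 1/2\<close> inside the open
    interval.\<close>
  define a where "a n = 1 - 1 / real (n + 2)" for n :: nat
  have a: "a n \<in> ?S" for n by (auto simp: a_def field_simps)
  have lim_a: "a \<longlonglongrightarrow> 1"
  proof -
    have "(\<lambda>n. 1 / real (n + 2)) \<longlonglongrightarrow> 0"
      using LIMSEQ_ignore_initial_segment[OF lim_1_over_n, of 2] by simp
    from tendsto_diff[OF tendsto_const this, of 1] show ?thesis by (simp add: a_def[abs_def])
  qed
  have "(\<lambda>n. LINT x|?M. f x * indicator {..<a n} x) \<longlonglongrightarrow> (LINT x|?M. f x)"
  proof (rule integral_dominated_convergence)
    show "integrable ?M (\<lambda>x. \<bar>f x\<bar>)" using int by simp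
    show "AE x in ?M. (\<lambda>n. f x * indicator {..<a n} x) \<longlonglongrightarrow> f x"
    proof (rule AE_I2)
      fix x assume "x \<in> space ?M"
      then have "\<forall>\<^sub>F n in sequentially. x < a n" using order_tendstoD(1)[OF lim_a, of x] by simp
      then have "\<forall>\<^sub>F n in sequentially. f x * indicator {..<a n} x = f x"
        by eventually_elim simp
      then show "(\<lambda>n. f x * indicator {..<a n} x) \<longlonglongrightarrow> f x" by (rule tendsto_eventually)
    qed
    show "AE x in ?M. norm (f x * indicator {..<a n} x) \<le> \<bar>f x\<bar>" for n
      by (intro AE_I2) (auto simp: indicator_def)
  qed measurable
  then have total: "(LINT x|?M. f x) = 0" using zero[OF a] by (simp add: LIMSEQ_const_iff)
  have tail: "(LINT x|?M. indicator {a<..} x * f x) = 0" for a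
  proof -
    consider "a \<le> 0" | "1 \<le> a" | "a \<in> ?S" by fastforce
    then show ?thesis
    proof cases
      case 1
      then have "(LINT x|?M. indicator {a<..} x * f x) = (LINT x|?M. f x)"
        by (intro Bochner_Integration.integral_cong) auto
      then show ?thesis using total by simp
    next
      case 2
      then have "(LINT x|?M. indicator {a<..} x * f x) = (LINT x|?M. 0)"
        by (intro Bochner_Integration.integral_cong) auto
      then show ?thesis by simp
    next
      case 3
      have "AE x in lborel. x \<noteq> a" by (rule AE_lborel_singleton)
      then have "AE x in lebesgue. x \<noteq> a" by (rule AE_completion)
      then have "AE x in ?M. x \<noteq> a"
        by (subst AE_restrict_space_iff) (auto elim: eventually_mono)
      then have ae: "AE x in ?M. indicator {a<..} x * f x = f x - f x * indicator {..<a} x"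
        by eventually_elim (auto simp: indicator_def)
      have "(LINT x|?M. indicator {a<..} x * f x) = (LINT x|?M. f x - f x * indicator {..<a} x)"
        by (rule integral_cong_AE[OF _ _ ae]) measurable
      also have "\<dots> = (LINT x|?M. f x) - (LINT x|?M. f x * indicator {..<a} x)"
      proof (rule Bochner_Integration.integral_diff[OF int])
        show "integrable ?M (\<lambda>x. f x * indicator {..<a} x)"
        proof (rule Bochner_Integration.integrable_bound[OF int])
          show "AE x in ?M. norm (f x * indicator {..<a} x) \<le> norm (f x)"
            by (intro AE_I2) (auto simp: indicator_def)
        qed measurable
      qed
      finally show ?thesis using total zero[OF 3] by simp
    qed
  qed
  have "(\<lambda>x. indicator ?S x * f x) \<in> borel_measurable lebesgue"
    using f by (simp add: borel_measurable_restrict_space_iff)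
  then obtain f' where f' [measurable]: "f' \<in> borel_measurable lborel"
    and ae: "AE x in lborel. indicator ?S x * f x = f' x"
    using completion_ex_borel_measurable_real by blast
  have "AE x in lborel. f' x = 0"
  proof (rule AE_zero_if_tail_integrals_zero)
    show "integrable lborel f'"
      by (rule integral_lebesgue_on_AE_borel(2)[OF _ _ f ae int]) (use f' in auto)
    fix a
    have "(LINT x|?M. indicator {a<..} x * f x) = (LINT x|lborel. indicator {a<..} x * f' x)"
    proof (rule integral_lebesgue_on_AE_borel(1))
      show "AE x in lborel. indicator ?S x * (indicator {a<..} x * f x) = indicator {a<..} x * f' x"
        using ae by eventually_elim (simp add: mult.left_commute)
    qed (use f' in \<open>auto intro!: borel_measurable_times f\<close>)
    then show "(LINT x|lborel. indicator {a<..} x * f' x) = 0" using tail by simp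
  qed
  with ae have "AE x in lborel. indicator ?S x * f x = 0" by eventually_elim simp
  then have "AE x in lebesgue. indicator ?S x * f x = 0" by (rule AE_completion)
  then have "AE x in lebesgue. x \<in> ?S \<longrightarrow> f x = 0"
    by eventually_elim (auto simp: indicator_def)
  then show ?thesis by (simp add: AE_restrict_space_iff)
qed

lemma C0_L1D:
  assumes "C0_Lp 1 T \<sigma>" "t \<in> {0..T}"
  shows "integrable (lebesgue_on {0<..<1}) (\<sigma> t)"
    "((\<lambda>s. LINT x|lebesgue_on {0<..<1}. \<bar>\<sigma> s x - \<sigma> t x\<bar>) \<longlongrightarrow> 0) (at t within {0..T})"
proof -
  have "\<sigma> t \<in> borel_measurable (lebesgue_on {0<..<1})" "integrable (lebesgue_on {0<..<1}) (\<lambda>x. \<bar>\<sigma> t x\<bar>)"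
    using assms unfolding C0_Lp_def Lp_def by auto
  then show "integrable (lebesgue_on {0<..<1}) (\<sigma> t)" using integrable_abs_cancel by blast
  have "Lp_norm 1 {0<..<1} f = (LINT x|lebesgue_on {0<..<1}. \<bar>f x\<bar>)" for f
    unfolding Lp_norm_def by (simp add: Bochner_Integration.integral_nonneg)
  then show "((\<lambda>s. LINT x|lebesgue_on {0<..<1}. \<bar>\<sigma> s x - \<sigma> t x\<bar>) \<longlongrightarrow> 0) (at t within {0..T})"
    using assms unfolding C0_Lp_def by simp
qed

text \<open>The change of \<sigma> is small in L1 and is multiplied by the bounded
  \<open>k s\<close>; for fixed \<open>\<sigma> t\<close> the change of \<open>k\<close> is handled
  by dominated convergence. It serves for the moments against a moving weight and, with
  \<open>k = 1\<close>, for the mass.\<close>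

lemma C0_L1_continuous_integral:
  fixes k :: "real \<Rightarrow> real \<Rightarrow> real"
  assumes \<sigma>: "C0_Lp 1 T \<sigma>"
    and k_meas: "\<And>t. k t \<in> borel_measurable borel" and k: "\<And>t x. \<bar>k t x\<bar> \<le> 1"
    and cont: "\<And>t x. isCont (\<lambda>t. k t x) t"
  shows "continuous_on {0..T} (\<lambda>t. LINT x|lebesgue_on {0<..<1}. \<sigma> t x * k t x)"
  unfolding continuous_on_def
proof
  let ?M = "lebesgue_on {0<..<1::real}"
  fix t assume t: "t \<in> {0..T}"
  have km [measurable]: "k t \<in> borel_measurable ?M" for t
    by (rule borel_measurable_lebesgue_on[OF k_meas])
  have int: "integrable ?M (\<lambda>x. f x * k t x)" if "integrable ?M f" for f t
  proof (rule Bochner_Integration.integrable_bound[OF that])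
    show "AE x in ?M. norm (f x * k t x) \<le> norm (f x)"
      using k by (intro AE_I2) (auto simp: abs_mult intro: mult_left_le)
    have [measurable]: "f \<in> borel_measurable ?M" using that by auto
    show "(\<lambda>x. f x * k t x) \<in> borel_measurable ?M" by measurable
  qed
  note \<sigma>int = C0_L1D(1)[OF \<sigma>]
  have 1: "((\<lambda>s. LINT x|?M. (\<sigma> s x - \<sigma> t x) * k s x) \<longlongrightarrow> 0) (at t within {0..T})"
  proof (rule Lim_null_comparison[OF _ C0_L1D(2)[OF \<sigma> t]])
    have "norm (LINT x|?M. (\<sigma> s x - \<sigma> t x) * k s x) \<le> (LINT x|?M. \<bar>\<sigma> s x - \<sigma> t x\<bar>)" if "s \<in> {0..T}" for s
    proof (rule Bochner_Integration.integral_norm_bound_integral)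
      show "integrable ?M (\<lambda>x. (\<sigma> s x - \<sigma> t x) * k s x)" "integrable ?M (\<lambda>x. \<bar>\<sigma> s x - \<sigma> t x\<bar>)"
        using \<sigma>int[OF t] \<sigma>int[OF that] by (auto intro!: int)
      show "norm ((\<sigma> s x - \<sigma> t x) * k s x) \<le> \<bar>\<sigma> s x - \<sigma> t x\<bar>" for x
        using k by (auto simp: abs_mult intro: mult_left_le)
    qed
    then show "\<forall>\<^sub>F s in at t within {0..T}. norm (LINT x|?M. (\<sigma> s x - \<sigma> t x) * k s x) \<le> (LINT x|?M. \<bar>\<sigma> s x - \<sigma> t x\<bar>)"
      by (auto simp: eventually_at_filter)
  qed
  have 2: "((\<lambda>s. LINT x|?M. \<sigma> t x * k s x) \<longlongrightarrow> (LINT x|?M. \<sigma> t x * k t x)) (at t within {0..T})"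
    unfolding tendsto_at_iff_sequentially comp_def
  proof (intro allI impI)
    fix s :: "nat \<Rightarrow> real" assume s: "s \<longlonglongrightarrow> t"
    have [measurable]: "\<sigma> t \<in> borel_measurable ?M" using \<sigma>int[OF t] by auto
    show "(\<lambda>n. LINT x|?M. \<sigma> t x * k (s n) x) \<longlonglongrightarrow> (LINT x|?M. \<sigma> t x * k t x)"
    proof (rule integral_dominated_convergence)
      show "integrable ?M (\<lambda>x. \<bar>\<sigma> t x\<bar>)" using \<sigma>int[OF t] by simp
      show "AE x in ?M. (\<lambda>n. \<sigma> t x * k (s n) x) \<longlonglongrightarrow> \<sigma> t x * k t x"
        by (intro AE_I2 tendsto_intros isCont_tendsto_compose[OF cont s])
      show "AE x in ?M. norm (\<sigma> t x * k (s n) x) \<le> \<bar>\<sigma> t x\<bar>" for n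
        using k by (intro AE_I2) (auto simp: abs_mult intro: mult_left_le)
    qed measurable
  qed
  have "((\<lambda>s. (LINT x|?M. (\<sigma> s x - \<sigma> t x) * k s x) + (LINT x|?M. \<sigma> t x * k s x))
      \<longlongrightarrow> 0 + (LINT x|?M. \<sigma> t x * k t x)) (at t within {0..T})"
    by (intro tendsto_add 1 2)
  moreover have "\<forall>\<^sub>F s in at t within {0..T}. (LINT x|?M. (\<sigma> s x - \<sigma> t x) * k s x) + (LINT x|?M. \<sigma> t x * k s x)
      = (LINT x|?M. \<sigma> s x * k s x)"
  proof -
    have "(LINT x|?M. (\<sigma> s x - \<sigma> t x) * k s x) + (LINT x|?M. \<sigma> t x * k s x) = (LINT x|?M. \<sigma> s x * k s x)"
      if "s \<in> {0..T}" for s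
      using int[OF \<sigma>int[OF that], of s] int[OF \<sigma>int[OF t], of s] by (simp add: left_diff_distrib)
    then show ?thesis by (auto simp: eventually_at_filter)
  qed
  ultimately show "((\<lambda>s. LINT x|?M. \<sigma> s x * k s x) \<longlongrightarrow> (LINT x|?M. \<sigma> t x * k t x)) (at t within {0..T})"
    using Lim_transform_eventually by fastforce
qed

text \<open>The hypothesis says that the square of \<open>m1 - m2\<close> has integral zero. It
  arises from a test function whose time factor has the derivative \<open>m1 - m2\<close>
  itself.\<close>

lemma continuous_square_integral_zero:
  fixes m1 m2 :: "real \<Rightarrow> real"
  assumes "0 < \<tau>" and cont: "continuous_on {0..\<tau>} m1" "continuous_on {0..\<tau>} m2"
    and eq: "(LINT t|lebesgue_on {0<..<\<tau>}. (m1 t - m2 t) * m1 t) = (LINT t|lebesgue_on {0<..<\<tau>}. (m1 t - m2 t) * m2 t)"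
    and "t \<in> {0..\<tau>}"
  shows "m1 t = m2 t"
proof -
  have Ioo: "integrable (lebesgue_on {0<..<\<tau>}) f" "(LINT t|lebesgue_on {0<..<\<tau>}. f t) = integral {0..\<tau>} f"
    if "continuous_on {0..\<tau>} f" for f :: "real \<Rightarrow> real"
  proof -
    have "integrable (lebesgue_on {0..\<tau>}) f" by (rule continuous_imp_integrable_real[OF that])
    then have "integrable lebesgue (\<lambda>x. indicator {0..\<tau>} x * f x)"
      by (simp add: integrable_restrict_space)
    from integrable_mult_indicator[OF _ this, of "{0<..<\<tau>}"]
    have "integrable lebesgue (\<lambda>x. indicator {0<..<\<tau>} x * (indicator {0..\<tau>} x * f x))" by simp
    also have "(\<lambda>x. indicator {0<..<\<tau>} x * (indicator {0..\<tau>} x * f x)) = (\<lambda>x. indicator {0<..<\<tau>} x * f x)"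
      by (auto simp: indicator_def)
    finally show int: "integrable (lebesgue_on {0<..<\<tau>}) f"
      by (simp add: integrable_restrict_space)
    show "(LINT t|lebesgue_on {0<..<\<tau>}. f t) = integral {0..\<tau>} f"
      using lebesgue_integral_eq_integral[OF int] by (simp add: integral_open_interval_real)
  qed
  have c: "continuous_on {0..\<tau>} (\<lambda>t. (m1 t - m2 t) * m1 t)" "continuous_on {0..\<tau>} (\<lambda>t. (m1 t - m2 t) * m2 t)"
    "continuous_on {0..\<tau>} (\<lambda>t. (m1 t - m2 t) * (m1 t - m2 t))"
    by (intro continuous_intros cont)+
  have "integral {0..\<tau>} (\<lambda>t. (m1 t - m2 t) * (m1 t - m2 t)) =
      (LINT t|lebesgue_on {0<..<\<tau>}. (m1 t - m2 t) * m1 t - (m1 t - m2 t) * m2 t)"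
    using Ioo(2)[OF c(3)] by (simp add: algebra_simps)
  also have "\<dots> = 0" using Ioo(1)[OF c(1)] Ioo(1)[OF c(2)] eq by simp
  finally have "\<forall>t\<in>{0..\<tau>}. (m1 t - m2 t) * (m1 t - m2 t) = 0"
    using integral_eq_0_iff[OF c(3) \<open>0 < \<tau>\<close>] by simp
  then show ?thesis using assms(5) by simp
qed

text \<open>A C1 approximation of the indicator of \<open>{..<y0}\<close> from below: it vanishes
  for \<open>y \<ge> y0\<close> and tends to \<open>1\<close> for \<open>y < y0\<close>. The square
  of the positive part makes it differentiable at \<open>y0\<close>.\<close>

definition step :: "nat \<Rightarrow> real \<Rightarrow> real \<Rightarrow> real" where
  "step n y0 y = 1 - exp (- (real n * (max 0 (y0 - y))\<^sup>2))"

definition dstep :: "nat \<Rightarrow> real \<Rightarrow> real \<Rightarrow> real" where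
  "dstep n y0 y = - (2 * real n * max 0 (y0 - y) * exp (- (real n * (max 0 (y0 - y))\<^sup>2)))"

lemma step_deriv: "(step n y0 has_real_derivative dstep n y0 y) (at y)"
proof -
  have "((\<lambda>z::real. (max 0 z)\<^sup>2) has_real_derivative 2 * max 0 z) (at z)" for z
  proof -
    consider "z < 0" | "z > 0" | "z = 0" by linarith
    then show ?thesis
    proof cases
      case 1
      have "((\<lambda>z::real. 0) has_real_derivative 2 * max 0 z) (at z)" using 1 by simp
      then show ?thesis
        by (rule has_field_derivative_transform_within_open[where S="{..<0}"]) (use 1 in auto)
    next
      case 2
      have "((\<lambda>z::real. z\<^sup>2) has_real_derivative 2 * max 0 z) (at z)"
        using 2 by (auto intro!: derivative_eq_intros)
      then show ?thesis
        by (rule has_field_derivative_transform_within_open[where S="{0<..}"]) (use 2 in auto)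
    next
      case 3
      \<comment> \<open>At the junction the difference quotient is at most
        \<open>\<bar>h\<bar>\<close> in absolute value.\<close>
      have "((\<lambda>h. (max 0 (0 + h))\<^sup>2 / h) \<longlongrightarrow> 0) (at (0::real))"
      proof (rule Lim_null_comparison)
        show "\<forall>\<^sub>F h::real in at 0. norm ((max 0 (0 + h))\<^sup>2 / h) \<le> \<bar>h\<bar>"
          by (intro always_eventually) (auto simp: max_def power2_eq_square)
        show "((\<lambda>h::real. \<bar>h\<bar>) \<longlongrightarrow> 0) (at 0)" by (rule tendsto_eq_intros | simp)+
      qed
      then show ?thesis using 3 by (simp add: DERIV_def)
    qed
  qed
  note sq = DERIV_chain2[OF this, of "\<lambda>y. y0 - y"]
  have "((\<lambda>y. (max 0 (y0 - y))\<^sup>2) has_real_derivative 2 * max 0 (y0 - y) * - 1) (at y)"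
    by (rule sq) (auto intro!: derivative_eq_intros)
  from DERIV_diff[OF DERIV_const DERIV_fun_exp[OF DERIV_minus[OF DERIV_cmult[OF this]]]]
  show ?thesis by (simp add: step_def[abs_def] dstep_def mult_ac)
qed

lemma step_bound: "\<bar>step n y0 y\<bar> \<le> 1"
  by (simp add: step_def abs_le_iff)

lemma step_zero: "y0 \<le> y \<Longrightarrow> step n y0 y = 0"
  by (simp add: step_def)

lemma continuous_on_step [continuous_intros]:
  "continuous_on S f \<Longrightarrow> continuous_on S (\<lambda>x. step n y0 (f x))"
  "continuous_on S f \<Longrightarrow> continuous_on S (\<lambda>x. dstep n y0 (f x))"
  unfolding step_def dstep_def by (auto intro!: continuous_intros)

lemma step_limit: "(\<lambda>n. step n y0 y) \<longlonglongrightarrow> indicator {..<y0} y"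
proof (cases "y < y0")
  case True
  then have q: "exp (- (max 0 (y0 - y))\<^sup>2) < 1" by simp
  have "exp (- (real n * (max 0 (y0 - y))\<^sup>2)) = exp (- (max 0 (y0 - y))\<^sup>2) ^ n" for n
    by (simp flip: exp_of_nat_mult)
  then have "(\<lambda>n. step n y0 y) \<longlonglongrightarrow> 1 - 0"
    unfolding step_def using q by (intro tendsto_intros) (auto intro!: LIMSEQ_power_zero)
  then show ?thesis using True by simp
qed (simp add: step_zero)

context flow
begin

text \<open>Functions of \<open>Y\<close> are annihilated by the transport operator, so for \<phi>
  only the derivative \<open>w\<close> of the time factor remains, times the step. The data terms
  are common to both solutions; hence the moments have the same integral against every continuous
  \<open>w\<close>, in particular against their own difference.\<close>

lemma step_moments_agree:
  assumes \<sigma>: "C0_Lp 1 T \<sigma>1" "C0_Lp 1 T \<sigma>2"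
    and weak: "linear_weak (\<lambda>t x. \<Lambda> x (W t)) T \<rho>0 u \<sigma>1" "linear_weak (\<lambda>t x. \<Lambda> x (W t)) T \<rho>0 u \<sigma>2"
    and \<tau>: "0 < \<tau>" "\<tau> \<le> T" and y0: "y0 \<le> Y \<tau> 1" and t: "t \<in> {0..\<tau>}"
  shows "(LINT x|lebesgue_on {0<..<1}. \<sigma>1 t x * step n y0 (Y t x)) =
    (LINT x|lebesgue_on {0<..<1}. \<sigma>2 t x * step n y0 (Y t x))"
proof -
  define m where "m \<sigma> t = (LINT x|lebesgue_on {0<..<1}. \<sigma> t x * step n y0 (Y t x))" for \<sigma> :: "real \<Rightarrow> real \<Rightarrow> real" and t
  have contm: "continuous_on {0..\<tau>} (m \<sigma>)" if \<sigma>: "C0_Lp 1 T \<sigma>" for \<sigma>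
  proof (rule continuous_on_subset)
    show "continuous_on {0..T} (m \<sigma>)"
      unfolding m_def
    proof (rule C0_L1_continuous_integral[OF \<sigma>])
      show "(\<lambda>x. step n y0 (Y t x)) \<in> borel_measurable borel" for t
        by (intro borel_measurable_continuous_onI continuous_intros)
      have "continuous_on UNIV (\<lambda>t. step n y0 (Y t x))" for x
        by (intro continuous_intros)
      then show "isCont (\<lambda>t. step n y0 (Y t x)) t" for t x
        by (simp add: continuous_on_eq_continuous_at)
    qed (rule step_bound)
  qed (use \<tau> in auto)
  define w where "w t = m \<sigma>1 t - m \<sigma>2 t" for t
  have contw: "continuous_on {0..\<tau>} w"
    unfolding w_def by (intro continuous_intros contm \<sigma>)
  \<comment> \<open>The primitive of \<open>w\<close> that vanishes at \<tau>, as a test function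
    must.\<close>
  define \<theta> where "\<theta> t = integral {0..t} w - integral {0..\<tau>} w" for t
  have \<theta>_deriv: "(\<theta> has_real_derivative w t) (at t within {0..\<tau>})" if "t \<in> {0..\<tau>}" for t
    unfolding \<theta>_def using integral_has_real_derivative[OF contw that]
    by (auto intro!: derivative_eq_intros)
  have cont\<theta>: "continuous_on {0..\<tau>} \<theta>" by (rule DERIV_continuous_on[OF \<theta>_deriv])
  define \<phi> where "\<phi> t x = \<theta> t * step n y0 (Y t x)" for t x
  define \<phi>t where "\<phi>t t x = w t * step n y0 (Y t x) + \<theta> t * (dstep n y0 (Y t x) * (- \<Lambda> x (W t) * J t x))" for t x
  define \<phi>x where "\<phi>x t x = \<theta> t * (dstep n y0 (Y t x) * J t x)" for t x
  have C1: "C1_rect {0..\<tau>} {0..1} \<phi> \<phi>t \<phi>x"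
    unfolding C1_rect_def
  proof (intro conjI ballI)
    fix t x :: real assume tx: "t \<in> {0..\<tau>}" "x \<in> {0..1}"
    let ?F = "at (t, x) within {0..\<tau>} \<times> {0..1}"
    have Y: "((\<lambda>z. Y (fst z) (snd z)) has_derivative (\<lambda>z. (- \<Lambda> x (W t) * J t x) * fst z + J t x * snd z)) ?F"
      using Y_has_derivative[of \<tau> t x] \<tau> tx by (simp add: split_beta')
    have "(step n y0 has_derivative (*) (dstep n y0 (Y t x))) (at (Y (fst (t, x)) (snd (t, x))))"
      using step_deriv[of n y0 "Y t x"] by (simp add: has_field_derivative_def)
    from has_derivative_compose[OF Y this]
    have s: "((\<lambda>z. step n y0 (Y (fst z) (snd z))) has_derivative
        (\<lambda>z. dstep n y0 (Y t x) * ((- \<Lambda> x (W t) * J t x) * fst z + J t x * snd z))) ?F" .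
    have "(\<theta> has_derivative (*) (w t)) (at (fst (t, x)) within fst ` ({0..\<tau>} \<times> {0..1::real}))"
      using \<theta>_deriv[OF tx(1)] by (simp add: has_field_derivative_def)
    from has_derivative_in_compose[OF has_derivative_fst[OF has_derivative_ident] this]
    have "((\<lambda>z. \<theta> (fst z)) has_derivative (\<lambda>z. w t * fst z)) ?F" .
    from has_derivative_mult[OF this s]
    show "((\<lambda>(t, x). \<phi> t x) has_derivative (\<lambda>(h, k). \<phi>t t x * h + \<phi>x t x * k)) ?F"
      unfolding \<phi>_def \<phi>t_def \<phi>x_def split_beta'
      by (rule has_derivative_eq_rhs) (auto simp: fun_eq_iff algebra_simps)
  next
    have c: "continuous_on ({0..\<tau>} \<times> {0..1::real}) (\<lambda>z. w (fst z))" "continuous_on ({0..\<tau>} \<times> {0..1::real}) (\<lambda>z. \<theta> (fst z))"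
      by (rule continuous_on_compose2[OF contw] continuous_on_compose2[OF cont\<theta>]; auto intro!: continuous_intros)+
    show "continuous_on ({0..\<tau>} \<times> {0..1}) (\<lambda>(x, y). \<phi>t x y)" "continuous_on ({0..\<tau>} \<times> {0..1}) (\<lambda>(x, y). \<phi>x x y)"
      unfolding \<phi>t_def \<phi>x_def split_beta' by (intro continuous_intros c)+
  qed
  have z\<tau>: "\<forall>x\<in>{0..1}. \<phi> \<tau> x = 0" by (simp add: \<phi>_def \<theta>_def)
  have z1: "\<forall>t\<in>{0..\<tau>}. \<phi> t 1 = 0"
  proof
    fix t assume "t \<in> {0..\<tau>}"
    \<comment> \<open>The foot of the outflow boundary moves to the left in time. Particles that
      started before \<open>y0\<close> are thus still inside up to time \<tau>, and the step
      vanishes at \<open>x = 1\<close>.\<close>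
    then have "y0 \<le> Y t 1" using y0 Y_antimono[of t \<tau> 1] \<tau> by auto
    then show "\<phi> t 1 = 0" by (simp add: \<phi>_def step_zero)
  qed
  have transport: "\<phi>t t x + \<Lambda> x (W t) * \<phi>x t x = w t * step n y0 (Y t x)" for t x
    by (simp add: \<phi>t_def \<phi>x_def algebra_simps)
  have "(LINT t|lebesgue_on {0<..<\<tau>}. w t * m \<sigma> t)
      = - (LINT t|lebesgue_on {0<..<\<tau>}. u t * \<phi> t 0) - (LINT x|lebesgue_on {0<..<1}. \<rho>0 x * \<phi> 0 x)"
    if "linear_weak (\<lambda>t x. \<Lambda> x (W t)) T \<rho>0 u \<sigma>" for \<sigma>
  proof -
    have "(LINT t|lebesgue_on {0<..<\<tau>}. LINT x|lebesgue_on {0<..<1}. \<sigma> t x * (\<phi>t t x + \<Lambda> x (W t) * \<phi>x t x))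
        + (LINT t|lebesgue_on {0<..<\<tau>}. u t * \<phi> t 0) + (LINT x|lebesgue_on {0<..<1}. \<rho>0 x * \<phi> 0 x) = 0"
      using that C1 z\<tau> z1 \<tau> unfolding linear_weak_def by auto
    moreover have "(LINT x|lebesgue_on {0<..<1}. \<sigma> t x * (\<phi>t t x + \<Lambda> x (W t) * \<phi>x t x)) = w t * m \<sigma> t" for t
      unfolding transport m_def by (simp add: mult.left_commute)
    ultimately show ?thesis by simp
  qed
  from this[OF weak(1)] this[OF weak(2)]
  have "(LINT t|lebesgue_on {0<..<\<tau>}. (m \<sigma>1 t - m \<sigma>2 t) * m \<sigma>1 t) = (LINT t|lebesgue_on {0<..<\<tau>}. (m \<sigma>1 t - m \<sigma>2 t) * m \<sigma>2 t)"
    unfolding w_def by simp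
  from continuous_square_integral_zero[OF \<tau>(1) contm[OF \<sigma>(1)] contm[OF \<sigma>(2)] this t]
  show ?thesis by (simp add: m_def)
qed

text \<open>With \<open>y0 = Y t a\<close> the steps tend to the indicator of \<open>{..<a}\<close>
  at time \<open>t\<close>, because \<open>Y t\<close> is strictly increasing. Equality of the
  moments passes to the limit and settles every segment with \<open>a < 1\<close>.\<close>

lemma linear_weak_unique:
  assumes \<sigma>: "C0_Lp 1 T \<sigma>1" "C0_Lp 1 T \<sigma>2"
    and weak: "linear_weak (\<lambda>t x. \<Lambda> x (W t)) T \<rho>0 u \<sigma>1" "linear_weak (\<lambda>t x. \<Lambda> x (W t)) T \<rho>0 u \<sigma>2"
    and t: "t \<in> {0..T}"
  shows "AE x in lebesgue_on {0<..<1}. \<sigma>1 t x = \<sigma>2 t x"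
proof -
  let ?M = "lebesgue_on {0<..<1::real}"
  note int = C0_L1D(1)[OF \<sigma>(1) t] C0_L1D(1)[OF \<sigma>(2) t]
  have sm [measurable]: "(\<lambda>x. step n y0 (Y t x)) \<in> borel_measurable ?M" for n y0
    by (intro borel_measurable_lebesgue_on borel_measurable_continuous_onI continuous_intros)
  have im [measurable]: "(\<lambda>x. indicator {..<a} x :: real) \<in> borel_measurable ?M" for a
    by (intro borel_measurable_lebesgue_on borel_measurable_indicator) simp
  have dint: "integrable ?M (\<lambda>x. \<sigma>1 t x - \<sigma>2 t x)" using int by simp
  then have dm [measurable]: "(\<lambda>x. \<sigma>1 t x - \<sigma>2 t x) \<in> borel_measurable ?M" by auto
  have "AE x in ?M. \<sigma>1 t x - \<sigma>2 t x = 0"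
  proof (rule AE_zero_on_unit_interval[OF dint])
    fix a :: real assume a: "a \<in> {0<..<1}"
    \<comment> \<open>For \<open>t > 0\<close> the choice \<tau> = \<open>t\<close> works, as
      \<open>a < 1\<close>. At \<open>t = 0\<close> a positive horizon is needed; up to time
      \<open>(1 - a) / C\<close> the particle from \<open>a\<close> cannot have passed
      \<open>1\<close>.\<close>
    obtain \<tau> where \<tau>: "0 < \<tau>" "\<tau> \<le> T" "t \<in> {0..\<tau>}" "Y t a \<le> Y \<tau> 1"
    proof (cases "t = 0")
      case True
      define \<tau> where "\<tau> = min T ((1 - a) / C)"
      have "0 < \<tau>" "\<tau> \<le> T" using T_pos C_pos a by (auto simp: \<tau>_def)
      moreover have "C * \<tau> \<le> 1 - a"
        using mult_left_mono[of \<tau> "(1 - a) / C" C] C_pos by (simp add: \<tau>_def)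
      then have "X \<tau> a \<le> 1" using X_increment(2)[of 0 \<tau> a] \<open>0 < \<tau>\<close> \<open>\<tau> \<le> T\<close> by simp
      ultimately show thesis using True by (intro that[of \<tau>]) (auto simp: le_Y_iff)
    next
      case False
      then show thesis using t a by (intro that[of t]) auto
    qed
    have "(LINT x|?M. (\<sigma>1 t x - \<sigma>2 t x) * step n (Y t a) (Y t x)) = 0" for n
    proof -
      have "integrable ?M (\<lambda>x. f x * step n (Y t a) (Y t x))" if f: "integrable ?M f" for f
      proof (rule Bochner_Integration.integrable_bound[OF f])
        show "AE x in ?M. norm (f x * step n (Y t a) (Y t x)) \<le> norm (f x)"
          using step_bound by (intro AE_I2) (auto simp: abs_mult intro: mult_left_le)
        have [measurable]: "f \<in> borel_measurable ?M" using f by auto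
        show "(\<lambda>x. f x * step n (Y t a) (Y t x)) \<in> borel_measurable ?M" by measurable
      qed
      then show ?thesis
        using step_moments_agree[OF \<sigma> weak \<tau>(1,2,4,3), of n] int by (simp add: left_diff_distrib)
    qed
    moreover have "(\<lambda>n. LINT x|?M. (\<sigma>1 t x - \<sigma>2 t x) * step n (Y t a) (Y t x)) \<longlonglongrightarrow>
        (LINT x|?M. (\<sigma>1 t x - \<sigma>2 t x) * indicator {..<a} x)"
    proof (rule integral_dominated_convergence)
      show "integrable ?M (\<lambda>x. \<bar>\<sigma>1 t x - \<sigma>2 t x\<bar>)" using dint by simp
      show "AE x in ?M. norm ((\<sigma>1 t x - \<sigma>2 t x) * step n (Y t a) (Y t x)) \<le> \<bar>\<sigma>1 t x - \<sigma>2 t x\<bar>" for n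
        using step_bound by (intro AE_I2) (auto simp: abs_mult intro: mult_left_le)
      show "AE x in ?M. (\<lambda>n. (\<sigma>1 t x - \<sigma>2 t x) * step n (Y t a) (Y t x)) \<longlonglongrightarrow> (\<sigma>1 t x - \<sigma>2 t x) * indicator {..<a} x"
      proof (rule AE_I2)
        fix x
        have "indicator {..<Y t a} (Y t x) = (indicator {..<a} x :: real)"
          by (simp add: indicator_def)
        then show "(\<lambda>n. (\<sigma>1 t x - \<sigma>2 t x) * step n (Y t a) (Y t x)) \<longlonglongrightarrow> (\<sigma>1 t x - \<sigma>2 t x) * indicator {..<a} x"
          using tendsto_mult[OF tendsto_const step_limit[of "Y t a" "Y t x"]] by simp
      qed
    qed measurable
    ultimately show "(LINT x|?M. (\<sigma>1 t x - \<sigma>2 t x) * indicator {..<a} x) = 0"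
      by (simp add: LIMSEQ_const_iff)
  qed
  then show ?thesis by eventually_elim simp
qed

end

section \<open>The fixed point\<close>

text \<open>The velocity is seen only at times in \<open>[0,T]\<close> and positions inside the
  interval; this is how clamps are inserted and removed where they do not act.\<close>

lemma linear_weak_cong_velocity:
  assumes "\<And>t x. t \<in> {0..T} \<Longrightarrow> x \<in> {0<..<1} \<Longrightarrow> a t x = a' t x"
  shows "linear_weak a T \<rho>0 u \<rho> \<longleftrightarrow> linear_weak a' T \<rho>0 u \<rho>"
proof -
  have "(LINT t|lebesgue_on {0<..<\<tau>}. LINT x|lebesgue_on {0<..<1}. \<rho> t x * (\<phi>t t x + a t x * \<phi>x t x)) =
      (LINT t|lebesgue_on {0<..<\<tau>}. LINT x|lebesgue_on {0<..<1}. \<rho> t x * (\<phi>t t x + a' t x * \<phi>x t x))"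
    if "\<tau> \<in> {0..T}" for \<tau> \<phi>t \<phi>x
    using assms that by (intro Bochner_Integration.integral_cong refl) auto
  then show ?thesis unfolding linear_weak_def by simp
qed

context flow
begin

definition exit :: "real \<Rightarrow> real" where "exit t = \<beta> (Y t 1)"

lemma Z_exit [simp]: "Z t (exit t) = 1"
  by (simp add: Z_def exit_def)

lemma exit_ge: "t \<in> {0..T} \<Longrightarrow> - t \<le> exit t"
  using Z_nonneg_iff[of t "exit t"] by simp

lemma continuous_on_exit: "continuous_on S exit"
  unfolding exit_def continuous_on_def by (intro ballI tendsto_\<beta> tendsto_Y tendsto_intros)

end

text \<open>The data without a mass: \<open>W\<close> now is the variable of a map, and the flows of
  two masses have to be compared.\<close>

locale source = velocity +
  fixes T :: real and g :: "real \<Rightarrow> real" and B :: real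
  assumes T_positive: "0 < T"
    and g_meas [measurable]: "g \<in> borel_measurable borel"
    and g_ge: "0 \<le> g b"
    and g_B: "g b \<le> B"
    and g_supp: "b \<notin> {- T..1} \<Longrightarrow> g b = 0"
begin

lemma flow: "continuous_on UNIV W \<Longrightarrow> flow \<Lambda> sl c C L T W"
  by unfold_locales (use T_positive in auto)

lemma transport: "continuous_on UNIV W \<Longrightarrow> transport \<Lambda> sl c C L T W g B"
  by unfold_locales (use T_positive g_meas g_ge g_B g_supp in auto)

text \<open>The distribution function of the labels. Boundedness of the data makes it Lipschitz with
  constant \<open>B\<close>, and no further regularity of the data enters the fixed point
  argument.\<close>

definition G :: "real \<Rightarrow> real" where "G x = (LINT b|lborel. indicator {..x} b * g b)"

lemma B_ge: "0 \<le> B"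
  using g_ge[of 0] g_B[of 0] by linarith

lemma G_integrable: "integrable lborel (\<lambda>b. indicator {..x} b * g b)"
  by (rule integrable_bounded_Icc[of _ "- T" 1 B])
    (use g_ge g_B g_supp B_ge in \<open>auto simp: indicator_def\<close>)

lemma G_increment:
  assumes "x \<le> y"
  shows "0 \<le> G y - G x" "G y - G x \<le> B * (y - x)"
proof -
  have eq: "G y - G x = (LINT b|lborel. indicator {..y} b * g b - indicator {..x} b * g b)"
    unfolding G_def by (rule Bochner_Integration.integral_diff[OF G_integrable G_integrable, symmetric])
  show "0 \<le> G y - G x"
    unfolding eq using assms g_ge by (intro Bochner_Integration.integral_nonneg) (auto simp: indicator_def)
  have "G y - G x \<le> (LINT b|lborel. B * indicator {x..y} b)"
    unfolding eq
    by (intro integral_mono Bochner_Integration.integrable_diff G_integrable integrable_const_indicator)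
      (use assms g_B B_ge in \<open>auto simp: indicator_def\<close>)
  also have "\<dots> = B * (y - x)" using assms by simp
  finally show "G y - G x \<le> B * (y - x)" .
qed

lemma G_lip: "\<bar>G y - G x\<bar> \<le> B * \<bar>y - x\<bar>"
  using G_increment[of x y] G_increment[of y x] by (cases "x \<le> y") (auto simp: abs_if)

definition F :: "(real \<Rightarrow> real) \<Rightarrow> real \<Rightarrow> real" where
  "F W t = G (flow.exit \<Lambda> T W t) - G (- t)"

text \<open>Particles move to the right, so a label leaving at \<open>1\<close> is at most
  \<open>1\<close>, and the labels present fill a window of length at most \<open>T + 1\<close>. The
  bound does not involve the velocity, so it can serve as the level of the clamp.\<close>

lemma F_bounds:
  assumes "continuous_on UNIV W" "t \<in> {0..T}"
  shows "0 \<le> F W t" "F W t \<le> B * (T + 1)"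
proof -
  interpret flow \<Lambda> sl c C L T W by (rule flow) fact
  show "0 \<le> F W t"
    unfolding F_def using G_increment(1)[OF exit_ge[OF assms(2)]] by simp
  have "exit t \<le> 1"
    using Z_le_iff[of t "exit t" 1] X_bounds(1)[of 1 t] unfolding Z_exit by (simp add: Z_def \<zeta>_def)
  then have "F W t \<le> B * (exit t - (- t))"
    unfolding F_def by (intro G_increment exit_ge assms)
  also have "\<dots> \<le> B * (T + 1)"
    using \<open>exit t \<le> 1\<close> assms B_ge by (intro mult_left_mono) auto
  finally show "F W t \<le> B * (T + 1)" .
qed

lemma F_continuous:
  assumes "continuous_on UNIV W"
  shows "continuous_on S (F W)"
proof -
  interpret flow \<Lambda> sl c C L T W by (rule flow) fact
  have "B-lipschitz_on UNIV G"
    using G_lip B_ge by (intro lipschitz_onI) (auto simp: dist_real_def)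
  then have G: "continuous_on UNIV G" by (rule lipschitz_on_continuous_on)
  show ?thesis
    unfolding F_def
    by (intro continuous_intros continuous_on_compose2[OF G] continuous_on_exit) auto
qed

lemma mass_eq_F:
  assumes "continuous_on UNIV W" "t \<in> {0..T}"
  shows "mass (transport.\<rho> \<Lambda> sl T W g) t = F W t"
proof -
  interpret transport \<Lambda> sl c C L T W g B by (rule transport) fact
  have "mass \<rho> t = (LINT x|lborel. indicator {0..1} x * (\<rho> t x * 1))"
    unfolding mass_def by (subst lint_lebesgue_on_Ioo) auto
  also have "\<dots> = (LINT b|lborel. g b * (indicator {0..1} (Z t b) * 1))"
    by (rule integral_\<rho>[where K=1]) auto
  also have "\<dots> = (LINT b|lborel. indicator {..exit t} b * g b - indicator {..- t} b * g b)"
  proof (rule integral_cong_AE)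
    \<comment> \<open>The label entering at this very moment is inside the interval but is removed
      by the difference of half-lines.\<close>
    have "AE b in lborel. b \<noteq> - t" by (rule AE_lborel_singleton)
    then show "AE b in lborel. g b * (indicator {0..1} (Z t b) * 1) = indicator {..exit t} b * g b - indicator {..- t} b * g b"
    proof eventually_elim
      case (elim b)
      have "Z t b \<in> {0..1} \<longleftrightarrow> - t \<le> b \<and> b \<le> exit t"
        using Z_nonneg_iff[OF assms(2), of b] Z_le_iff[of t b "exit t"] by simp
      then show ?case using elim exit_ge[OF assms(2)] by (auto simp: indicator_def)
    qed
    have [measurable]: "Z t \<in> borel_measurable borel"
      by (intro borel_measurable_continuous_onI continuous_intros)
    show "(\<lambda>b. g b * (indicator {0..1} (Z t b) * 1)) \<in> borel_measurable lborel" by measurable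
  qed measurable
  also have "\<dots> = F W t"
    unfolding F_def G_def by (rule Bochner_Integration.integral_diff[OF G_integrable G_integrable])
  finally show ?thesis .
qed

text \<open>\<open>B\<close> comes from \<open>G\<close>, the denominator from returning from
  positions at time \<open>0\<close> to labels, and the outer exponential from inverting the flow.
  The two summands measure the shift of the initial position and the change of the velocity along
  the way. No mass occurs, so the constant serves for all pairs.\<close>

definition K :: real where
  "K = B * (exp (L * T) * (exp (L * T) * L + L * exp (L * T)) / min 1 c)"

lemma K_nonneg: "0 \<le> K"
  unfolding K_def using B_ge L_nonneg c_pos by simp

text \<open>The label leaving under \<open>W1\<close> is followed with the flow of
  \<open>W2\<close>. Its distance to \<open>1\<close> at time \<open>t\<close> is estimated by
  Gronwall and then pulled back to a distance between the two leaving labels.\<close>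

lemma F_lip:
  assumes W: "continuous_on UNIV W1" "continuous_on UNIV W2" and t: "t \<in> {0..T}"
  shows "\<bar>F W1 t - F W2 t\<bar> \<le> K * integral {0..t} (\<lambda>s. \<bar>W1 s - W2 s\<bar>)"
proof -
  interpret f1: flow \<Lambda> sl c C L T W1 by (rule flow) fact
  interpret f2: flow \<Lambda> sl c C L T W2 by (rule flow) fact
  define I where "I = integral {0..t} (\<lambda>s. \<bar>W1 s - W2 s\<bar>)"
  have contW: "continuous_on S (\<lambda>s. \<bar>W1 s - W2 s\<bar>)" for S
    by (intro continuous_intros W[THEN continuous_on_subset] subset_UNIV)
  have intW: "(\<lambda>s. \<bar>W1 s - W2 s\<bar>) integrable_on {0..s}" for s
    by (intro integrable_continuous_real contW)
  have I_mono: "integral {0..s} (\<lambda>s. \<bar>W1 s - W2 s\<bar>) \<le> I" if "s \<le> t" for s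
    unfolding I_def using that by (intro integral_subset_le intW) auto
  have I0: "0 \<le> I" unfolding I_def by (rule integral_nonneg[OF intW]) simp
  have X: "\<bar>f1.X t y - f2.X t y\<bar> \<le> L * exp (L * T) * I" for y
  proof -
    define D where "D s = \<bar>f1.X s y - f2.X s y\<bar>" for s
    have contD: "continuous_on S D" for S
      unfolding D_def by (intro continuous_intros f1.cont_X_t f2.cont_X_t)
    have "D t \<le> (L * I) * exp (L * t)"
    proof (rule gronwall[of t D L])
      fix s assume s: "s \<in> {0..t}"
      have int: "(\<lambda>r. \<Lambda> (f1.X r y) (W1 r)) integrable_on {0..s}" "(\<lambda>r. \<Lambda> (f2.X r y) (W2 r)) integrable_on {0..s}"
        by (intro integrable_continuous_real f1.cont_vel f2.cont_vel)+
      have intD: "D integrable_on {0..s}" by (intro integrable_continuous_real contD)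
      have "D s = norm (integral {0..s} (\<lambda>r. \<Lambda> (f1.X r y) (W1 r) - \<Lambda> (f2.X r y) (W2 r)))"
        using f1.X_eq[of s y] f2.X_eq[of s y] s t int by (simp add: D_def integral_diff)
      also have "\<dots> \<le> integral {0..s} (\<lambda>r. L * D r + L * \<bar>W1 r - W2 r\<bar>)"
      proof (rule integral_norm_bound_integral)
        show "(\<lambda>r. L * D r + L * \<bar>W1 r - W2 r\<bar>) integrable_on {0..s}"
          by (intro integrable_continuous_real continuous_on_add continuous_on_mult_left contD contW)
      qed (use int lip in \<open>auto simp: D_def intro: integrable_diff\<close>)
      also have "\<dots> = L * integral {0..s} D + L * integral {0..s} (\<lambda>s. \<bar>W1 s - W2 s\<bar>)"
        using intD intW[of s] by (simp add: integral_add integrable_on_mult_right)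
      also have "\<dots> \<le> L * I + L * integral {0..s} D"
        using mult_left_mono[OF I_mono[of s] L_nonneg] s by simp
      finally show "D s \<le> L * I + L * integral {0..s} D" .
    qed (use contD L_nonneg t in auto)
    also have "\<dots> \<le> (L * I) * exp (L * T)"
      using t L_nonneg I0 by (intro mult_left_mono) (auto intro: mult_left_mono)
    finally show ?thesis by (simp add: D_def mult_ac)
  qed
  have \<zeta>: "\<bar>f1.\<zeta> b - f2.\<zeta> b\<bar> \<le> L * I" if "- t \<le> b" for b
  proof (cases "0 \<le> b")
    case True
    then show ?thesis using L_nonneg I0 by (simp add: f1.\<zeta>_def f2.\<zeta>_def)
  next
    case False
    have int: "(\<lambda>r. \<Lambda> 0 (W1 r)) integrable_on {0..-b}" "(\<lambda>r. \<Lambda> 0 (W2 r)) integrable_on {0..-b}"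
      using f1.cont_W' f2.cont_W' by (auto intro!: integrable_continuous_real continuous_on_\<Lambda> continuous_on_const continuous_on_id)
    have "\<bar>f1.\<zeta> b - f2.\<zeta> b\<bar> = norm (integral {0..-b} (\<lambda>r. \<Lambda> 0 (W1 r) - \<Lambda> 0 (W2 r)))"
      using False f1.A_integral[of "- b"] f2.A_integral[of "- b"] int
      by (simp add: f1.\<zeta>_def f2.\<zeta>_def integral_diff abs_minus_commute)
    also have "\<dots> \<le> integral {0..-b} (\<lambda>r. L * \<bar>W1 r - W2 r\<bar>)"
      by (rule integral_norm_bound_integral)
        (use int intW lip_w in \<open>auto intro: integrable_diff integrable_on_mult_right\<close>)
    also have "\<dots> \<le> L * I" using mult_left_mono[OF I_mono[of "- b"] L_nonneg] that by simp
    finally show ?thesis .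
  qed
  let ?e1 = "f1.exit t" and ?e2 = "f2.exit t"
  \<comment> \<open>Entry at or before time \<open>t\<close> means that \<zeta> at this label uses
    the mass on \<open>[0,t]\<close> only, which gives the estimate its Volterra form.\<close>
  have b: "- t \<le> ?e1" by (rule f1.exit_ge[OF t])
  have "f2.k\<zeta> * \<bar>?e1 - ?e2\<bar> \<le> \<bar>f2.\<zeta> ?e1 - f2.\<zeta> ?e2\<bar>" by (rule f2.\<zeta>_expand)
  also have "\<dots> \<le> exp (L * T) * \<bar>f2.Z t ?e1 - f2.Z t ?e2\<bar>"
    unfolding f2.Z_def by (rule f2.X_expand_y)
  \<comment> \<open>Each leaving label is at \<open>1\<close> under its own flow, so
    \<open>f2.Z t ?e2\<close> can be exchanged for \<open>f1.Z t ?e1\<close>.\<close>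
  also have "\<bar>f2.Z t ?e1 - f2.Z t ?e2\<bar> = \<bar>f2.X t (f2.\<zeta> ?e1) - f1.X t (f1.\<zeta> ?e1)\<bar>"
    using f1.Z_exit[of t] unfolding f2.Z_exit f1.Z_def by (simp add: f2.Z_def)
  also have "\<dots> \<le> exp (L * T) * (L * I) + L * exp (L * T) * I"
  proof -
    have "\<bar>f2.X t (f2.\<zeta> ?e1) - f2.X t (f1.\<zeta> ?e1)\<bar> \<le> exp (L * T) * \<bar>f2.\<zeta> ?e1 - f1.\<zeta> ?e1\<bar>"
      by (rule f2.X_lip_y)
    also have "\<dots> \<le> exp (L * T) * (L * I)"
      using \<zeta>[OF b] by (intro mult_left_mono) (auto simp: abs_minus_commute)
    finally show ?thesis using X[of "f1.\<zeta> ?e1"] by linarith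
  qed
  finally have *: "min 1 c * \<bar>?e1 - ?e2\<bar> \<le> exp (L * T) * (exp (L * T) * (L * I) + L * exp (L * T) * I)"
    by (simp add: f2.k\<zeta>_def mult_left_mono)
  have "0 < min 1 c" using c_pos by simp
  with * have "\<bar>?e1 - ?e2\<bar> \<le> exp (L * T) * (exp (L * T) * (L * I) + L * exp (L * T) * I) / min 1 c"
    by (simp add: pos_le_divide_eq mult.commute)
  also have "\<dots> = exp (L * T) * (exp (L * T) * L + L * exp (L * T)) / min 1 c * I"
    by (simp add: algebra_simps)
  finally have e: "\<bar>?e1 - ?e2\<bar> \<le> exp (L * T) * (exp (L * T) * L + L * exp (L * T)) / min 1 c * I" .
  have "\<bar>F W1 t - F W2 t\<bar> = \<bar>G ?e1 - G ?e2\<bar>" by (simp add: F_def)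
  also have "\<dots> \<le> B * \<bar>?e1 - ?e2\<bar>" by (rule G_lip)
  also have "\<dots> \<le> K * I"
    using mult_left_mono[OF e B_ge] by (simp add: K_def mult.assoc)
  finally show ?thesis by (simp add: I_def)
qed

lemma fixed_point_unique:
  assumes W: "continuous_on UNIV W1" "continuous_on UNIV W2"
    and fp: "\<And>t. t \<in> {0..T} \<Longrightarrow> F W1 t = W1 t" "\<And>t. t \<in> {0..T} \<Longrightarrow> F W2 t = W2 t"
    and t: "t \<in> {0..T}"
  shows "W1 t = W2 t"
proof -
  have "\<bar>W1 t - W2 t\<bar> \<le> 0 * exp (K * t)"
  proof (rule gronwall[OF _ K_nonneg _ t])
    show "continuous_on {0..T} (\<lambda>s. \<bar>W1 s - W2 s\<bar>)"
      by (intro continuous_intros W[THEN continuous_on_subset] subset_UNIV)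
    show "\<bar>W1 s - W2 s\<bar> \<le> 0 + K * integral {0..s} (\<lambda>s. \<bar>W1 s - W2 s\<bar>)" if "s \<in> {0..T}" for s
      using F_lip[OF W that] fp[OF that] by simp
  qed
  then show ?thesis by simp
qed

lemma fixed_point_exists: "\<exists>W. continuous_on UNIV W \<and> (\<forall>t\<in>{0..T}. F W t = W t)"
  by (rule volterra_fixpoint[OF _ K_nonneg]) (use T_positive F_continuous F_lip in auto)

text \<open>The fixed point is the mass of the density that its own flow transports, which closes
  the loop. The mass bound is recorded so that the clamp can be removed afterwards.\<close>

lemma solution_exists:
  "\<exists>\<rho>. (\<forall>t\<in>{0..T}. 0 \<le> mass \<rho> t \<and> mass \<rho> t \<le> B * (T + 1)) \<and>
    linear_weak (\<lambda>t x. \<Lambda> x (mass \<rho> t)) T g (\<lambda>t. g (- t)) \<rho> \<and> (\<forall>t x. 0 \<le> \<rho> t x) \<and>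
    (\<forall>p\<ge>1. C0_Lp p T \<rho>) \<and> Linf ({0<..<T} \<times> {0<..<1}) (\<lambda>(t, x). \<rho> t x)"
proof -
  obtain W where W: "continuous_on UNIV W" and fp: "\<And>t. t \<in> {0..T} \<Longrightarrow> F W t = W t"
    using fixed_point_exists by blast
  interpret transport \<Lambda> sl c C L T W g B by (rule transport) fact
  have mass: "mass \<rho> t = W t" if "t \<in> {0..T}" for t
    using mass_eq_F[OF W that] fp[OF that] by simp
  have "linear_weak (\<lambda>t x. \<Lambda> x (mass \<rho> t)) T g (\<lambda>t. g (- t)) \<rho> \<longleftrightarrow>
      linear_weak (\<lambda>t x. \<Lambda> x (W t)) T g (\<lambda>t. g (- t)) \<rho>"
    by (rule linear_weak_cong_velocity) (simp add: mass)
  then show ?thesis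
    using weak_\<rho> \<rho>_nonneg \<rho>_C0_Lp \<rho>_Linf F_bounds[OF W] mass fp by (intro exI[of _ \<rho>]) auto
qed

text \<open>By linear uniqueness \<sigma> is the density transported by the flow of
  \<open>W\<close>, and that density has mass \<open>F W\<close>. For \<open>W\<close> the mass of
  \<sigma> itself this is the fixed point equation.\<close>

lemma mass_fixed_point:
  assumes W: "continuous_on UNIV W" and \<sigma>: "C0_Lp 1 T \<sigma>"
    and weak: "linear_weak (\<lambda>t x. \<Lambda> x (W t)) T g (\<lambda>t. g (- t)) \<sigma>" and t: "t \<in> {0..T}"
  shows "mass \<sigma> t = F W t"
proof -
  interpret transport \<Lambda> sl c C L T W g B by (rule transport) fact
  have \<rho>: "C0_Lp 1 T \<rho>" by (rule \<rho>_C0_Lp) simp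
  have "AE x in lebesgue_on {0<..<1}. \<sigma> t x = \<rho> t x"
    by (rule linear_weak_unique[OF \<sigma> \<rho> weak weak_\<rho> t])
  then have "mass \<sigma> t = mass \<rho> t"
    unfolding mass_def using C0_L1D(1)[OF \<sigma> t] C0_L1D(1)[OF \<rho> t] by (intro integral_cong_AE) auto
  then show ?thesis using mass_eq_F[OF W t] by simp
qed

text \<open>Both masses are fixed points and so agree; the two solutions then share one velocity and
  linear uniqueness applies.\<close>

lemma solution_unique:
  assumes W: "continuous_on UNIV W1" "continuous_on UNIV W2" and \<sigma>: "C0_Lp 1 T \<sigma>1" "C0_Lp 1 T \<sigma>2"
    and mass: "\<And>t. t \<in> {0..T} \<Longrightarrow> mass \<sigma>1 t = W1 t" "\<And>t. t \<in> {0..T} \<Longrightarrow> mass \<sigma>2 t = W2 t"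
    and weak: "linear_weak (\<lambda>t x. \<Lambda> x (W1 t)) T g (\<lambda>t. g (- t)) \<sigma>1"
      "linear_weak (\<lambda>t x. \<Lambda> x (W2 t)) T g (\<lambda>t. g (- t)) \<sigma>2"
    and t: "t \<in> {0..T}"
  shows "AE x in lebesgue_on {0<..<1}. \<sigma>1 t x = \<sigma>2 t x"
proof -
  interpret flow \<Lambda> sl c C L T W2 by (rule flow) fact
  have eq: "W1 t = W2 t" if "t \<in> {0..T}" for t
    using fixed_point_unique[OF W _ _ that] mass_fixed_point[OF W(1) \<sigma>(1) weak(1)]
      mass_fixed_point[OF W(2) \<sigma>(2) weak(2)] mass by simp
  have "linear_weak (\<lambda>t x. \<Lambda> x (W1 t)) T g (\<lambda>t. g (- t)) \<sigma>1 \<longleftrightarrow>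
      linear_weak (\<lambda>t x. \<Lambda> x (W2 t)) T g (\<lambda>t. g (- t)) \<sigma>1"
    by (rule linear_weak_cong_velocity) (simp add: eq)
  then show ?thesis using linear_weak_unique[OF \<sigma> _ weak(2) t] weak(1) by simp
qed

end

section \<open>Existence and uniqueness\<close>

abbreviation clamp1 :: "real \<Rightarrow> real \<Rightarrow> real" where "clamp1 M x \<equiv> max 0 (min M x)"

lemma clamp1_mem: "0 \<le> M \<Longrightarrow> clamp1 M x \<in> {0..M}"
  by simp

lemma clamp1_lip: "\<bar>clamp1 M x - clamp1 M y\<bar> \<le> \<bar>x - y\<bar>"
  by linarith

lemma C1_rect_partial1:
  assumes "C1_rect S R f f1 f2" "a \<in> S" "b \<in> R"
  shows "((\<lambda>x. f x b) has_real_derivative f1 a b) (at a within S)"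
proof -
  have "((\<lambda>(x, y). f x y) has_derivative (\<lambda>(h, k). f1 a b * h + f2 a b * k)) (at (a, b) within S \<times> R)"
    using assms unfolding C1_rect_def by blast
  then have "((\<lambda>(x, y). f x y) has_derivative (\<lambda>(h, k). f1 a b * h + f2 a b * k)) (at (a, b) within (\<lambda>x. (x, b)) ` S)"
    by (rule has_derivative_subset) (use assms in auto)
  from has_derivative_in_compose[OF has_derivative_Pair[OF has_derivative_ident has_derivative_const] this]
  show ?thesis by (simp add: has_field_derivative_def)
qed

lemma C1_rect_partial2:
  assumes "C1_rect S R f f1 f2" "a \<in> S" "b \<in> R"
  shows "((\<lambda>y. f a y) has_real_derivative f2 a b) (at b within R)"
proof -
  have "((\<lambda>(x, y). f x y) has_derivative (\<lambda>(h, k). f1 a b * h + f2 a b * k)) (at (a, b) within S \<times> R)"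
    using assms unfolding C1_rect_def by blast
  then have "((\<lambda>(x, y). f x y) has_derivative (\<lambda>(h, k). f1 a b * h + f2 a b * k)) (at (a, b) within (\<lambda>y. (a, y)) ` R)"
    by (rule has_derivative_subset) (use assms in auto)
  from has_derivative_in_compose[OF has_derivative_Pair[OF has_derivative_const has_derivative_ident] this]
  show ?thesis by (simp add: has_field_derivative_def)
qed

text \<open>A form for one-sided derivatives at the ends and for \<open>a\<close>, \<open>b\<close>
  in either order, \<open>a = b\<close> included.\<close>

lemma mean_value_within:
  fixes f :: "real \<Rightarrow> real"
  assumes "\<And>x. x \<in> {p..q} \<Longrightarrow> (f has_real_derivative f' x) (at x within {p..q})"
    and "a \<in> {p..q}" "b \<in> {p..q}"
  obtains z where "z \<in> {p..q}" "min a b \<le> z" "z \<le> max a b" "f b - f a = f' z * (b - a)"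
proof -
  have *: "\<exists>z\<in>{a..b}. f b - f a = f' z * (b - a)" if "a < b" "{a..b} \<subseteq> {p..q}" for a b
  proof -
    have "(f has_derivative (*) (f' x)) (at x within {a..b})" if "a \<le> x" "x \<le> b" for x
    proof -
      have "x \<in> {p..q}" using that \<open>{a..b} \<subseteq> {p..q}\<close> by auto
      from DERIV_subset[OF assms(1)[OF this] \<open>{a..b} \<subseteq> {p..q}\<close>] show ?thesis
        by (simp add: has_field_derivative_def)
    qed
    from mvt_simple[OF \<open>a < b\<close> this] show ?thesis by force
  qed
  consider "a < b" | "b < a" | "a = b" by linarith
  then show thesis
  proof cases
    case 1
    with *[of a b] assms obtain z where "z \<in> {a..b}" "f b - f a = f' z * (b - a)" by auto
    with 1 assms(2,3) show thesis by (intro that[of z]) auto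
  next
    case 2
    with *[of b a] assms obtain z where "z \<in> {b..a}" "f a - f b = f' z * (a - b)" by auto
    with 2 assms(2,3) show thesis by (intro that[of z]) (auto simp: algebra_simps)
  next
    case 3
    then show thesis using assms(2) by (intro that[of a]) auto
  qed
qed

text \<open>All constants come from compactness of \<open>[0,1] \<times> [0,M]\<close>: the minimum
  of \<open>lam\<close> is attained and hence positive, and bounds on the partial derivatives give
  \<open>L\<close>, since clamping does not increase distances.\<close>

lemma velocity_exists:
  assumes C1: "C1_rect {0..1} {0..} lam lam1 lam2"
    and pos: "\<And>x w. x \<in> {0..1} \<Longrightarrow> w \<ge> 0 \<Longrightarrow> lam x w > 0"
    and "0 \<le> M"
  shows "\<exists>sl c C L. velocity (\<lambda>x w. lam (clamp1 1 x) (clamp1 M w)) sl c C L"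
proof -
  define \<Lambda> where "\<Lambda> x w = lam (clamp1 1 x) (clamp1 M w)" for x w
  define R where "R = {0..1::real} \<times> {0..M}"
  have R: "compact R" "R \<noteq> {}" "R \<subseteq> {0..1} \<times> {0..}"
    using \<open>0 \<le> M\<close> unfolding R_def by (auto intro: compact_Times)
  note cont = C1_rect_continuous[OF C1, THEN continuous_on_subset, OF R(3)]
  have bound: "\<exists>K. \<forall>z\<in>R. \<bar>h z\<bar> \<le> K" if ch: "continuous_on R h" for h :: "real \<times> real \<Rightarrow> real"
    using compact_imp_bounded[OF compact_continuous_image[OF ch R(1)]]
    unfolding bounded_iff by auto
  obtain z0 where z0: "z0 \<in> R" "\<And>z. z \<in> R \<Longrightarrow> lam (fst z0) (snd z0) \<le> lam (fst z) (snd z)"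
    using continuous_attains_inf[OF R(1,2) cont(1)] by blast
  from bound[OF cont(1)] obtain C where C: "\<And>z. z \<in> R \<Longrightarrow> \<bar>lam (fst z) (snd z)\<bar> \<le> C" by blast
  from bound[OF cont(2)] obtain L1 where L1: "\<And>z. z \<in> R \<Longrightarrow> \<bar>lam1 (fst z) (snd z)\<bar> \<le> L1" by blast
  from bound[OF cont(3)] obtain L2 where L2: "\<And>z. z \<in> R \<Longrightarrow> \<bar>lam2 (fst z) (snd z)\<bar> \<le> L2" by blast
  define L where "L = max L1 L2"
  have inR: "(clamp1 1 x, clamp1 M w) \<in> R" for x w
    using \<open>0 \<le> M\<close> by (auto simp: R_def)
  have L: "\<bar>lam1 x w\<bar> \<le> L" "\<bar>lam2 x w\<bar> \<le> L" if "x \<in> {0..1}" "w \<in> {0..M}" for x w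
    using L1[of "(x, w)"] L2[of "(x, w)"] that by (auto simp: R_def L_def)
  have L0: "0 \<le> L" using L(1)[of 0 0] \<open>0 \<le> M\<close> by simp
  have mv1: "\<exists>z. z \<in> {0..1} \<and> min x x' \<le> z \<and> z \<le> max x x' \<and> lam x' w - lam x w = lam1 z w * (x' - x)"
    if "x \<in> {0..1}" "x' \<in> {0..1}" "w \<in> {0..M}" for x x' w
    using mean_value_within[of 0 1 "\<lambda>x. lam x w" "\<lambda>x. lam1 x w" x x'] C1_rect_partial1[OF C1] that
    by (metis atLeastAtMost_iff atLeast_iff)
  have lip1: "\<bar>\<Lambda> x' w - \<Lambda> x w\<bar> \<le> L * \<bar>x' - x\<bar>" for x x' w
  proof -
    obtain z where z: "z \<in> {0..1}" "\<Lambda> x' w - \<Lambda> x w = lam1 z (clamp1 M w) * (clamp1 1 x' - clamp1 1 x)"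
      using mv1[OF clamp1_mem clamp1_mem clamp1_mem[OF \<open>0 \<le> M\<close>], of x x' w] unfolding \<Lambda>_def by auto
    have "\<bar>lam1 z (clamp1 M w)\<bar> \<le> L" by (rule L(1)[OF z(1) clamp1_mem[OF \<open>0 \<le> M\<close>]])
    then show ?thesis
      unfolding z(2) abs_mult by (rule mult_mono[OF _ clamp1_lip L0]) simp
  qed
  have lip2: "\<bar>\<Lambda> x w - \<Lambda> x w'\<bar> \<le> L * \<bar>w - w'\<bar>" for x w w'
  proof -
    let ?x = "clamp1 1 x"
    have "((\<lambda>w. lam ?x w) has_real_derivative lam2 ?x v) (at v within {0..M})" if "v \<in> {0..M}" for v
      by (rule DERIV_subset[OF C1_rect_partial2[OF C1]]) (use that in auto)
    from mean_value_within[OF this clamp1_mem[OF \<open>0 \<le> M\<close>, of w'] clamp1_mem[OF \<open>0 \<le> M\<close>, of w]]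
    obtain z where z: "z \<in> {0..M}" "\<Lambda> x w - \<Lambda> x w' = lam2 ?x z * (clamp1 M w - clamp1 M w')"
      unfolding \<Lambda>_def by blast
    have "\<bar>lam2 ?x z\<bar> \<le> L" by (rule L(2)[OF clamp1_mem z(1)]) simp
    then show ?thesis
      unfolding z(2) abs_mult by (rule mult_mono[OF _ clamp1_lip L0]) simp
  qed
  \<comment> \<open>The values on the diagonal. At \<open>0\<close> and \<open>1\<close> they are
    the one-sided derivatives from inside, while beyond these points the clamped velocity is
    constant.\<close>
  define l where "l x w = (if 0 \<le> x \<and> x \<le> 1 then lam1 (clamp1 1 x) (clamp1 M w) else 0)" for x w
  define sl where "sl x x' w = (if x = x' then l x w else (\<Lambda> x' w - \<Lambda> x w) / (x' - x))" for x x' w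
  have cont_clamp: "continuous_on UNIV (\<lambda>z. h (clamp1 1 (f z)) (clamp1 M (f' z)))"
    if h: "continuous_on R (\<lambda>z. h (fst z) (snd z))" and f: "continuous_on UNIV f" "continuous_on UNIV f'"
    for h :: "real \<Rightarrow> real \<Rightarrow> real" and f f' :: "real \<times> real \<times> real \<Rightarrow> real"
  proof -
    have "continuous_on UNIV (\<lambda>z. (clamp1 1 (f z), clamp1 M (f' z)))"
      by (intro continuous_intros f)
    from continuous_on_compose2[OF h this] show ?thesis using inR by auto
  qed
  have meas: "(\<lambda>(x, x', w). sl x x' w) \<in> borel_measurable borel"
  proof -
    have c: "continuous_on UNIV (\<lambda>z :: real \<times> real \<times> real. fst z)"
      "continuous_on UNIV (\<lambda>z :: real \<times> real \<times> real. fst (snd z))"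
      "continuous_on UNIV (\<lambda>z :: real \<times> real \<times> real. snd (snd z))"
      by (intro continuous_intros)+
    note [measurable] = c[THEN borel_measurable_continuous_onI]
      cont_clamp[OF cont(2) c(1,3), THEN borel_measurable_continuous_onI]
      cont_clamp[OF cont(1) c(1,3), THEN borel_measurable_continuous_onI]
      cont_clamp[OF cont(1) c(2,3), THEN borel_measurable_continuous_onI]
    show ?thesis
      unfolding sl_def l_def \<Lambda>_def split_beta' by measurable
  qed
  \<comment> \<open>Inside the interval the mean value theorem writes the quotient as
    \<open>lam1\<close> at a point between \<open>p\<close> and \<open>q\<close>, and
    \<open>lam1\<close> is continuous; outside the quotient is locally zero.\<close>
  have slope_at: "isCont (\<lambda>(p, q). sl p q w) (x, x)" if x: "x \<notin> {0, 1}" for x w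
  proof (cases "0 \<le> x \<and> x \<le> 1")
    case False
    define U where "U = (if x < 0 then {..<0::real} else {1<..})"
    have U: "open (U \<times> U)" "(x, x) \<in> U \<times> U"
      using False by (auto simp: U_def intro: open_Times)
    have "sl p q w = 0" if "(p, q) \<in> U \<times> U" for p q
      using that False by (auto simp: U_def sl_def l_def \<Lambda>_def split: if_splits)
    then have "\<And>z. z \<in> U \<times> U \<Longrightarrow> (\<lambda>(p, q). sl p q w) z = (\<lambda>_. 0) z" by auto
    then have "continuous_on (U \<times> U) (\<lambda>(p, q). sl p q w)"
      using continuous_on_cong[of "U \<times> U" "U \<times> U" "\<lambda>(p, q). sl p q w" "\<lambda>_. 0"] by auto
    then show ?thesis using continuous_on_eq_continuous_at[OF U(1)] U(2) by blast
  next
    case True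
    with x have x01: "0 < x" "x < 1" by auto
    have "continuous_on {0..1} (\<lambda>y. lam1 y (clamp1 M w))"
    proof -
      have "continuous_on {0..1} (\<lambda>y. (y, clamp1 M w))" by (intro continuous_intros)
      moreover have "(\<lambda>y. (y, clamp1 M w)) ` {0..1} \<subseteq> R"
        using clamp1_mem[OF \<open>0 \<le> M\<close>] by (auto simp: R_def)
      ultimately show ?thesis using continuous_on_compose2[OF cont(2)] by fastforce
    qed
    then have "isCont (\<lambda>y. lam1 y (clamp1 M w)) x"
      using x01 by (intro continuous_on_interior[of "{0..1}"]) auto
    note lam1 = this[unfolded continuous_at_eps_delta]
    show ?thesis
      unfolding continuous_at_eps_delta
    proof (intro allI impI)
      fix e :: real assume "0 < e"
      then obtain d where d: "0 < d" "\<And>y. \<bar>y - x\<bar> < d \<Longrightarrow> \<bar>lam1 y (clamp1 M w) - lam1 x (clamp1 M w)\<bar> < e"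
        using lam1 by (auto simp: dist_real_def)
      \<comment> \<open>The two extra terms keep \<open>p\<close> and \<open>q\<close> within
        \<open>[0,1]\<close>, where the clamp is the identity.\<close>
      define d' where "d' = min d (min x (1 - x))"
      have d': "0 < d'" using d x01 by (simp add: d'_def)
      have close: "\<bar>sl p q w - lam1 x (clamp1 M w)\<bar> < e" if pq: "\<bar>p - x\<bar> < d'" "\<bar>q - x\<bar> < d'" for p q
      proof -
        have p01: "p \<in> {0..1}" "q \<in> {0..1}" using pq x01 by (auto simp: d'_def)
        then have cl: "clamp1 1 p = p" "clamp1 1 q = q" by auto
        obtain z where z: "min p q \<le> z" "z \<le> max p q" "lam q (clamp1 M w) - lam p (clamp1 M w) = lam1 z (clamp1 M w) * (q - p)"
          using mv1[of p q "clamp1 M w"] p01 \<open>0 \<le> M\<close> by auto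
        have "\<exists>z. \<bar>z - x\<bar> < d \<and> sl p q w = lam1 z (clamp1 M w)"
        proof (cases "p = q")
          case True
          then show ?thesis using p01 pq cl by (intro exI[of _ p]) (auto simp: sl_def l_def d'_def)
        next
          case False
          have "d' \<le> d" by (simp add: d'_def)
          then have "\<bar>z - x\<bar> < d" using z(1,2) pq by linarith
          then show ?thesis using False z(3) cl by (intro exI[of _ z]) (simp add: sl_def \<Lambda>_def)
        qed
        then show ?thesis using d(2) by auto
      qed
      have "dist (sl (fst z) (snd z) w) (lam1 x (clamp1 M w)) < e" if "dist z (x, x) < d'" for z
      proof -
        have "dist (fst z) x \<le> dist z (x, x)" "dist (snd z) x \<le> dist z (x, x)"
          using dist_fst_le[of z "(x, x)"] dist_snd_le[of z "(x, x)"] by auto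
        then show ?thesis using close[of "fst z" "snd z"] that by (simp add: dist_real_def)
      qed
      moreover have "sl x x w = lam1 x (clamp1 M w)" using x01 by (simp add: sl_def l_def)
      ultimately show "\<exists>d>0. \<forall>z. dist z (x, x) < d \<longrightarrow> dist ((\<lambda>(p, q). sl p q w) z) ((\<lambda>(p, q). sl p q w) (x, x)) < e"
        using d' by (intro exI[of _ d']) (auto simp: split_beta')
    qed
  qed
  have slope_off: "isCont (\<lambda>(p, q). sl p q w) (x, x')" if "x \<noteq> x'" for x x' w
  proof -
    define U where "U = {z :: real \<times> real. fst z \<noteq> snd z}"
    have U: "open U" "(x, x') \<in> U"
      using that unfolding U_def by (auto intro!: open_Collect_neq continuous_intros)
    have c: "continuous_on UNIV (\<lambda>z :: real \<times> real. \<Lambda> (f z) w)" if "continuous_on UNIV f" for f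
    proof (rule continuous_on_compose2[of UNIV "\<lambda>x. \<Lambda> x w"])
      have "L-lipschitz_on UNIV (\<lambda>x. \<Lambda> x w)"
        using lip1 L0 by (intro lipschitz_onI) (auto simp: dist_real_def)
      then show "continuous_on UNIV (\<lambda>x. \<Lambda> x w)" by (rule lipschitz_on_continuous_on)
    qed (use that in auto)
    have "continuous_on U (\<lambda>z. (\<Lambda> (snd z) w - \<Lambda> (fst z) w) / (snd z - fst z))"
      by (intro continuous_intros continuous_on_subset[OF c]) (auto simp: U_def)
    then have "continuous_on U (\<lambda>(p, q). sl p q w)"
      by (rule continuous_on_eq) (auto simp: U_def sl_def)
    then show ?thesis using continuous_on_eq_continuous_at[OF U(1)] U(2) by blast
  qed
  have "velocity \<Lambda> sl (lam (fst z0) (snd z0)) C L"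
  proof
    show "0 < lam (fst z0) (snd z0)" using z0(1) by (intro pos) (auto simp: R_def)
    show "lam (fst z0) (snd z0) \<le> \<Lambda> x w" "\<Lambda> x w \<le> C" for x w
      using z0(2)[OF inR[of x w]] C[OF inR[of x w], THEN abs_le_D1] by (auto simp: \<Lambda>_def)
    show "\<bar>\<Lambda> x w - \<Lambda> x w'\<bar> \<le> L * \<bar>w - w'\<bar>" for x w w' by (rule lip2)
    show "\<Lambda> x w = \<Lambda> 0 w" if "x \<le> 0" for x w using that by (simp add: \<Lambda>_def)
    show "\<Lambda> x' w - \<Lambda> x w = sl x x' w * (x' - x)" for x x' w by (simp add: sl_def)
    show "\<bar>sl x x' w\<bar> \<le> L" for x x' w
    proof (cases "x = x'")
      case True
      then show ?thesis using L(1)[of "clamp1 1 x" "clamp1 M w"] L0 \<open>0 \<le> M\<close> by (auto simp: sl_def l_def)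
    next
      case False
      then show ?thesis using lip1[of x' w x] by (simp add: sl_def abs_divide divide_le_eq)
    qed
    show "isCont (\<lambda>(p, q). sl p q w) (x, x')" if "x \<noteq> x' \<or> x \<notin> {0, 1}" for x x' w
      using slope_at[of x w] slope_off[of x x' w] that by (cases "x = x'") auto
  qed (rule meas)
  then show ?thesis unfolding \<Lambda>_def[abs_def] by blast
qed

text \<open>Bounds that hold almost everywhere become bounds everywhere for a Borel representative,
  as the label density requires. Using \<open>\<bar>B\<bar>\<close> keeps the level nonnegative, so
  that it also bounds the value \<open>0\<close> outside the interval.\<close>

lemma bounded_borel_version:
  fixes f :: "real \<Rightarrow> real"
  assumes "Linf {a<..<b} f" "AE x in lebesgue_on {a<..<b}. f x \<ge> 0"
  obtains f' B where "f' \<in> borel_measurable borel" "\<And>x. 0 \<le> f' x" "\<And>x. f' x \<le> B"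
    "\<And>x. x \<notin> {a<..<b} \<Longrightarrow> f' x = 0" "AE x in lebesgue_on {a<..<b}. f x = f' x"
proof -
  let ?S = "{a<..<b}"
  obtain B where f: "f \<in> borel_measurable (lebesgue_on ?S)" and B: "AE x in lebesgue_on ?S. \<bar>f x\<bar> \<le> B"
    using assms(1) unfolding Linf_def by blast
  have "(\<lambda>x. indicator ?S x * f x) \<in> borel_measurable lebesgue"
    using f by (simp add: borel_measurable_restrict_space_iff)
  then obtain h where h [measurable]: "h \<in> borel_measurable lborel"
    and ae: "AE x in lborel. indicator ?S x * f x = h x"
    using completion_ex_borel_measurable_real by blast
  define f' where "f' x = indicator ?S x * max 0 (min \<bar>B\<bar> (h x))" for x
  have "AE x in lebesgue. indicator ?S x * f x = h x" by (rule AE_completion[OF ae])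
  then have "AE x in lebesgue_on ?S. indicator ?S x * f x = h x"
    by (subst AE_restrict_space_iff) (auto elim: eventually_mono)
  moreover have "AE x in lebesgue_on ?S. x \<in> ?S" by (rule AE_I2) simp
  ultimately have "AE x in lebesgue_on ?S. f x = f' x"
    using B assms(2) by eventually_elim (auto simp: f'_def)
  moreover have "f' \<in> borel_measurable borel"
    unfolding f'_def using h by measurable
  ultimately show thesis
    by (intro that[of f' "\<bar>B\<bar>"]) (auto simp: f'_def indicator_def)
qed

text \<open>The data enter through integrals against continuous functions only, so they may be
  changed on null sets.\<close>

lemma linear_weak_cong_data:
  assumes u: "u \<in> borel_measurable (lebesgue_on {0<..<T})" "u' \<in> borel_measurable borel"
      "AE t in lebesgue_on {0<..<T}. u t = u' t"
    and \<rho>0: "\<rho>0 \<in> borel_measurable (lebesgue_on {0<..<1})" "\<rho>0' \<in> borel_measurable borel"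
      "AE x in lebesgue_on {0<..<1}. \<rho>0 x = \<rho>0' x"
  shows "linear_weak a T \<rho>0 u \<rho> \<longleftrightarrow> linear_weak a T \<rho>0' u' \<rho>"
proof -
  have eq: "(LINT t|lebesgue_on {0<..<\<tau>}. u t * \<phi> t 0) = (LINT t|lebesgue_on {0<..<\<tau>}. u' t * \<phi> t 0) \<and>
      (LINT x|lebesgue_on {0<..<1}. \<rho>0 x * \<phi> 0 x) = (LINT x|lebesgue_on {0<..<1}. \<rho>0' x * \<phi> 0 x)"
    if \<tau>: "\<tau> \<in> {0..T}" and C1: "C1_rect {0..\<tau>} {0..1} \<phi> \<phi>t \<phi>x" for \<tau> \<phi> \<phi>t \<phi>x
  proof
    note c = C1_rect_continuous(1)[OF C1]
    have c1: "continuous_on {0<..<\<tau>} (\<lambda>t. \<phi> t 0)"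
    proof -
      have "continuous_on {0<..<\<tau>} (\<lambda>t. \<phi> (fst (t, 0 :: real)) (snd (t, 0 :: real)))"
        by (rule continuous_on_compose2[OF c, where f="\<lambda>t. (t, 0)"]) (auto intro!: continuous_intros)
      then show ?thesis by simp
    qed
    have c2: "continuous_on {0<..<1} (\<lambda>x. \<phi> 0 x)"
    proof -
      have "continuous_on {0<..<1} (\<lambda>x. \<phi> (fst (0 :: real, x)) (snd (0 :: real, x)))"
        by (rule continuous_on_compose2[OF c, where f="\<lambda>x. (0, x)"]) (use \<tau> in \<open>auto intro!: continuous_intros\<close>)
      then show ?thesis by simp
    qed
    have [measurable]: "(\<lambda>t. \<phi> t 0) \<in> borel_measurable (lebesgue_on {0<..<\<tau>})"
      "(\<lambda>x. \<phi> 0 x) \<in> borel_measurable (lebesgue_on {0<..<1})"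
      using c1 c2 by (auto intro: continuous_imp_measurable_on_sets_lebesgue)
    have sub: "{0<..<\<tau>} \<subseteq> {0<..<T}" using \<tau> by auto
    have [measurable]: "u \<in> borel_measurable (lebesgue_on {0<..<\<tau>})"
      by (rule measurable_restrict_mono[OF u(1) sub])
    have [measurable]: "u' \<in> borel_measurable (lebesgue_on {0<..<\<tau>})" "\<rho>0' \<in> borel_measurable (lebesgue_on {0<..<1})"
      "\<rho>0 \<in> borel_measurable (lebesgue_on {0<..<1})"
      using u(2) \<rho>0 by (auto intro: borel_measurable_lebesgue_on)
    have "AE t in lebesgue. t \<in> {0<..<T} \<longrightarrow> u t = u' t"
      using u(3) by (subst (asm) AE_restrict_space_iff) auto
    then have "AE t in lebesgue_on {0<..<\<tau>}. u t = u' t"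
      using sub by (subst AE_restrict_space_iff) (auto elim!: eventually_mono)
    then have "AE t in lebesgue_on {0<..<\<tau>}. u t * \<phi> t 0 = u' t * \<phi> t 0" by eventually_elim simp
    then show "(LINT t|lebesgue_on {0<..<\<tau>}. u t * \<phi> t 0) = (LINT t|lebesgue_on {0<..<\<tau>}. u' t * \<phi> t 0)"
      by (intro integral_cong_AE) auto
    have "AE x in lebesgue_on {0<..<1}. \<rho>0 x * \<phi> 0 x = \<rho>0' x * \<phi> 0 x"
      using \<rho>0(3) by eventually_elim simp
    then show "(LINT x|lebesgue_on {0<..<1}. \<rho>0 x * \<phi> 0 x) = (LINT x|lebesgue_on {0<..<1}. \<rho>0' x * \<phi> 0 x)"
      by (intro integral_cong_AE) auto
  qed
  show ?thesis
    unfolding linear_weak_def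
    by (intro ball_cong refl iff_allI imp_cong) (use eq in \<open>simp only:\<close>)
qed

lemma mass_continuous:
  assumes "C0_Lp 1 T \<sigma>"
  shows "continuous_on {0..T} (mass \<sigma>)"
  using C0_L1_continuous_integral[OF assms, of "\<lambda>_ _. 1"] by (simp add: mass_def[abs_def])

theorem theorem3p1:
  fixes lam :: "real \<Rightarrow> real \<Rightarrow> real" and T :: real and \<rho>0 u :: "real \<Rightarrow> real"
  assumes "\<exists>lam1 lam2. C1_rect {0..1} {0..} lam lam1 lam2"
    and "\<And>x w. x \<in> {0..1} \<Longrightarrow> w \<ge> 0 \<Longrightarrow> lam x w > 0"
    and "T > 0"
    and "Linf {0<..<1} \<rho>0"
    and "AE x in lebesgue_on {0<..<1}. \<rho>0 x \<ge> 0"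
    and "Linf {0<..<T} u"
    and "AE t in lebesgue_on {0<..<T}. u t \<ge> 0"
  shows "\<exists>\<rho>. weak_solution lam T \<rho>0 u \<rho> \<and>
    (\<forall>\<sigma>. weak_solution lam T \<rho>0 u \<sigma> \<longrightarrow>
        (\<forall>t\<in>{0..T}. AE x in lebesgue_on {0<..<1}. \<sigma> t x = \<rho> t x)) \<and>
    (AE (t, x) in lebesgue_on ({0..T} \<times> {0..1}). \<rho> t x \<ge> 0) \<and>
    (\<forall>p\<ge>1. C0_Lp p T \<rho>)"
proof -
  obtain lam1 lam2 where C1: "C1_rect {0..1} {0..} lam lam1 lam2" using assms(1) by blast
  obtain q B1 where q: "q \<in> borel_measurable borel" "\<And>x. 0 \<le> q x" "\<And>x. q x \<le> B1"
      "\<And>x. x \<notin> {0<..<1} \<Longrightarrow> q x = 0" "AE x in lebesgue_on {0<..<1}. \<rho>0 x = q x"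
    by (rule bounded_borel_version[OF assms(4,5)]) (intro that; assumption)
  obtain v B2 where v: "v \<in> borel_measurable borel" "\<And>x. 0 \<le> v x" "\<And>x. v x \<le> B2"
      "\<And>x. x \<notin> {0<..<T} \<Longrightarrow> v x = 0" "AE x in lebesgue_on {0<..<T}. u x = v x"
    by (rule bounded_borel_version[OF assms(6,7)]) (intro that; assumption)
  \<comment> \<open>The two summands have disjoint supports, in \<open>(0,1)\<close> and in
    \<open>(- T,0)\<close>.\<close>
  define g where "g b = q b + v (- b)" for b
  define B where "B = B1 + B2"
  have [measurable]: "g \<in> borel_measurable borel"
    unfolding g_def using q(1) v(1) by measurable
  have g: "0 \<le> g b" "g b \<le> B" for b
    using q(2,3)[of b] v(2,3)[of "- b"] by (auto simp: g_def B_def)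
  have g_supp: "g b = 0" if "b \<notin> {- T..1}" for b
    using q(4)[of b] v(4)[of "- b"] that \<open>T > 0\<close> by (auto simp: g_def)
  have B0: "0 \<le> B" using g[of 0] by linarith
  have data: "linear_weak a T \<rho>0 u \<rho> \<longleftrightarrow> linear_weak a T g (\<lambda>t. g (- t)) \<rho>" for a \<rho>
  proof (rule linear_weak_cong_data)
    show "(\<lambda>t. g (- t)) \<in> borel_measurable borel" "g \<in> borel_measurable borel" by measurable
    have "AE t in lebesgue_on {0<..<T}. t \<in> {0<..<T}" by (rule AE_I2) simp
    with v(5) show "AE t in lebesgue_on {0<..<T}. u t = g (- t)"
      by eventually_elim (use q(4) in \<open>auto simp: g_def\<close>)
    have "AE x in lebesgue_on {0<..<1::real}. x \<in> {0<..<1}" by (rule AE_I2) simp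
    with q(5) show "AE x in lebesgue_on {0<..<1}. \<rho>0 x = g x"
      by eventually_elim (use v(4) in \<open>auto simp: g_def\<close>)
  qed (use assms(4,6) in \<open>auto simp: Linf_def\<close>)
  have source: "\<exists>sl c C L. source (\<lambda>x w. lam (clamp1 1 x) (clamp1 M w)) sl c C L T g B" if M: "0 \<le> M" for M
  proof -
    obtain sl c C L where vel: "velocity (\<lambda>x w. lam (clamp1 1 x) (clamp1 M w)) sl c C L"
      using velocity_exists[OF C1 assms(2) M] by blast
    have "source (\<lambda>x w. lam (clamp1 1 x) (clamp1 M w)) sl c C L T g B"
      by (intro source.intro[OF vel] source_axioms.intro) (use g g_supp \<open>T > 0\<close> in auto)
    then show ?thesis by blast
  qed
  have vel: "linear_weak (\<lambda>t x. lam x (mass \<sigma> t)) T \<rho>0 u \<sigma> \<longleftrightarrow>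
      linear_weak (\<lambda>t x. lam (clamp1 1 x) (clamp1 M (W t))) T g (\<lambda>t. g (- t)) \<sigma>"
    if "\<And>t. t \<in> {0..T} \<Longrightarrow> mass \<sigma> t \<in> {0..M} \<and> W t = mass \<sigma> t" for \<sigma> M W
    unfolding data by (rule linear_weak_cong_velocity) (use that in auto)

  \<comment> \<open>This is the bound that \<open>solution_exists\<close> gives for the mass under
    any clamp, so the clamp at \<open>M\<close> does not act on the solution.\<close>
  define M where "M = B * (T + 1)"
  have M0: "0 \<le> M" using B0 \<open>T > 0\<close> by (simp add: M_def)
  obtain sl c C L where "source (\<lambda>x w. lam (clamp1 1 x) (clamp1 M w)) sl c C L T g B"
    using source[OF M0] by blast
  from source.solution_exists[OF this]
  obtain \<rho> where mass: "\<And>t. t \<in> {0..T} \<Longrightarrow> 0 \<le> mass \<rho> t \<and> mass \<rho> t \<le> M"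
    and weak: "linear_weak (\<lambda>t x. lam (clamp1 1 x) (clamp1 M (mass \<rho> t))) T g (\<lambda>t. g (- t)) \<rho>"
    and nonneg: "\<And>t x. 0 \<le> \<rho> t x" and C0: "\<And>p. p \<ge> 1 \<Longrightarrow> C0_Lp p T \<rho>"
    and Linf: "Linf ({0<..<T} \<times> {0<..<1}) (\<lambda>(t, x). \<rho> t x)"
    unfolding M_def by blast
  have "linear_weak (\<lambda>t x. lam x (mass \<rho> t)) T \<rho>0 u \<rho>"
    using vel[of \<rho> M "mass \<rho>"] mass weak by simp
  then have sol: "weak_solution lam T \<rho>0 u \<rho>"
    unfolding weak_solution_iff using C0 Linf mass by simp

  have unique: "AE x in lebesgue_on {0<..<1}. \<sigma>1 t x = \<sigma>2 t x"
    if sols: "weak_solution lam T \<rho>0 u \<sigma>1" "weak_solution lam T \<rho>0 u \<sigma>2" and t: "t \<in> {0..T}" for \<sigma>1 \<sigma>2 t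
  proof -
    have bdd: "\<exists>K. \<forall>t\<in>{0..T}. mass \<sigma> t \<le> K" if "weak_solution lam T \<rho>0 u \<sigma>" for \<sigma>
    proof -
      have "continuous_on {0..T} (mass \<sigma>)"
        using that by (auto simp: weak_solution_iff intro: mass_continuous)
      from continuous_attains_sup[OF _ _ this] show ?thesis using \<open>T > 0\<close> by fastforce
    qed
    obtain K1 K2 where K: "\<And>t. t \<in> {0..T} \<Longrightarrow> mass \<sigma>1 t \<le> K1" "\<And>t. t \<in> {0..T} \<Longrightarrow> mass \<sigma>2 t \<le> K2"
      using bdd[OF sols(1)] bdd[OF sols(2)] by blast
    \<comment> \<open>The masses of two arbitrary weak solutions need not respect \<open>M\<close>
      beforehand. A level above both makes them solutions of one common clamped problem.\<close>
    define N where "N = max 0 (max K1 K2)"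
    \<comment> \<open>The mass is extended by constants beyond \<open>[0,T]\<close>, because the
      flow asks for continuity on the whole line.\<close>
    define W where "W \<sigma> t = mass \<sigma> (max 0 (min T t))" for \<sigma> t
    have W: "mass \<sigma> t \<in> {0..N} \<and> W \<sigma> t = mass \<sigma> t"
      if "\<sigma> \<in> {\<sigma>1, \<sigma>2}" "t \<in> {0..T}" for \<sigma> t
      using that sols K[OF that(2)] by (auto simp: weak_solution_iff N_def W_def)
    have "0 \<le> N" by (simp add: N_def)
    then obtain sl c C L where src: "source (\<lambda>x w. lam (clamp1 1 x) (clamp1 N w)) sl c C L T g B"
      using source by blast
    have C0: "C0_Lp 1 T \<sigma>1" "C0_Lp 1 T \<sigma>2" using sols by (auto simp: weak_solution_iff)
    have contW: "continuous_on UNIV (W \<sigma>1)" "continuous_on UNIV (W \<sigma>2)"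
      unfolding W_def by (intro continuous_on_clamp mass_continuous C0; use \<open>T > 0\<close> in simp)+
    have weak: "linear_weak (\<lambda>t x. lam (clamp1 1 x) (clamp1 N (W \<sigma> t))) T g (\<lambda>t. g (- t)) \<sigma>"
      if "\<sigma> \<in> {\<sigma>1, \<sigma>2}" for \<sigma>
      using vel[of \<sigma> N "W \<sigma>"] W[OF that] that sols by (auto simp: weak_solution_iff)
    show ?thesis
      by (rule source.solution_unique[OF src contW C0 _ _ weak weak t]) (use W in auto)
  qed
  have "AE (t, x) in lebesgue_on ({0..T} \<times> {0..1}). \<rho> t x \<ge> 0"
    using nonneg by (intro AE_I2) auto
  then show ?thesis using sol unique[OF _ sol] C0 by blast
qed

end
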